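(* Assume $u\in S^2(Q_2)$ and $P_0u=0$ in $Q_2$. Then there exists a constant $N=N(d,\delta)$ such that $$\|u\|_{L^2(Q_2)}\le N\Big(\|u\|_{L^2(Q_1)}+\|\nabla_zu\|_{L^2(Q_2)}+\|\nabla_x^2u\|_{L^2(Q_2)}\Big).$$
   Context: Points of $\mathbb{R}^{1+3d}$ are written $X=(t,x,y,z)$ with $t\in\mathbb{R}$, $x,y,z\in\mathbb{R}^d$. $B_\rho\subset\mathbb{R}^d$ is the open ball of radius $\rho$ centered at $0$, and $Q_r=(-r^2,0)\times B_r\times B_{r^3}\times B_{r^5}$. Let $\delta\in(0,1)$ and let $a^{ij}(t)$, $i,j=1,\dots,d$, be bounded measurable functions of $t$ only with $\delta|\xi|^2\le\sum_{i,j}a^{ij}(t)\xi_i\xi_j\le\delta^{-1}|\xi|^2$ for all $t\in\mathbb{R}$, $\xi\in\mathbb{R}^d$. Set $P_0u=\partial_tu-x\cdot\nabla_yu-y\cdot\nabla_zu-\sum_{i,j=1}^da^{ij}(t)\partial_{x_ix_j}u$. For open $G$, $u\in S^2(G)$ means $u,\nabla_xu,\nabla_x^2u,\ \partial_tu-x\cdot\nabla_yu-y\cdot\nabla_zu\in L^2(G)$. $N(d,\delta)$ denotes a constant depending only on $d,\delta$. *)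

theory Defs
  imports "HOL-Analysis.Analysis"
begin

section \<open>Test functions and weak derivatives\<close>

primrec C_k :: "nat \<Rightarrow> ('e::euclidean_space \<Rightarrow> real) \<Rightarrow> bool" where
  "C_k 0 f \<longleftrightarrow> continuous_on UNIV f"
| "C_k (Suc k) f \<longleftrightarrow>
     (\<forall>x. f differentiable (at x)) \<and> (\<forall>v. C_k k (\<lambda>x. frechet_derivative f (at x) v))"

definition test_function :: "'e::euclidean_space set \<Rightarrow> ('e \<Rightarrow> real) \<Rightarrow> bool" where
  "test_function G \<phi> \<longleftrightarrow>
     (\<forall>k. C_k k \<phi>) \<and> (\<exists>K. compact K \<and> K \<subseteq> G \<and> (\<forall>x. x \<notin> K \<longrightarrow> \<phi> x = 0))"

definition locally_integrable :: "'e::euclidean_space set \<Rightarrow> ('e \<Rightarrow> real) \<Rightarrow> bool" where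
  "locally_integrable G f \<longleftrightarrow> (\<forall>K. compact K \<and> K \<subseteq> G \<longrightarrow> set_integrable lebesgue K f)"

text \<open>
  \<open>weak_deriv G V u f\<close>: the distribution \<open>V \<cdot> \<nabla>u\<close> on the open set \<open>G\<close> is the function \<open>f\<close>.
  The formula is the right one only for divergence-free vector fields \<open>V\<close>, whose formal adjoint is
  \<open>- V \<cdot> \<nabla>\<close>. All fields used below are divergence-free: constant coordinate fields and the
  transport field \<open>(1, 0, - x, - y)\<close>.
\<close>

definition weak_deriv ::
  "'e::euclidean_space set \<Rightarrow> ('e \<Rightarrow> 'e) \<Rightarrow> ('e \<Rightarrow> real) \<Rightarrow> ('e \<Rightarrow> real) \<Rightarrow> bool" where
  "weak_deriv G V u f \<longleftrightarrow>
     locally_integrable G u \<and> locally_integrable G f \<and>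
     (\<forall>\<phi>. test_function G \<phi> \<longrightarrow>
        (LINT X|lebesgue_on G. u X * frechet_derivative \<phi> (at X) (V X)) =
        - (LINT X|lebesgue_on G. f X * \<phi> X))"

section \<open>The space \<open>L\<^sup>2\<close>\<close>

definition L2norm :: "'e::euclidean_space set \<Rightarrow> ('e \<Rightarrow> 'b::real_normed_vector) \<Rightarrow> ennreal" where
  "L2norm G f =
     (let I = (\<integral>\<^sup>+ X. ennreal ((norm (f X))\<^sup>2) \<partial>lebesgue_on G)
      in if I = \<infinity> then \<infinity> else ennreal (sqrt (enn2real I)))"

definition L2 :: "'e::euclidean_space set \<Rightarrow> ('e \<Rightarrow> 'b::real_normed_vector) set" where
  "L2 G = {f. f \<in> borel_measurable (lebesgue_on G) \<and> L2norm G f < \<infinity>}"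

section \<open>The kinetic setting\<close>

text \<open>Points are \<open>X = (t, x, y, z)\<close>; the dimension \<open>d\<close> is \<open>CARD('n)\<close>.\<close>

type_synonym 'n pt = "real \<times> (real^'n) \<times> (real^'n) \<times> (real^'n)"

definition Q :: "real \<Rightarrow> ('n::finite) pt set" where
  "Q r = {- (r^2)<..<0} \<times> ball 0 r \<times> ball 0 (r^3) \<times> ball 0 (r^5)"

definition weak_grad_x :: "('n::finite) pt set \<Rightarrow> ('n pt \<Rightarrow> real) \<Rightarrow> ('n pt \<Rightarrow> real^'n) \<Rightarrow> bool" where
  "weak_grad_x G u g \<longleftrightarrow> (\<forall>i. weak_deriv G (\<lambda>_. (0, axis i 1, 0, 0)) u (\<lambda>X. g X $ i))"

definition weak_grad_z :: "('n::finite) pt set \<Rightarrow> ('n pt \<Rightarrow> real) \<Rightarrow> ('n pt \<Rightarrow> real^'n) \<Rightarrow> bool" where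
  "weak_grad_z G u g \<longleftrightarrow> (\<forall>i. weak_deriv G (\<lambda>_. (0, 0, 0, axis i 1)) u (\<lambda>X. g X $ i))"

definition weak_hess_x :: "('n::finite) pt set \<Rightarrow> ('n pt \<Rightarrow> real) \<Rightarrow> ('n pt \<Rightarrow> real^'n^'n) \<Rightarrow> bool" where
  "weak_hess_x G u h \<longleftrightarrow>
     (\<exists>g. weak_grad_x G u g \<and> (\<forall>i. weak_grad_x G (\<lambda>X. g X $ i) (\<lambda>X. h X $ i)))"

definition weak_transport :: "('n::finite) pt set \<Rightarrow> ('n pt \<Rightarrow> real) \<Rightarrow> ('n pt \<Rightarrow> real) \<Rightarrow> bool" where
  "weak_transport G u f \<longleftrightarrow> weak_deriv G (\<lambda>(t, x, y, z). (1, 0, - x, - y)) u f"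

definition S2 :: "('n::finite) pt set \<Rightarrow> ('n pt \<Rightarrow> real) set" where
  "S2 G = {u. u \<in> L2 G \<and>
     (\<exists>g. weak_grad_x G u g \<and> g \<in> L2 G) \<and>
     (\<exists>h. weak_hess_x G u h \<and> h \<in> L2 G) \<and>
     (\<exists>f. weak_transport G u f \<and> f \<in> L2 G)}"

text \<open>
  Weak derivatives are unique up to null sets, so the infima below are attained by any weak
  derivative; they equal \<open>\<infinity>\<close> if the weak derivative does not exist as a function.
  The norm on \<open>real^'n^'n\<close> is the Frobenius norm.
\<close>

definition grad_z_L2norm :: "('n::finite) pt set \<Rightarrow> ('n pt \<Rightarrow> real) \<Rightarrow> ennreal" where
  "grad_z_L2norm G u = (INF g\<in>{g. weak_grad_z G u g}. L2norm G g)"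

definition hess_x_L2norm :: "('n::finite) pt set \<Rightarrow> ('n pt \<Rightarrow> real) \<Rightarrow> ennreal" where
  "hess_x_L2norm G u = (INF h\<in>{h. weak_hess_x G u h}. L2norm G h)"

definition admissible_coeff :: "real \<Rightarrow> (real \<Rightarrow> real^'n^'n::finite) \<Rightarrow> bool" where
  "admissible_coeff \<delta> a \<longleftrightarrow>
     (\<forall>i j. (\<lambda>t. a t $ i $ j) \<in> borel_measurable lebesgue \<and> bounded (range (\<lambda>t. a t $ i $ j))) \<and>
     (\<forall>t \<xi>. \<delta> * (norm \<xi>)\<^sup>2 \<le> (\<Sum>i\<in>UNIV. \<Sum>j\<in>UNIV. a t $ i $ j * \<xi> $ i * \<xi> $ j) \<and>
            (\<Sum>i\<in>UNIV. \<Sum>j\<in>UNIV. a t $ i $ j * \<xi> $ i * \<xi> $ j) \<le> inverse \<delta> * (norm \<xi>)\<^sup>2)"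

text \<open>\<open>weak_P0 a G u p\<close>: \<open>p\<close> is a version of \<open>P\<^sub>0 u\<close> on \<open>G\<close>.\<close>

definition weak_P0 ::
  "(real \<Rightarrow> real^'n^'n::finite) \<Rightarrow> 'n pt set \<Rightarrow> ('n pt \<Rightarrow> real) \<Rightarrow> ('n pt \<Rightarrow> real) \<Rightarrow> bool" where
  "weak_P0 a G u p \<longleftrightarrow>
     (\<exists>f h. weak_transport G u f \<and> weak_hess_x G u h \<and>
        p = (\<lambda>X. f X - (\<Sum>i\<in>UNIV. \<Sum>j\<in>UNIV. a (fst X) $ i $ j * h X $ i $ j)))"

end

theory Submission
  imports Defs
begin

text \<open>
  Why the estimate holds. The equation expresses \<open>\<partial>\<^sub>t u - x \<cdot> \<nabla>\<^sub>y u - y \<cdot> \<nabla>\<^sub>z u\<close> by second derivatives in \<open>x\<close>, and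
  \<open>y\<close> is bounded on \<open>Q 2\<close>; so the right hand side of the estimate controls \<open>u\<close> on \<open>Q 1\<close>, the derivative of \<open>u\<close> along
  the field \<open>(1, 0, - x, 0)\<close>, the derivatives in \<open>z\<close>, and the second derivatives in \<open>x\<close>
  (\<open>solution_controlled\<close>). If all these quantities vanish, then \<open>u\<close> is constant along the straight lines
  \<open>(t + s, x, y - s x, z)\<close> and in \<open>z\<close>, affine in \<open>x\<close>, and zero on \<open>Q 1\<close>. It then vanishes on \<open>Q 2\<close>: affinity
  extends the zero set to all \<open>\<bar>x\<bar> < 2\<close>, hence velocities of norm up to \<open>2\<close> may be used on the lines, moving back and
  forth in time they reach every \<open>y\<close>, and then all times. The proof makes this argument quantitative.

  The quantitative form works on the dual side. A point \<open>p\<close> of the closure of \<open>Q 2\<close> is called \<open>good\<close> if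
  \<open>\<bar>\<integral> u \<psi>\<bar> \<le> N M \<parallel>\<psi>\<parallel>\<close> holds for test functions \<open>\<psi>\<close> supported in \<open>Q 2\<close> near \<open>p\<close>, where \<open>M\<close> is the size of the data. Along the
  flow of a field \<open>V\<close> with weak derivative \<open>V u = f\<close>, the pairing of \<open>u\<close> with the transported test function has the
  derivative \<open>\<integral> f \<psi>\<^sub>s\<close>, which the Cauchy-Schwarz inequality bounds (\<open>transport_integral_bound\<close>). So goodness moves
  along the two kinds of lines (\<open>good_move\<close>), and by second differences in the \<open>x\<close> directions (\<open>good_x_second\<close>).
  The fields are chosen so that their integral curves are straight; the convexity of \<open>Q 2\<close> keeps all paths inside \<open>Q 2\<close>, also near its boundary, so
  that the whole compact closure consists of good points (\<open>good_closure_Q2\<close>).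

  Finitely many neighbourhoods of good points cover \<open>Q 2\<close>. On each, the dual bound gives a bound of the
  square integral (\<open>L2_bound_by_duality\<close>), because bounded measurable functions are limits of test functions.
  The sum is the estimate \<open>controlled_L2_bound\<close>. The same duality, applied to differences of weak Hessians, shows that
  the Hessian is symmetric and unique, so that the ellipticity bounds, which see only the symmetric part
  of the coefficients, suffice to bound the diffusion term (\<open>diffusion_term_bound\<close>).
\<close>

section \<open>Calculus of smooth functions\<close>

text \<open>
Closure properties of smoothness are proved by induction on the order of differentiability, for each order
separately: the derivative of a product or of a composition is built from functions of one order less.
\<close>

definition smooth :: "('e::euclidean_space \<Rightarrow> real) \<Rightarrow> bool" where
  "smooth f \<longleftrightarrow> (\<forall>k. C_k k f)"

abbreviation dderiv :: "'e::euclidean_space \<Rightarrow> ('e \<Rightarrow> real) \<Rightarrow> 'e \<Rightarrow> real" where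
  "dderiv v f \<equiv> (\<lambda>x. frechet_derivative f (at x) v)"

lemma C_k_SucI:
  assumes "\<And>x. (f has_derivative f' x) (at x)" "\<And>v. C_k k (\<lambda>x. f' x v)"
  shows "C_k (Suc k) f"
proof -
  have "frechet_derivative f (at x) = f' x" for x
    using frechet_derivative_at[OF assms(1)] by simp
  then show ?thesis using assms by (auto simp: differentiable_def)
qed

lemma C_k_has_derivative:
  assumes "C_k (Suc k) f" shows "(f has_derivative frechet_derivative f (at x)) (at x)"
  using assms by (simp add: frechet_derivative_works)

lemma C_k_continuous: "C_k k f \<Longrightarrow> continuous_on UNIV f"
  by (cases k) (auto intro!: continuous_at_imp_continuous_on differentiable_imp_continuous_within)

lemma C_k_lower: "C_k (Suc k) f \<Longrightarrow> C_k k f"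
proof (induction k arbitrary: f)
  case 0 show ?case using C_k_continuous[OF 0] by simp
next
  case (Suc k) then show ?case by (metis C_k.simps(2))
qed

lemma C_k_const: "C_k k (\<lambda>x. c)"
  by (induction k arbitrary: c) (auto intro!: C_k_SucI[where f'="\<lambda>x v. 0"] simp del: C_k.simps(2))

lemma C_k_linear: assumes "bounded_linear l" shows "C_k k l"
  by (cases k) (auto intro!: C_k_SucI[where f'="\<lambda>x. l"] C_k_const bounded_linear_imp_has_derivative assms
      linear_continuous_on simp del: C_k.simps(2))

lemma C_k_add: "C_k k f \<Longrightarrow> C_k k g \<Longrightarrow> C_k k (\<lambda>x. f x + g x)"
proof (induction k arbitrary: f g)
  case 0 then show ?case by (auto intro: continuous_intros)
next
  case (Suc k)
  then show ?case
    by (intro C_k_SucI[where f'="\<lambda>x v. frechet_derivative f (at x) v + frechet_derivative g (at x) v"])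
      (auto intro!: derivative_intros C_k_has_derivative simp del: C_k.simps(2), auto)
qed

lemma C_k_mult: "C_k k f \<Longrightarrow> C_k k g \<Longrightarrow> C_k k (\<lambda>x. f x * g x)"
proof (induction k arbitrary: f g)
  case 0 then show ?case by (auto intro: continuous_intros)
next
  case (Suc k)
  have "C_k k f" "C_k k g" using Suc.prems C_k_lower by blast+
  moreover have "C_k k (dderiv v f)" "C_k k (dderiv v g)" for v using Suc.prems by auto
  ultimately have "C_k k (\<lambda>x. f x * frechet_derivative g (at x) v + frechet_derivative f (at x) v * g x)" for v
    by (intro C_k_add Suc.IH)
  then show ?case
    by (intro C_k_SucI[OF has_derivative_mult]) (use Suc.prems C_k_has_derivative in blast)+
qed

text \<open>
Derivatives of \<open>f \<circ> (L + b)\<close> are directional derivatives of \<open>f\<close> at the moved point, in the moved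
direction \<open>L v\<close>, so the induction hypothesis applies to them. This makes the transport of a test
function along an affine flow a test function again.
\<close>

lemma C_k_affine_comp:
  assumes "bounded_linear L"
  shows "C_k k f \<Longrightarrow> C_k k (\<lambda>x. f (L x + b))"
proof (induction k arbitrary: f)
  case 0 then show ?case
    using continuous_on_compose[of UNIV "\<lambda>x. L x + b" f] linear_continuous_on[OF assms]
    by (auto intro!: continuous_intros continuous_on_compose2[of UNIV f])
next
  case (Suc k)
  have aff: "((\<lambda>x. L x + b) has_derivative L) (at x)" for x
    using bounded_linear_imp_has_derivative[OF assms] by (auto intro!: derivative_eq_intros)
  have "((\<lambda>x. f (L x + b)) has_derivative (\<lambda>v. frechet_derivative f (at (L x + b)) (L v))) (at x)" for x
    using has_derivative_compose[OF aff C_k_has_derivative[OF Suc.prems]] by simp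
  moreover have "C_k k (\<lambda>x. frechet_derivative f (at (L x + b)) (L v))" for v
    using Suc by auto
  ultimately show ?case by (intro C_k_SucI)
qed

named_theorems smooth_intros

lemma smooth_const [smooth_intros]: "smooth (\<lambda>x. c)" by (simp add: smooth_def C_k_const)
lemma smooth_linear: "bounded_linear l \<Longrightarrow> smooth l" by (simp add: smooth_def C_k_linear)
lemma smooth_add [smooth_intros]: "smooth f \<Longrightarrow> smooth g \<Longrightarrow> smooth (\<lambda>x. f x + g x)" by (simp add: smooth_def C_k_add)
lemma smooth_mult [smooth_intros]: "smooth f \<Longrightarrow> smooth g \<Longrightarrow> smooth (\<lambda>x. f x * g x)" by (simp add: smooth_def C_k_mult)
lemma smooth_affine_comp: "smooth f \<Longrightarrow> bounded_linear L \<Longrightarrow> smooth (\<lambda>x. f (L x + b))"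
  by (simp add: smooth_def C_k_affine_comp)
lemma smooth_minus [smooth_intros]: "smooth f \<Longrightarrow> smooth (\<lambda>x. - f x)"
  using smooth_mult[of "\<lambda>_. -1" f] smooth_const by auto
lemma smooth_diff [smooth_intros]: "smooth f \<Longrightarrow> smooth g \<Longrightarrow> smooth (\<lambda>x. f x - g x)"
  using smooth_add[of f "\<lambda>x. - g x"] smooth_minus[of g] by auto
lemma smooth_sum [smooth_intros]: "(\<And>i. i \<in> I \<Longrightarrow> smooth (f i)) \<Longrightarrow> smooth (\<lambda>x. \<Sum>i\<in>I. f i x)"
  by (induction I rule: infinite_finite_induct) (auto intro: smooth_intros)
lemma smooth_prod [smooth_intros]: "(\<And>i. i \<in> I \<Longrightarrow> smooth (f i)) \<Longrightarrow> smooth (\<lambda>x. \<Prod>i\<in>I. f i x)"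
  by (induction I rule: infinite_finite_induct) (auto intro: smooth_intros)
lemma smooth_power [smooth_intros]: "smooth f \<Longrightarrow> smooth (\<lambda>x. f x ^ n)"
  by (induction n) (auto intro: smooth_intros)
lemma smooth_dderiv [smooth_intros]: "smooth f \<Longrightarrow> smooth (dderiv v f)"
  unfolding smooth_def by (metis C_k.simps(2))
lemma smooth_has_derivative: "smooth f \<Longrightarrow> (f has_derivative frechet_derivative f (at x)) (at x)"
  unfolding smooth_def using C_k_has_derivative by blast
lemma smooth_continuous: "smooth f \<Longrightarrow> continuous_on UNIV f"
  unfolding smooth_def using C_k_continuous by blast

lemma smooth_real_polynomial: "real_polynomial_function p \<Longrightarrow> smooth p"
  by (induction rule: real_polynomial_function.induct) (auto intro: smooth_intros smooth_linear)

section \<open>Cutoff functions\<close>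

text \<open>
The functions \<open>p (1/s) exp (- 1/s)\<close> on \<open>s > 0\<close>, extended by zero, for all polynomials \<open>p\<close> at once:
this family is closed under differentiation, so the smoothness of \<open>exp (- 1/s)\<close> at the origin
reduces to the first derivative of each member.
\<close>

definition flat :: "real poly \<Rightarrow> real \<Rightarrow> real" where
  "flat p s = (if s \<le> 0 then 0 else poly p (1/s) * exp (-(1/s)))"

lemma tendsto_poly_div_exp_0: "((\<lambda>w::real. poly p w * exp (-w)) \<longlongrightarrow> 0) at_top"
proof -
  have "((\<lambda>w::real. \<Sum>i\<le>degree p. coeff p i * (w^i / exp w)) \<longlongrightarrow> (\<Sum>i\<le>degree p. coeff p i * 0)) at_top"
    by (intro tendsto_intros tendsto_power_div_exp_0)
  then show ?thesis by (simp add: poly_altdef exp_minus divide_inverse sum_distrib_right mult.assoc)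
qed

lemma flat_tendsto_0: "(flat p \<longlongrightarrow> 0) (at 0)"
proof -
  have "(flat p \<longlongrightarrow> 0) (at_right 0)"
  proof (rule Lim_transform_eventually)
    show "((\<lambda>s. poly p (inverse s) * exp (-(inverse s))) \<longlongrightarrow> 0) (at_right 0)"
      by (rule filterlim_compose[OF tendsto_poly_div_exp_0 filterlim_inverse_at_top_right])
    show "\<forall>\<^sub>F s in at_right 0. poly p (inverse s) * exp (- inverse s) = flat p s"
      using eventually_at_right_less[of 0] by eventually_elim (auto simp: flat_def divide_inverse)
  qed
  moreover have "(flat p \<longlongrightarrow> 0) (at_left 0)"
    by (rule tendsto_eventually) (auto simp: flat_def eventually_at_left_field intro!: exI[of _ "-1"])
  ultimately show ?thesis by (simp add: filterlim_at_split)
qed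

text \<open>
On \<open>s > 0\<close> this is the product rule. At \<open>0\<close> the difference quotient of \<open>flat p\<close> is \<open>flat (X p)\<close>, which
tends to \<open>0\<close> because the exponential beats every polynomial.
\<close>

lemma flat_has_derivative:
  "(flat p has_real_derivative flat ([:0,0,1:] * (p - pderiv p)) s) (at s)"
proof -
  consider "s < 0" | "s = 0" | "s > 0" by linarith
  then show ?thesis
  proof cases
    case 1
    have "((\<lambda>s. 0) has_real_derivative 0) (at s)" by simp
    then have "(flat p has_real_derivative 0) (at s)"
      by (rule has_field_derivative_transform_within_open[of _ _ _ "{..<0}"]) (use 1 in \<open>auto simp: flat_def\<close>)
    then show ?thesis using 1 by (simp add: flat_def)
  next
    case 2
    have "((\<lambda>h. (flat p h - flat p 0) / (h - 0)) \<longlongrightarrow> 0) (at 0)"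
    proof (rule Lim_transform_eventually[OF flat_tendsto_0])
      show "\<forall>\<^sub>F h in at 0. flat ([:0,1:] * p) h = (flat p h - flat p 0) / (h - 0)"
        by (auto simp: eventually_at flat_def intro!: exI[of _ 1])
    qed
    then have "(flat p has_real_derivative 0) (at 0)"
      by (simp add: has_field_derivative_iff)
    then show ?thesis using 2 by (simp add: flat_def)
  next
    case 3
    have "((\<lambda>s. poly p (1/s) * exp (-(1/s))) has_real_derivative
       poly p (1/s) * (exp (-(1/s)) * (1/s^2)) + (poly (pderiv p) (1/s) * (-(1/s^2))) * exp (-(1/s))) (at s)"
      using 3 by (auto intro!: derivative_eq_intros DERIV_chain2[OF poly_DERIV] simp: power2_eq_square field_simps)
    then have "(flat p has_real_derivative
       poly p (1/s) * (exp (-(1/s)) * (1/s^2)) + (poly (pderiv p) (1/s) * (-(1/s^2))) * exp (-(1/s))) (at s)"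
      by (rule has_field_derivative_transform_within_open[of _ _ _ "{0<..}"]) (use 3 in \<open>auto simp: flat_def\<close>)
    then show ?thesis using 3 by (simp add: flat_def algebra_simps power2_eq_square diff_divide_distrib)
  qed
qed

lemma C_k_flat: "C_k k g \<Longrightarrow> C_k k (\<lambda>x. flat p (g x))"
proof (induction k arbitrary: p)
  case 0
  have "continuous_on UNIV (flat p)"
    by (meson DERIV_continuous_on flat_has_derivative has_field_derivative_at_within)
  then show ?case using 0 by (auto intro: continuous_on_compose2[of UNIV "flat p"])
next
  case (Suc k)
  let ?q = "[:0,0,1:] * (p - pderiv p)"
  have "((\<lambda>x. flat p (g x)) has_derivative (\<lambda>v. frechet_derivative g (at x) v * flat ?q (g x))) (at x)" for x
    using has_derivative_compose[OF C_k_has_derivative[OF Suc.prems] flat_has_derivative[of p, unfolded has_field_derivative_def]]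
    by (simp add: mult.commute)
  moreover have "C_k k (\<lambda>x. frechet_derivative g (at x) v * flat ?q (g x))" for v
    using Suc.IH[OF C_k_lower[OF Suc.prems], of ?q] Suc.prems by (intro C_k_mult) auto
  ultimately show ?case by (intro C_k_SucI)
qed

lemma smooth_flat: "smooth g \<Longrightarrow> smooth (\<lambda>x. flat p (g x))"
  by (simp add: smooth_def C_k_flat)

lemma test_function_smooth:
  "test_function G \<phi> \<longleftrightarrow> smooth \<phi> \<and> (\<exists>K. compact K \<and> K \<subseteq> G \<and> (\<forall>x. x \<notin> K \<longrightarrow> \<phi> x = 0))"
  by (simp add: test_function_def smooth_def)

lemma exists_bump:
  fixes p :: "'e::euclidean_space"
  obtains b where "smooth b" "\<And>x. 0 \<le> b x \<and> b x \<le> 1" "\<And>x. 0 < b x \<longleftrightarrow> x \<in> ball p r"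
proof
  \<comment> \<open>The case distinction makes \<open>b\<close> vanish when the ball is empty; the square of a negative \<open>r\<close> would not.\<close>
  let ?b = "\<lambda>x. flat 1 (if r > 0 then (r^2 - (\<Sum>i\<in>Basis. ((x - p)\<bullet>i)^2)) else 0)"
  have *: "(\<Sum>i\<in>Basis. ((x - p)\<bullet>i)^2) = (norm (x - p))^2" for x
    unfolding power2_norm_eq_inner euclidean_inner[of "x-p" "x-p"] by (simp only: power2_eq_square)
  have "smooth (\<lambda>x::'e. (x - p) \<bullet> i)" for i
    unfolding inner_diff_left by (intro smooth_diff smooth_const smooth_linear bounded_linear_inner_left)
  then have "smooth (\<lambda>x::'e. r^2 - (\<Sum>i\<in>Basis. ((x - p)\<bullet>i)^2))"
    by (intro smooth_diff smooth_sum smooth_power smooth_const)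
  then show "smooth ?b" by (intro smooth_flat) (cases "r > 0"; simp add: smooth_const)
  show "0 \<le> ?b x \<and> ?b x \<le> 1" for x by (auto simp: flat_def)
  show "0 < ?b x \<longleftrightarrow> x \<in> ball p r" for x
  proof (cases "r > 0")
    case True
    have "(norm (x - p))^2 < r^2 \<longleftrightarrow> norm (x - p) < r"
      using True by (metis less_imp_le norm_ge_zero not_le power2_le_imp_le power_mono)
    then show ?thesis unfolding * using True by (auto simp: flat_def dist_norm norm_minus_commute)
  next
    case False
    then have "x \<notin> ball p r" by (metis ball_eq_empty empty_iff not_le)
    with False show ?thesis by (simp add: flat_def)
  qed
qed

text \<open>
Cover \<open>A\<close> by countably many balls with closures in \<open>A\<close>, with bumps \<open>b i\<close> positive exactly on them. In
\<open>1 - (\<Prod>i<n. (1 - b i)^n)\<close> only finitely many balls occur, so it has compact support in \<open>A\<close>; at a point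
of ball number \<open>j\<close> the product is at most \<open>(1 - b j)^n\<close> and tends to \<open>0\<close>.
\<close>

lemma cutoff_sequence:
  fixes A :: "'e::euclidean_space set"
  assumes "open A"
  obtains c where "\<And>n. test_function A (c n)" "\<And>n x. 0 \<le> c n x \<and> c n x \<le> 1"
    "\<And>x. x \<in> A \<Longrightarrow> (\<lambda>n. c n x) \<longlonglongrightarrow> 1"
proof -
  define F where "F = {ball p r | p r. cball p r \<subseteq> A \<and> r > (0::real)}"
  have "\<Union>F = A"
  proof -
    have "x \<in> \<Union>F" if x: "x \<in> A" for x
    proof -
      obtain e where e: "e > 0" "cball x e \<subseteq> A"
        using open_contains_cball_eq[OF assms] x by metis
      then have "ball x e \<in> F" unfolding F_def by blast
      then show ?thesis using e(1) by (meson UnionI centre_in_ball)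
    qed
    moreover have "x \<in> A" if x: "x \<in> \<Union>F" for x
    proof -
      obtain p r where "x \<in> ball p r" "cball p r \<subseteq> A"
        using x unfolding F_def by (smt (verit) UnionE mem_Collect_eq)
      then show ?thesis by (meson ball_subset_cball subsetD)
    qed
    ultimately show ?thesis by blast
  qed
  moreover obtain F' where F': "F' \<subseteq> F" "countable F'" "\<Union>F' = \<Union>F"
  proof -
    have "open S" if "S \<in> F" for S
    proof -
      from that[unfolded F_def mem_Collect_eq] obtain p r where "S = ball p r" by (elim exE conjE)
      then show ?thesis by simp
    qed
    from Lindelof[OF this] show thesis using that by metis
  qed
  ultimately have FA: "\<Union>F' = A" by simp
  \<comment> \<open>The empty set is added so that the enumeration exists even when \<open>A\<close>, and so \<open>F'\<close>, is empty.\<close>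
  define B where "B = from_nat_into (insert {} F')"
  have rB: "range B = insert {} F'" unfolding B_def
    by (rule range_from_nat_into) (simp_all add: F'(2))
  have "\<exists>p r. B i = ball p r \<and> cball p r \<subseteq> A" for i
  proof -
    have "B i \<in> insert {} F'" using rB by blast
    moreover have ?thesis if "B i = {}"
    proof -
      have e: "ball (0::'e) (-1) = {}" "cball (0::'e) (-1) = {}" by (auto intro: ball_empty cball_empty)
      have "B i = ball 0 (-1) \<and> cball 0 (-1) \<subseteq> A" unfolding e using that by simp
      then show ?thesis by blast
    qed
    moreover have ?thesis if "B i \<in> F'"
    proof -
      from that have "B i \<in> F" by (rule subsetD[OF F'(1)])
      then show ?thesis unfolding F_def by (smt (verit) mem_Collect_eq)
    qed
    ultimately show ?thesis by blast
  qed
  then obtain p r where pr: "\<And>i. B i = ball (p i) (r i)" "\<And>i. cball (p i) (r i) \<subseteq> A" by metis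
  have "\<exists>b. smooth b \<and> (\<forall>x. 0 \<le> b x \<and> b x \<le> 1) \<and> (\<forall>x. 0 < b x \<longleftrightarrow> x \<in> B i)" for i
    by (rule exists_bump[of "p i" "r i"]) (unfold pr(1), blast)
  then obtain b where b: "\<And>i. smooth (b i)" "\<And>i x. 0 \<le> b i x" "\<And>i x. b i x \<le> 1" "\<And>i x. 0 < b i x \<longleftrightarrow> x \<in> B i"
    by metis
  have bp: "0 \<le> (1 - b i x)^n" "(1 - b i x)^n \<le> 1" for i x n
    using b(2)[of i x] b(3)[of i x] by (auto intro: power_le_one)
  define c where "c = (\<lambda>n x. 1 - (\<Prod>i<n. (1 - b i x)^n))"
  show thesis
  proof
    show "test_function A (c n)" for n
    proof -
      have "smooth (c n)" unfolding c_def by (intro smooth_diff smooth_prod smooth_power smooth_const b)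
      moreover have "compact (\<Union>i<n. cball (p i) (r i))" by (intro compact_UN) auto
      moreover have "c n x = 0" if nx: "x \<notin> (\<Union>i<n. cball (p i) (r i))" for x
      proof -
        have "b i x = 0" if "i < n" for i
        proof -
          have "x \<notin> cball (p i) (r i)" using nx that by auto
          then have "x \<notin> B i" unfolding pr(1) using ball_subset_cball by blast
          then show ?thesis using b(2)[of i x] b(4)[of i x] by linarith
        qed
        then show ?thesis by (simp add: c_def)
      qed
      moreover have "(\<Union>i<n. cball (p i) (r i)) \<subseteq> A" using pr(2) by auto
      ultimately show ?thesis unfolding test_function_smooth by blast
    qed
    show "0 \<le> c n x \<and> c n x \<le> 1" for n x
    proof -
      have "(\<Prod>i<n. (1 - b i x)^n) \<le> 1" by (rule prod_le_1) (simp add: bp)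
      moreover have "0 \<le> (\<Prod>i<n. (1 - b i x)^n)" by (rule prod_nonneg) (simp add: bp)
      ultimately show ?thesis by (simp add: c_def)
    qed
    show "(\<lambda>n. c n x) \<longlonglongrightarrow> 1" if x: "x \<in> A" for x
    proof -
      obtain j where j: "x \<in> B j" using x FA rB by blast
      have "(\<lambda>n. \<Prod>i<n. (1 - b i x)^n) \<longlonglongrightarrow> 0"
      proof (rule tendsto_sandwich[of "\<lambda>_. 0" _ _ "\<lambda>n. (1 - b j x)^n"])
        show "\<forall>\<^sub>F n in sequentially. 0 \<le> (\<Prod>i<n. (1 - b i x)^n)"
          by (intro always_eventually allI prod_nonneg) (simp add: bp)
        show "\<forall>\<^sub>F n in sequentially. (\<Prod>i<n. (1 - b i x)^n) \<le> (1 - b j x)^n"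
          using eventually_gt_at_top[of j]
        proof eventually_elim
          case (elim n)
          have "(\<Prod>i<n. (1 - b i x)^n) = (1 - b j x)^n * (\<Prod>i\<in>{..<n}-{j}. (1 - b i x)^n)"
            using elim by (intro prod.remove) auto
          also have "\<dots> \<le> (1 - b j x)^n * 1"
            by (intro mult_left_mono prod_le_1) (auto simp: bp)
          finally show ?case by simp
        qed
        show "(\<lambda>n. (1 - b j x)^n) \<longlonglongrightarrow> 0"
          using b(3,4)[where i=j and x=x] j by (intro LIMSEQ_power_zero) auto
      qed auto
      then show ?thesis unfolding c_def using tendsto_diff[OF tendsto_const[of 1]] by fastforce
    qed
  qed
qed

section \<open>Approximation by test functions\<close>

text \<open>
A Lebesgue measurable function is almost everywhere a limit of continuous functions; on the compact
support of the cutoff these are replaced by polynomials (Stone-Weierstrass), and a polynomial times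
a cutoff is a test function.
\<close>

lemma test_function_approx:
  fixes f :: "'e::euclidean_space \<Rightarrow> real"
  assumes f: "f \<in> borel_measurable lebesgue" "\<And>x. \<bar>f x\<bar> \<le> B" and c: "test_function A c"
  obtains \<psi> where "\<And>n. test_function A (\<psi> n)" "\<And>n x. \<bar>\<psi> n x\<bar> \<le> (B + 1) * \<bar>c x\<bar>"
    "AE x in lebesgue. (\<lambda>n. \<psi> n x) \<longlonglongrightarrow> c x * f x"
proof -
  have B: "B \<ge> 0" using f(2)[of undefined] by linarith
  obtain K where K: "smooth c" "compact K" "K \<subseteq> A" "\<And>x. x \<notin> K \<Longrightarrow> c x = 0"
    using c unfolding test_function_smooth by blast
  have "f measurable_on UNIV" using f(1) measurable_on_iff_borel_measurable[of UNIV f] by simp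
  then obtain N g where N: "negligible N" and g: "\<And>n. continuous_on UNIV (g n)"
    "\<And>x. x \<notin> N \<Longrightarrow> (\<lambda>n. g n x) \<longlonglongrightarrow> f x"
    unfolding measurable_on_def by force
  \<comment> \<open>Clamping keeps the limit, as \<open>\<bar>f\<bar> \<le> B\<close>, and makes the approximants uniformly bounded.\<close>
  define h where "h = (\<lambda>n x. max (-B) (min B (g n x)))"
  have "\<exists>q. real_polynomial_function q \<and> (\<forall>x\<in>K. \<bar>h n x - q x\<bar> < 1 / Suc n)" for n
  proof -
    have "continuous_on K (h n)" unfolding h_def
      by (intro continuous_intros continuous_on_subset[OF g(1)]) auto
    moreover have "0 < 1 / real (Suc n)" by simp
    ultimately obtain q where "real_polynomial_function q" "\<And>x. x \<in> K \<Longrightarrow> \<bar>h n x - q x\<bar> < 1 / Suc n"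
      using Stone_Weierstrass_real_polynomial_function[OF K(2)] by blast
    then show ?thesis by blast
  qed
  then obtain q where q: "\<And>n. real_polynomial_function (q n)" "\<And>n x. x \<in> K \<Longrightarrow> \<bar>h n x - q n x\<bar> < 1 / Suc n"
    by metis
  have qb: "\<bar>q n x\<bar> \<le> B + 1" if "x \<in> K" for n x
  proof -
    have "1 / real (Suc n) \<le> 1" by simp
    moreover have "\<bar>h n x\<bar> \<le> B" using B by (auto simp: h_def)
    ultimately show ?thesis using q(2)[OF that, of n] by linarith
  qed
  show thesis
  proof
    show "test_function A (\<lambda>x. c x * q n x)" for n
      unfolding test_function_smooth
      using K smooth_mult[OF K(1) smooth_real_polynomial[OF q(1)]] by (auto intro!: exI[of _ K])
    show "\<bar>c x * q n x\<bar> \<le> (B+1) * \<bar>c x\<bar>" for n x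
      using qb[of x n] K(4)[of x] by (cases "x \<in> K") (auto simp: abs_mult mult.commute mult_left_mono)
    have "(\<lambda>n. c x * q n x) \<longlonglongrightarrow> c x * f x" if "x \<notin> N" for x
    proof (cases "x \<in> K")
      case True
      have "(\<lambda>n. h n x) \<longlonglongrightarrow> max (-B) (min B (f x))"
        unfolding h_def by (intro tendsto_intros g that)
      then have "(\<lambda>n. h n x) \<longlonglongrightarrow> f x" using f(2)[of x] by (auto simp: abs_le_iff max_def min_def split: if_splits)
      moreover have "(\<lambda>n. h n x - q n x) \<longlonglongrightarrow> 0"
        by (rule Lim_null_comparison[OF _ lim_1_over_n[THEN LIMSEQ_Suc]])
           (use q(2)[OF True] in \<open>auto intro!: always_eventually less_imp_le\<close>)
      ultimately have "(\<lambda>n. h n x - (h n x - q n x)) \<longlonglongrightarrow> f x - 0" by (intro tendsto_diff)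
      then show ?thesis by (auto intro: tendsto_intros)
    qed (simp add: K)
    then show "AE x in lebesgue. (\<lambda>n. c x * q n x) \<longlonglongrightarrow> c x * f x"
      using N unfolding eventually_ae_filter negligible_iff_null_sets by auto
  qed
qed

section \<open>Weak derivatives and pairings with test functions\<close>

lemma open_imp_lebesgue: "open (G :: 'e::euclidean_space set) \<Longrightarrow> G \<in> sets lebesgue"
  by auto

lemma frechet_derivative_zero_outside:
  fixes \<phi> :: "'e::euclidean_space \<Rightarrow> real"
  assumes "closed K" "\<And>x. x \<notin> K \<Longrightarrow> \<phi> x = 0" "x \<notin> K"
  shows "frechet_derivative \<phi> (at x) = (\<lambda>_. 0)"
proof -
  have "(\<phi> has_derivative (\<lambda>_. 0)) (at x)"
    by (rule has_derivative_transform_within_open[where f="\<lambda>_. 0" and s="- K"]) (use assms in auto)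
  then show ?thesis by (rule frechet_derivative_at[symmetric])
qed

text \<open>
Pairings with functions supported in \<open>G\<close> may be computed on the whole space. This removes the set
\<open>G\<close> from all integrals, so that test functions can be moved around freely.
\<close>

lemma integral_lebesgue_on_support:
  assumes "G \<in> sets lebesgue" "\<And>x. x \<notin> G \<Longrightarrow> \<phi> x = (0::real)"
  shows "(LINT X|lebesgue_on G. u X * \<phi> X) = (LINT X|lebesgue. u X * \<phi> X)"
proof -
  have "(LINT X|lebesgue_on G. u X * \<phi> X) = (LINT X|lebesgue. indicator G X *\<^sub>R (u X * \<phi> X))"
    using assms(1) by (intro integral_restrict_space) auto
  also have "\<dots> = (LINT X|lebesgue. u X * \<phi> X)"
    by (rule Bochner_Integration.integral_cong) (use assms(2) in \<open>auto simp: indicator_def\<close>)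
  finally show ?thesis .
qed

lemma weak_deriv_apply:
  assumes "weak_deriv G V u f" "open G" "test_function G \<phi>"
  shows "(LINT X|lebesgue. u X * frechet_derivative \<phi> (at X) (V X)) = - (LINT X|lebesgue. f X * \<phi> X)"
proof -
  obtain K where K: "compact K" "K \<subseteq> G" "\<And>x. x \<notin> K \<Longrightarrow> \<phi> x = 0"
    using assms(3) unfolding test_function_smooth by blast
  have G: "G \<in> sets lebesgue" using assms(2) by auto
  have "frechet_derivative \<phi> (at X) (V X) = 0" if "X \<notin> G" for X
  proof -
    have "X \<notin> K" using K(2) that by blast
    then show ?thesis using frechet_derivative_zero_outside[OF compact_imp_closed[OF K(1)], of \<phi> X] K(3) by simp
  qed
  moreover have "\<phi> X = 0" if "X \<notin> G" for X using K that by blast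
  moreover have "(LINT X|lebesgue_on G. u X * frechet_derivative \<phi> (at X) (V X)) = - (LINT X|lebesgue_on G. f X * \<phi> X)"
    by (rule assms(1)[unfolded weak_deriv_def, THEN conjunct2, THEN conjunct2, rule_format, OF assms(3)])
  ultimately show ?thesis
    using integral_lebesgue_on_support[OF G, of "\<lambda>X. frechet_derivative \<phi> (at X) (V X)" u]
      integral_lebesgue_on_support[OF G, of \<phi> f] by simp
qed

lemma bounded_of_compact_support:
  fixes g :: "'e::euclidean_space \<Rightarrow> real"
  assumes "continuous_on UNIV g" "compact K" "\<And>x. x \<notin> K \<Longrightarrow> g x = 0"
  obtains B where "B \<ge> 0" "\<And>x. \<bar>g x\<bar> \<le> B"
proof -
  have "compact (g ` K)" using assms by (intro compact_continuous_image) (auto intro: continuous_on_subset)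
  then obtain B where B: "\<forall>y\<in>g ` K. norm y \<le> B" using compact_imp_bounded bounded_iff by metis
  show thesis
  proof (rule that[of "max 0 B"])
    show "\<bar>g x\<bar> \<le> max 0 B" for x using B assms(3)[of x] by (cases "x \<in> K") (auto simp: le_max_iff_disj)
  qed simp
qed

lemma continuous_imp_lebesgue_measurable:
  fixes g :: "'e::euclidean_space \<Rightarrow> real"
  assumes "continuous_on UNIV g" shows "g \<in> borel_measurable lebesgue"
  using borel_measurable_continuous_onI[OF assms] by (intro measurable_completion) simp

lemma integrable_mult_compact_support:
  fixes g :: "'e::euclidean_space \<Rightarrow> real"
  assumes "set_integrable lebesgue K u" "compact K" "continuous_on UNIV g" "\<And>x. x \<notin> K \<Longrightarrow> g x = 0"
  shows "integrable lebesgue (\<lambda>x. u x * g x)"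
proof -
  obtain B where B: "B \<ge> 0" "\<And>x. \<bar>g x\<bar> \<le> B" using bounded_of_compact_support[OF assms(3,2,4)] by blast
  have i: "integrable lebesgue (\<lambda>x. indicator K x *\<^sub>R u x)" using assms(1) unfolding set_integrable_def .
  have e: "u x * g x = (indicator K x *\<^sub>R u x) * g x" for x using assms(4)[of x] by (cases "x \<in> K") auto
  have g: "g \<in> borel_measurable lebesgue"
    by (rule continuous_imp_lebesgue_measurable[OF assms(3)])
  show ?thesis unfolding e
  proof (rule Bochner_Integration.integrable_bound[OF integrable_mult_left[OF i, of B]])
    show "(\<lambda>x. indicator K x *\<^sub>R u x * g x) \<in> borel_measurable lebesgue"
      using i g by (intro borel_measurable_times) auto
    show "AE x in lebesgue. norm (indicator K x *\<^sub>R u x * g x) \<le> norm (indicator K x *\<^sub>R u x * B)"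
      using B by (auto simp: abs_mult intro!: mult_left_mono)
  qed
qed

text \<open>
The norm of a test function, as a real number and over the whole space, where it is invariant under
measure preserving maps.
\<close>

definition l2 :: "('e::euclidean_space \<Rightarrow> real) \<Rightarrow> real" where
  "l2 \<psi> = sqrt (LINT X|lebesgue. (\<psi> X)^2)"

lemma l2_nonneg [simp]: "0 \<le> l2 \<psi>"
  unfolding l2_def by simp

text \<open>
The function \<open>f\<close> is known to be integrable only on compact subsets of \<open>G\<close>, so it is first cut off to
the support of \<open>\<psi>\<close>.
\<close>

lemma Cauchy_Schwarz_support:
  fixes f :: "'e::euclidean_space \<Rightarrow> real"
  assumes "set_integrable lebesgue K f" "compact K" "continuous_on UNIV \<psi>" "\<And>x. x \<notin> K \<Longrightarrow> \<psi> x = 0"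
    and M: "(\<integral>\<^sup>+ X. ennreal ((f X)^2) \<partial>lebesgue_on G) \<le> ennreal (M^2)" "0 \<le> M" "K \<subseteq> G" "G \<in> sets lebesgue"
  shows "\<bar>LINT X|lebesgue. f X * \<psi> X\<bar> \<le> M * l2 \<psi>"
proof -
  define h where "h = (\<lambda>x. indicator K x *\<^sub>R f x)"
  have hm: "h \<in> borel_measurable lebesgue" using assms(1) unfolding set_integrable_def h_def by auto
  have pm: "\<psi> \<in> borel_measurable lebesgue"
    by (rule continuous_imp_lebesgue_measurable[OF assms(3)])
  have hp: "f x * \<psi> x = h x * \<psi> x" for x using assms(4)[of x] by (auto simp: h_def indicator_def)
  have ifp: "integrable lebesgue (\<lambda>x. f x * \<psi> x)" using integrable_mult_compact_support assms(1-4) by blast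
  have c: "continuous_on UNIV (\<lambda>x. (\<psi> x)^2)" using assms(3) by (intro continuous_intros)
  have "set_integrable lebesgue K (\<lambda>x. 1::real)"
    unfolding set_integrable_def using lmeasurable_compact[OF assms(2)]
    by (simp add: lmeasurable_iff_integrable)
  from integrable_mult_compact_support[OF this assms(2) c]
  have ip: "integrable lebesgue (\<lambda>x. (\<psi> x)^2)" using assms(4) by auto
  have "(\<integral>\<^sup>+ X. ennreal ((h X)^2) \<partial>lebesgue) \<le> (\<integral>\<^sup>+ X. ennreal ((f X)^2) * indicator G X \<partial>lebesgue)"
    using M(3) by (intro nn_integral_mono) (auto simp: h_def indicator_def)
  also have "\<dots> = (\<integral>\<^sup>+ X. ennreal ((f X)^2) \<partial>lebesgue_on G)"
    using M(4) by (subst nn_integral_restrict_space) auto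
  finally have h2: "(\<integral>\<^sup>+ X. ennreal ((h X)^2) \<partial>lebesgue) \<le> ennreal (M^2)" using M(1) by order
  have "ennreal \<bar>LINT X|lebesgue. f X * \<psi> X\<bar> \<le> (\<integral>\<^sup>+ X. ennreal \<bar>f X * \<psi> X\<bar> \<partial>lebesgue)"
    using integral_norm_bound_ennreal[OF ifp] by simp
  also have "\<dots> = (\<integral>\<^sup>+ X. ennreal \<bar>h X\<bar> * ennreal \<bar>\<psi> X\<bar> \<partial>lebesgue)"
    by (simp add: hp abs_mult ennreal_mult)
  finally have "(ennreal \<bar>LINT X|lebesgue. f X * \<psi> X\<bar>)^2 \<le> (\<integral>\<^sup>+ X. ennreal \<bar>h X\<bar> * ennreal \<bar>\<psi> X\<bar> \<partial>lebesgue)^2"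
    by (intro power_mono) auto
  also have "\<dots> \<le> (\<integral>\<^sup>+ X. (ennreal \<bar>h X\<bar>)^2 \<partial>lebesgue) * (\<integral>\<^sup>+ X. (ennreal \<bar>\<psi> X\<bar>)^2 \<partial>lebesgue)"
    using hm pm by (intro Cauchy_Schwarz_nn_integral) auto
  also have "(\<integral>\<^sup>+ X. (ennreal \<bar>\<psi> X\<bar>)^2 \<partial>lebesgue) = ennreal (LINT X|lebesgue. (\<psi> X)^2)"
    using nn_integral_eq_integral[OF ip] by (simp add: ennreal_power)
  also have "(\<integral>\<^sup>+ X. (ennreal \<bar>h X\<bar>)^2 \<partial>lebesgue) = (\<integral>\<^sup>+ X. ennreal ((h X)^2) \<partial>lebesgue)"
    by (simp add: ennreal_power)
  also have "(\<integral>\<^sup>+ X. ennreal ((h X)^2) \<partial>lebesgue) * ennreal (LINT X|lebesgue. (\<psi> X)^2) \<le> ennreal (M^2) * ennreal (LINT X|lebesgue. (\<psi> X)^2)"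
    using h2 by (intro mult_right_mono) auto
  finally have "ennreal (\<bar>LINT X|lebesgue. f X * \<psi> X\<bar>^2) \<le> ennreal (M^2 * (LINT X|lebesgue. (\<psi> X)^2))"
    by (simp add: ennreal_power ennreal_mult)
  then have "\<bar>LINT X|lebesgue. f X * \<psi> X\<bar>^2 \<le> M^2 * (LINT X|lebesgue. (\<psi> X)^2)"
    by (subst (asm) ennreal_le_iff) auto
  then have "sqrt (\<bar>LINT X|lebesgue. f X * \<psi> X\<bar>^2) \<le> sqrt (M^2 * (LINT X|lebesgue. (\<psi> X)^2))"
    by (rule real_sqrt_le_mono)
  then show ?thesis using M(2) by (simp add: real_sqrt_mult l2_def)
qed

lemma l2_comp_measure_preserving:
  assumes "continuous_on UNIV \<psi>" "T \<in> borel_measurable borel" "distr lborel borel T = lborel"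
  shows "l2 (\<lambda>X. \<psi> (T X)) = l2 \<psi>"
proof -
  have p: "(\<lambda>X. (\<psi> X)^2) \<in> borel_measurable borel" using assms(1) by (intro borel_measurable_continuous_onI continuous_intros)
  have t: "T \<in> measurable borel borel" using assms(2) .
  have "(LINT X|lebesgue. (\<psi> (T X))^2) = (LINT X|lborel. (\<psi> (T X))^2)"
    using measurable_compose[OF t p] by (intro integral_completion) simp
  also have "\<dots> = (LINT X|distr lborel borel T. (\<psi> X)^2)"
    using p t by (subst integral_distr) auto
  also have "\<dots> = (LINT X|lebesgue. (\<psi> X)^2)"
    unfolding assms(3) using p by (intro integral_completion[symmetric]) simp
  finally show ?thesis by (simp add: l2_def)
qed

section \<open>Transport along shear fields\<close>

text \<open>
Affine vector fields \<open>V X = c + N X\<close> that are constant along their own integral curves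
(\<open>N c = 0\<close>, \<open>N (N x) = 0\<close>). Their integral curves are straight lines, so they stay inside convex sets
together with their end points; and their flow is affine, so it preserves test functions. Constant
fields and the kinetic field \<open>(1, 0, - x, 0)\<close> are of this kind.
\<close>

locale shear_field =
  fixes c :: "'e::euclidean_space" and N :: "'e \<Rightarrow> 'e"
  assumes lin: "bounded_linear N" and Nc: "N c = 0" and NN: "\<And>x. N (N x) = 0"
    and preserve: "\<And>s. distr lborel borel (\<lambda>X. X + s *\<^sub>R (c + N X)) = lborel"
begin

definition V :: "'e \<Rightarrow> 'e" where "V X = c + N X"
definition flow :: "real \<Rightarrow> 'e \<Rightarrow> 'e" where "flow s X = X + s *\<^sub>R V X"

lemma V_flow: "V (flow s X) = V X"
proof -
  interpret bounded_linear N by (rule lin)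
  show ?thesis by (simp add: V_def flow_def add scaleR Nc NN)
qed

lemma flow_flow: "flow s (flow r X) = flow (s + r) X"
  unfolding flow_def[of s] V_flow by (simp add: flow_def scaleR_add_left)

lemma flow_0 [simp]: "flow 0 X = X" by (simp add: flow_def)

lemma flow_affine: "flow s X = (X + s *\<^sub>R N X) + s *\<^sub>R c"
  by (simp add: flow_def V_def scaleR_add_right)

lemma bounded_linear_flow_part: "bounded_linear (\<lambda>X. X + s *\<^sub>R N X)"
  by (intro bounded_linear_add bounded_linear_ident bounded_linear_scaleR_right[THEN bounded_linear_compose] lin)

lemma continuous_flow: "continuous_on UNIV (\<lambda>p. flow (fst p) (snd p))"
  unfolding flow_def V_def
  by (intro continuous_intros bounded_linear.continuous_on[OF lin])

lemma smooth_flow: "smooth \<psi> \<Longrightarrow> smooth (\<lambda>X. \<psi> (flow s X))"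
  unfolding flow_affine by (rule smooth_affine_comp[OF _ bounded_linear_flow_part])

text \<open>
The derivative along \<open>V\<close>, as an operator on smooth functions that can be iterated.
\<close>

definition VD :: "('e \<Rightarrow> real) \<Rightarrow> 'e \<Rightarrow> real" where
  "VD \<psi> X = frechet_derivative \<psi> (at X) (V X)"

text \<open>
Expanding the linear part of \<open>V\<close> in the standard basis writes \<open>VD \<psi>\<close> as a sum of directional
derivatives with linear coefficients.
\<close>

lemma smooth_VD: assumes "smooth \<psi>" shows "smooth (VD \<psi>)"
proof -
  have "VD \<psi> X = dderiv c \<psi> X + (\<Sum>b\<in>Basis. (N X \<bullet> b) * dderiv b \<psi> X)" for X
  proof -
    interpret D: bounded_linear "frechet_derivative \<psi> (at X)"
      using smooth_has_derivative[OF assms] has_derivative_bounded_linear by blast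
    have "VD \<psi> X = dderiv c \<psi> X + frechet_derivative \<psi> (at X) (\<Sum>b\<in>Basis. (N X \<bullet> b) *\<^sub>R b)"
      unfolding euclidean_representation by (simp add: VD_def V_def D.add)
    then show ?thesis by (simp add: D.sum D.scaleR)
  qed
  moreover have "smooth (\<lambda>X. dderiv c \<psi> X + (\<Sum>b\<in>Basis. (N X \<bullet> b) * dderiv b \<psi> X))"
    by (intro smooth_add smooth_sum smooth_mult smooth_dderiv assms smooth_linear
        bounded_linear_compose[OF bounded_linear_inner_left lin])
  ultimately show ?thesis by presburger
qed

text \<open>
Since \<open>V\<close> is constant along the flow, the time derivative of \<open>\<psi> \<circ> flow (- s)\<close> is \<open>- VD \<psi>\<close> transported by the
same flow. Hence all time derivatives are obtained by iterating \<open>VD\<close>.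
\<close>

lemma flow_time_derivative:
  assumes "smooth \<psi>"
  shows "((\<lambda>s. \<psi> (flow (-s) X)) has_real_derivative - VD \<psi> (flow (-s) X)) (at s within S)"
proof -
  have "((\<lambda>s. flow (-s) X) has_derivative (\<lambda>h. - h *\<^sub>R V X)) (at s within S)"
    unfolding flow_def by (auto intro!: derivative_eq_intros)
  from has_derivative_compose[OF this smooth_has_derivative[OF assms]]
  have "((\<lambda>s. \<psi> (flow (-s) X)) has_derivative (\<lambda>h. frechet_derivative \<psi> (at (flow (-s) X)) (- h *\<^sub>R V X))) (at s within S)" .
  moreover have "(\<lambda>h. frechet_derivative \<psi> (at (flow (-s) X)) (- h *\<^sub>R V X)) = (*) (- VD \<psi> (flow (-s) X))"
  proof
    fix h
    interpret D: bounded_linear "frechet_derivative \<psi> (at (flow (-s) X))"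
      using smooth_has_derivative[OF assms] has_derivative_bounded_linear by blast
    show "frechet_derivative \<psi> (at (flow (-s) X)) (- h *\<^sub>R V X) = - VD \<psi> (flow (-s) X) * h"
      by (simp only: D.scaleR VD_def V_flow) simp
  qed
  ultimately show ?thesis unfolding has_field_derivative_def by simp
qed

text \<open>
Differentiation along \<open>V\<close> commutes with the flow of \<open>V\<close>.
\<close>

lemma frechet_derivative_flow:
  assumes "smooth \<psi>"
  shows "frechet_derivative (\<lambda>X. \<psi> (flow s X)) (at X) (V X) = VD \<psi> (flow s X)"
proof -
  interpret bounded_linear N by (rule lin)
  have "((\<lambda>X. flow s X) has_derivative (\<lambda>h. h + s *\<^sub>R N h)) (at X)"
    unfolding flow_affine
    using has_derivative_add[OF bounded_linear_imp_has_derivative[OF bounded_linear_flow_part] has_derivative_const] by simp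
  from has_derivative_compose[OF this smooth_has_derivative[OF assms]]
  have "((\<lambda>X. \<psi> (flow s X)) has_derivative (\<lambda>h. frechet_derivative \<psi> (at (flow s X)) (h + s *\<^sub>R N h))) (at X)" .
  from frechet_derivative_at[OF this]
  have "frechet_derivative (\<lambda>X. \<psi> (flow s X)) (at X) (V X) = frechet_derivative \<psi> (at (flow s X)) (V X + s *\<^sub>R N (V X))"
    by metis
  also have "N (V X) = 0" by (simp add: V_def add Nc NN)
  finally show ?thesis by (simp add: VD_def V_flow)
qed

lemma l2_flow: assumes "smooth \<psi>" shows "l2 (\<lambda>X. \<psi> (flow s X)) = l2 \<psi>"
proof (rule l2_comp_measure_preserving[OF smooth_continuous[OF assms]])
  show "flow s \<in> borel_measurable borel"
    unfolding flow_affine[abs_def]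
    by (intro borel_measurable_continuous_onI continuous_intros linear_continuous_on[OF lin])
  show "distr lborel borel (flow s) = lborel" using preserve unfolding flow_def[abs_def] V_def .
qed

end

section \<open>Pairing with a transported test function\<close>

text \<open>
A quadratic remainder that is uniform in the base point lets one differentiate under the integral
sign by mere integration of the remainder.
\<close>

lemma first_order_Taylor_bound:
  fixes w w' :: "real \<Rightarrow> real"
  assumes "\<And>s. (w has_real_derivative w' s) (at s)" "\<And>s. (w' has_real_derivative w'' s) (at s)" "\<And>s. \<bar>w'' s\<bar> \<le> C"
  shows "\<bar>w r - w s - (r - s) * w' s\<bar> \<le> C * (r - s)^2"
proof -
  have lip: "\<bar>w' x - w' s\<bar> \<le> C * \<bar>x - s\<bar>" for x
    using field_differentiable_bound[of UNIV w' w'' C x s] assms by auto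
  have C: "C \<ge> 0" using assms(3)[of 0] by linarith
  have "norm ((w r - r * w' s) - (w s - s * w' s)) \<le> (C * \<bar>r - s\<bar>) * norm (r - s)"
  proof (rule field_differentiable_bound[of "closed_segment s r" "\<lambda>x. w x - x * w' s" "\<lambda>x. w' x - w' s"])
    show "((\<lambda>x. w x - x * w' s) has_field_derivative w' x - w' s) (at x within closed_segment s r)" for x
      using assms(1)[of x, THEN has_field_derivative_at_within] by (auto intro!: derivative_eq_intros)
    show "norm (w' x - w' s) \<le> C * \<bar>r - s\<bar>" if "x \<in> closed_segment s r" for x
    proof -
      have "\<bar>x - s\<bar> \<le> \<bar>r - s\<bar>" using that by (auto simp: closed_segment_eq_real_ivl split: if_splits)
      then show ?thesis using lip[of x] C by (smt (verit) mult_left_mono real_norm_def)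
    qed
  qed auto
  moreover have "(w r - r * w' s) - (w s - s * w' s) = w r - w s - (r - s) * w' s" by (simp add: algebra_simps)
  moreover have "(C * \<bar>r - s\<bar>) * norm (r - s) = C * (r - s)^2"
    by (metis abs_mult_self_eq mult.assoc power2_eq_square real_norm_def)
  ultimately show ?thesis by (metis real_norm_def)
qed

lemma has_real_derivative_quadratic_bound:
  fixes p :: "real \<Rightarrow> real"
  assumes "\<And>r. r \<in> S \<Longrightarrow> \<bar>p r - p s - (r - s) * d\<bar> \<le> B * (r - s)^2"
  shows "(p has_real_derivative d) (at s within S)"
proof -
  have "((\<lambda>r. (p r - p s) / (r - s) - d) \<longlongrightarrow> 0) (at s within S)"
  proof (rule Lim_null_comparison)
    show "\<forall>\<^sub>F r in at s within S. norm ((p r - p s) / (r - s) - d) \<le> B * \<bar>r - s\<bar>"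
      unfolding eventually_at_filter
    proof (intro always_eventually allI impI)
      fix r assume r: "r \<noteq> s" "r \<in> S"
      have "norm ((p r - p s) / (r - s) - d) = \<bar>p r - p s - (r - s) * d\<bar> / \<bar>r - s\<bar>"
        using r by (simp add: diff_divide_distrib flip: abs_divide)
      also have "\<dots> \<le> B * (r - s)^2 / \<bar>r - s\<bar>"
        by (intro divide_right_mono assms r) auto
      also have "\<dots> = B * \<bar>r - s\<bar>" using r
        by (metis abs_eq_0 nonzero_eq_divide_eq mult.assoc power2_abs power2_eq_square right_minus_eq)
      finally show "norm ((p r - p s) / (r - s) - d) \<le> B * \<bar>r - s\<bar>" .
    qed
    have "((\<lambda>r. B * \<bar>r - s\<bar>) \<longlongrightarrow> B * \<bar>s - s\<bar>) (at s within S)" by (intro tendsto_intros)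
    then show "((\<lambda>r. B * \<bar>r - s\<bar>) \<longlongrightarrow> 0) (at s within S)" by simp
  qed
  from tendsto_add[OF this tendsto_const[of d]] show ?thesis
    by (simp add: has_field_derivative_iff)
qed

context shear_field
begin

text \<open>
The region swept out by \<open>K\<close> in the times \<open>{a..b}\<close>: a common support for all transported functions.
\<close>

definition tube :: "real \<Rightarrow> real \<Rightarrow> 'e set \<Rightarrow> 'e set" where
  "tube a b K = (\<lambda>p. flow (fst p) (snd p)) ` ({a..b} \<times> K)"

lemma compact_tube: "compact K \<Longrightarrow> compact (tube a b K)"
  unfolding tube_def
  by (intro compact_continuous_image continuous_on_subset[OF continuous_flow] compact_Times) auto

lemma zero_off_tube:
  assumes "s \<in> {a..b}" "X \<notin> tube a b K" "\<And>X. X \<notin> K \<Longrightarrow> g X = (0::real)"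
  shows "g (flow (-s) X) = 0"
proof (rule assms(3), rule notI)
  assume "flow (-s) X \<in> K"
  then have "flow s (flow (-s) X) \<in> tube a b K" using assms(1) unfolding tube_def by force
  then show False using assms(2) by (simp add: flow_flow)
qed

lemma test_function_flow:
  assumes "smooth \<psi>" "compact K" "\<And>X. X \<notin> K \<Longrightarrow> \<psi> X = 0" "s \<in> {a..b}" "tube a b K \<subseteq> G"
  shows "test_function G (\<lambda>X. \<psi> (flow (-s) X))"
  unfolding test_function_smooth
proof (intro conjI exI[of _ "tube a b K"] allI impI)
  show "\<psi> (flow (-s) X) = 0" if "X \<notin> tube a b K" for X by (rule zero_off_tube[OF assms(4) that assms(3)])
qed (use smooth_flow[OF assms(1)] compact_tube[OF assms(2)] assms(5) in auto)

lemma VD_zero_off: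
  assumes "compact K" "\<And>X. X \<notin> K \<Longrightarrow> \<psi> X = 0" "X \<notin> K" shows "VD \<psi> X = 0"
  unfolding VD_def using frechet_derivative_zero_outside[OF compact_imp_closed[OF assms(1)] assms(2,3)] by simp

text \<open>
Differentiating \<open>\<psi> \<circ> flow (- s)\<close> in \<open>s\<close> gives minus its derivative along \<open>V\<close>, and the weak derivative \<open>f\<close> of
\<open>u\<close> along \<open>V\<close> takes it over. Only the test function is ever differentiated classically.
\<close>

lemma transport_integral_derivative:
  assumes wd: "weak_deriv G V u f" and G: "open G"
    and \<psi>: "smooth \<psi>" "compact K" "\<And>X. X \<notin> K \<Longrightarrow> \<psi> X = 0" and tube: "tube a b K \<subseteq> G"
    and s: "s \<in> {a..b}"
  shows "((\<lambda>s. LINT X|lebesgue. u X * \<psi> (flow (-s) X)) has_real_derivative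
          (LINT X|lebesgue. f X * \<psi> (flow (-s) X))) (at s within {a..b})"
proof -
  let ?T = "tube a b K"
  have T: "compact ?T" using \<psi>(2) by (rule compact_tube)
  have u: "set_integrable lebesgue ?T u"
    using wd T tube unfolding weak_deriv_def locally_integrable_def by (elim conjE) simp
  have iu: "integrable lebesgue (\<lambda>X. u X * g (flow (-r) X))"
    if "smooth g" "\<And>X. X \<notin> K \<Longrightarrow> g X = 0" "r \<in> {a..b}" for g r
    by (rule integrable_mult_compact_support[OF u T smooth_continuous[OF smooth_flow[OF that(1)]]])
       (rule zero_off_tube[OF that(3) _ that(2)])
  have VD0: "VD \<psi> X = 0" if "X \<notin> K" for X by (rule VD_zero_off[OF \<psi>(2,3) that])
  have sV: "smooth (VD \<psi>)" "smooth (VD (VD \<psi>))" by (auto intro: smooth_VD \<psi>(1))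
  obtain C where C: "C \<ge> 0" "\<And>X. \<bar>VD (VD \<psi>) X\<bar> \<le> C"
    by (rule bounded_of_compact_support[OF smooth_continuous[OF sV(2)] \<psi>(2) VD_zero_off[OF \<psi>(2) VD0]]) auto
  have "- (LINT X|lebesgue. u X * VD \<psi> (flow (-s) X)) = (LINT X|lebesgue. f X * \<psi> (flow (-s) X))"
    using weak_deriv_apply[OF wd G test_function_flow[OF \<psi> s tube]]
    unfolding frechet_derivative_flow[OF \<psi>(1)] by simp
  moreover have "((\<lambda>s. LINT X|lebesgue. u X * \<psi> (flow (-s) X)) has_real_derivative
      - (LINT X|lebesgue. u X * VD \<psi> (flow (-s) X))) (at s within {a..b})"
  proof (rule has_real_derivative_quadratic_bound)
    fix r assume r: "r \<in> {a..b}"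
    let ?w = "\<lambda>X. \<psi> (flow (-r) X) - \<psi> (flow (-s) X) - (r - s) * (- VD \<psi> (flow (-s) X))"
    have "(LINT X|lebesgue. u X * ?w X) = (LINT X|lebesgue. u X * \<psi> (flow (-r) X) - u X * \<psi> (flow (-s) X)
        - (r - s) * (- (u X * VD \<psi> (flow (-s) X))))"
      by (rule Bochner_Integration.integral_cong) (auto simp: algebra_simps)
    also have "\<dots> = (LINT X|lebesgue. u X * \<psi> (flow (-r) X)) - (LINT X|lebesgue. u X * \<psi> (flow (-s) X))
        - (r - s) * (- (LINT X|lebesgue. u X * VD \<psi> (flow (-s) X)))"
      using iu[OF \<psi>(1,3) r] iu[OF \<psi>(1,3) s] iu[OF sV(1) VD0 s] by simp
    finally have e: "(LINT X|lebesgue. u X * \<psi> (flow (-r) X)) - (LINT X|lebesgue. u X * \<psi> (flow (-s) X))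
        - (r - s) * (- (LINT X|lebesgue. u X * VD \<psi> (flow (-s) X))) = (LINT X|lebesgue. u X * ?w X)" by simp
    have w0: "?w X = 0" if "X \<notin> ?T" for X
      using zero_off_tube[where g=\<psi>, OF r that \<psi>(3)] zero_off_tube[where g=\<psi>, OF s that \<psi>(3)]
        zero_off_tube[where g="VD \<psi>", OF s that VD0] by simp
    have wC: "\<bar>?w X\<bar> \<le> C * (r - s)^2" for X
    proof (rule first_order_Taylor_bound[where w''="\<lambda>t. VD (VD \<psi>) (flow (-t) X)"])
      show "((\<lambda>t. \<psi> (flow (-t) X)) has_real_derivative - VD \<psi> (flow (-t) X)) (at t)" for t
        by (rule flow_time_derivative[OF \<psi>(1)])
      show "((\<lambda>t. - VD \<psi> (flow (-t) X)) has_real_derivative VD (VD \<psi>) (flow (-t) X)) (at t)" for t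
        using DERIV_minus[OF flow_time_derivative[OF sV(1), of X t UNIV]] by simp
      show "\<bar>VD (VD \<psi>) (flow (- t) X)\<bar> \<le> C" for t by (rule C)
    qed
    have iu1: "integrable lebesgue (\<lambda>X. norm (indicator ?T X *\<^sub>R u X) * (C * (r - s)^2))"
      using u unfolding set_integrable_def by (intro integrable_mult_left integrable_norm)
    have "\<bar>LINT X|lebesgue. u X * ?w X\<bar> \<le> (LINT X|lebesgue. norm (indicator ?T X *\<^sub>R u X) * (C * (r - s)^2))"
    proof (rule integral_abs_bound_integral[OF _ iu1])
      show "integrable lebesgue (\<lambda>X. u X * ?w X)"
        by (rule integrable_mult_compact_support[OF u T _ w0])
           (intro continuous_intros smooth_continuous smooth_flow \<psi> sV)
      fix X
      show "\<bar>u X * ?w X\<bar> \<le> norm (indicator ?T X *\<^sub>R u X) * (C * (r - s)^2)"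
        using mult_left_mono[OF wC[of X], of "\<bar>u X\<bar>"] w0[of X] by (cases "X \<in> ?T") (auto simp: abs_mult)
    qed
    also have "\<dots> = (LINT X|lebesgue. norm (indicator ?T X *\<^sub>R u X)) * C * (r - s)^2"
      by simp
    finally show "\<bar>(LINT X|lebesgue. u X * \<psi> (flow (-r) X)) - (LINT X|lebesgue. u X * \<psi> (flow (-s) X))
        - (r - s) * (- (LINT X|lebesgue. u X * VD \<psi> (flow (-s) X)))\<bar>
        \<le> ((LINT X|lebesgue. norm (indicator ?T X *\<^sub>R u X)) * C) * (r - s)^2"
      unfolding e .
  qed
  ultimately show ?thesis by simp
qed

text \<open>
The derivative in \<open>s\<close> of the pairing is a pairing of \<open>f\<close> with a transported test function, whose norm is
that of \<open>\<psi>\<close>; integrate in \<open>s\<close>.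
\<close>

lemma transport_integral_bound:
  assumes wd: "weak_deriv G V u f" and G: "open G"
    and \<psi>: "smooth \<psi>" "compact K" "\<And>X. X \<notin> K \<Longrightarrow> \<psi> X = 0" and tube: "tube a b K \<subseteq> G"
    and s: "s \<in> {a..b}" "r \<in> {a..b}"
    and M: "(\<integral>\<^sup>+ X. ennreal ((f X)^2) \<partial>lebesgue_on G) \<le> ennreal (M^2)" "0 \<le> M"
  shows "\<bar>(LINT X|lebesgue. u X * \<psi> (flow (-r) X)) - (LINT X|lebesgue. u X * \<psi> (flow (-s) X))\<bar>
     \<le> M * l2 \<psi> * \<bar>r - s\<bar>"
proof -
  let ?T = "tube a b K"
  have f: "set_integrable lebesgue ?T f"
    using wd compact_tube[OF \<psi>(2)] tube unfolding weak_deriv_def locally_integrable_def by (elim conjE) simp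
  have b: "\<bar>LINT X|lebesgue. f X * \<psi> (flow (-t) X)\<bar> \<le> M * l2 \<psi>" if "t \<in> {a..b}" for t
    using Cauchy_Schwarz_support[OF f compact_tube[OF \<psi>(2)] smooth_continuous[OF smooth_flow[OF \<psi>(1)]]
        zero_off_tube[where g=\<psi>, OF that _ \<psi>(3)] M tube] G
    by (simp add: l2_flow[OF \<psi>(1)])
  show ?thesis
    using field_differentiable_bound[of "{a..b}" "\<lambda>s. LINT X|lebesgue. u X * \<psi> (flow (-s) X)"
        "\<lambda>s. LINT X|lebesgue. f X * \<psi> (flow (-s) X)" "M * l2 \<psi>" r s]
      transport_integral_derivative[OF wd G \<psi> tube] b s by (simp add: norm_minus_commute)
qed

text \<open>
The first derivative \<open>g\<close> of \<open>u\<close> is not controlled here, only the second one. The pairing \<open>p s\<close> has the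
derivative \<open>p' s\<close>, the pairing with \<open>g\<close>, which is Lipschitz by the previous bound; and the second difference
of \<open>p\<close> is an increment over \<open>{0..1}\<close> of \<open>p (s + 1) - p s\<close>, whose derivative is
\<open>p' (s + 1) - p' s\<close>.
\<close>

lemma second_difference_bound:
  assumes wd: "weak_deriv G V u g" "weak_deriv G V g k" and G: "open G"
    and \<psi>: "smooth \<psi>" "compact K" "\<And>X. X \<notin> K \<Longrightarrow> \<psi> X = 0" and tube: "tube 0 2 K \<subseteq> G"
    and M: "(\<integral>\<^sup>+ X. ennreal ((k X)^2) \<partial>lebesgue_on G) \<le> ennreal (M^2)" "0 \<le> M"
  shows "\<bar>(LINT X|lebesgue. u X * \<psi> X) - 2 * (LINT X|lebesgue. u X * \<psi> (flow (-1) X))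
      + (LINT X|lebesgue. u X * \<psi> (flow (-2) X))\<bar> \<le> M * l2 \<psi>"
proof -
  define p where "p = (\<lambda>s. LINT X|lebesgue. u X * \<psi> (flow (-s) X))"
  define p' where "p' = (\<lambda>s. LINT X|lebesgue. g X * \<psi> (flow (-s) X))"
  have p: "(p has_real_derivative p' s) (at s within {0..2})" if "s \<in> {0..2}" for s
    unfolding p_def p'_def by (rule transport_integral_derivative[OF wd(1) G \<psi> tube that])
  have p': "\<bar>p' r - p' s\<bar> \<le> M * l2 \<psi> * \<bar>r - s\<bar>" if "s \<in> {0..2}" "r \<in> {0..2}" for r s
    unfolding p'_def by (rule transport_integral_bound[OF wd(2) G \<psi> tube that M])
  have "norm ((p (1 + 1) - p 1) - (p (0 + 1) - p 0)) \<le> (M * l2 \<psi>) * norm (1 - 0::real)"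
  proof (rule field_differentiable_bound[of "{0..1}" "\<lambda>s. p (s + 1) - p s" "\<lambda>s. p' (s + 1) - p' s"])
    fix s :: real assume s: "s \<in> {0..1}"
    have 1: "(p has_real_derivative p' s) (at s within {0..1})"
      by (rule DERIV_subset[OF p]) (use s in auto)
    have 2: "(p has_real_derivative p' (s + 1)) (at (s + 1) within (\<lambda>s. s + 1) ` {0..1})"
      by (rule DERIV_subset[OF p]) (use s in auto)
    have "((\<lambda>s. p (s + 1)) has_real_derivative p' (s + 1) * 1) (at s within {0..1})"
      by (rule DERIV_image_chain[OF 2, unfolded o_def]) (auto intro!: derivative_eq_intros)
    then show "((\<lambda>s. p (s + 1) - p s) has_field_derivative p' (s + 1) - p' s) (at s within {0..1})"
      using DERIV_diff[OF _ 1] by simp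
    show "norm (p' (s + 1) - p' s) \<le> M * l2 \<psi>"
      using p'[of s "s + 1"] s by simp
  qed auto
  then show ?thesis by (simp add: p_def algebra_simps)
qed

end

section \<open>Square integral bounds by duality\<close>

lemma locally_integrable_cutoff:
  assumes "locally_integrable A u" "test_function A c"
  shows "integrable lebesgue (\<lambda>X. u X * c X)"
proof -
  obtain K where K: "smooth c" "compact K" "K \<subseteq> A" "\<And>x. x \<notin> K \<Longrightarrow> c x = 0"
    using assms(2) unfolding test_function_smooth by auto
  have "set_integrable lebesgue K u" using assms(1) K unfolding locally_integrable_def by simp
  then show ?thesis by (rule integrable_mult_compact_support[OF _ K(2) smooth_continuous[OF K(1)] K(4)])
qed

lemma test_function_measurable: "test_function A c \<Longrightarrow> c \<in> borel_measurable lebesgue"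
  unfolding test_function_smooth by (elim conjE) (rule continuous_imp_lebesgue_measurable[OF smooth_continuous])

lemma test_function_zero_outside: "test_function A c \<Longrightarrow> X \<notin> A \<Longrightarrow> c X = 0"
  unfolding test_function_smooth by (elim conjE exE) auto

lemma locally_integrable_measurable:
  fixes u :: "'e::euclidean_space \<Rightarrow> real"
  assumes "open A" "locally_integrable A u"
  shows "(\<lambda>X. indicator A X * u X) \<in> borel_measurable lebesgue"
proof -
  obtain c where c: "\<And>n. test_function A (c n)" "\<And>n x. 0 \<le> c n x \<and> c n x \<le> 1"
    "\<And>x. x \<in> A \<Longrightarrow> (\<lambda>n. c n x) \<longlonglongrightarrow> 1"
    using cutoff_sequence[OF assms(1)] by metis
  show ?thesis
  proof (rule borel_measurable_LIMSEQ_metric)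
    show "(\<lambda>X. u X * c n X) \<in> borel_measurable lebesgue" for n
      using locally_integrable_cutoff[OF assms(2) c(1)] by (rule borel_measurable_integrable)
    fix X
    show "(\<lambda>n. u X * c n X) \<longlonglongrightarrow> indicator A X * u X"
    proof (cases "X \<in> A")
      case True
      then show ?thesis using tendsto_mult[OF tendsto_const[of "u X"] c(3)[OF True]] by simp
    next
      case False
      then show ?thesis using test_function_zero_outside[OF c(1) False] by simp
    qed
  qed
qed

text \<open>
Formally, test with \<open>\<psi> = c u\<close>: then the integral \<open>I\<close> of \<open>c u^2\<close> satisfies \<open>I \<le> C sqrt I\<close>. Here \<open>u\<close> is truncated at
height \<open>B\<close> so that \<open>c u\<close> is a limit of test functions under a common integrable bound.
\<close>

lemma truncated_duality_bound:
  fixes u :: "'e::euclidean_space \<Rightarrow> real"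
  assumes A: "open A" and u: "locally_integrable A u" and C: "0 \<le> C"
    and bound: "\<And>\<psi>. test_function A \<psi> \<Longrightarrow> \<bar>LINT X|lebesgue. u X * \<psi> X\<bar> \<le> C * l2 \<psi>"
    and c: "test_function A c" "\<And>x. 0 \<le> c x \<and> c x \<le> 1"
  shows "(\<integral>\<^sup>+ X. ennreal (c X * (u X)^2 * indicator {X. \<bar>u X\<bar> \<le> B} X) \<partial>lebesgue) \<le> ennreal (C^2)"
proof -
  define f where "f = (\<lambda>X. if \<bar>indicator A X * u X\<bar> \<le> B then indicator A X * u X else 0)"
  define B' where "B' = max B 0"
  have um: "(\<lambda>X. indicator A X * u X) \<in> borel_measurable lebesgue" by (rule locally_integrable_measurable[OF A u])
  have fm [measurable]: "f \<in> borel_measurable lebesgue"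
    unfolding f_def using um by measurable
  have fB: "\<bar>f X\<bar> \<le> B'" for X unfolding f_def B'_def by auto
  obtain \<psi> where \<psi>: "\<And>n. test_function A (\<psi> n)" "\<And>n x. \<bar>\<psi> n x\<bar> \<le> (B' + 1) * \<bar>c x\<bar>"
    "AE x in lebesgue. (\<lambda>n. \<psi> n x) \<longlonglongrightarrow> c x * f x"
    by (rule test_function_approx[OF fm fB c(1)]) (rule that)
  have cs: "smooth c" using c(1) by (simp add: test_function_smooth)
  have cm [measurable]: "c \<in> borel_measurable lebesgue"
    by (rule continuous_imp_lebesgue_measurable[OF smooth_continuous[OF cs]])
  have uc: "integrable lebesgue (\<lambda>X. u X * c X)" by (rule locally_integrable_cutoff[OF u c(1)])
  have li1: "locally_integrable A (\<lambda>X. 1::real)"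
    unfolding locally_integrable_def set_integrable_def
    using lmeasurable_compact[unfolded lmeasurable_iff_integrable] by auto
  have i1: "integrable lebesgue (\<lambda>X. c X)" using locally_integrable_cutoff[OF li1 c(1)] by simp
  have B1: "B' + 1 > 0" by (simp add: B'_def)
  have \<psi>m: "(\<lambda>X. \<psi> n X) \<in> borel_measurable lebesgue" for n
    by (rule test_function_measurable[OF \<psi>(1)])
  have cf: "u X * (c X * f X) = c X * (u X)^2 * indicator {X. \<bar>u X\<bar> \<le> B} X" for X
    using test_function_zero_outside[OF c(1), of X] by (cases "X \<in> A") (auto simp: f_def power2_eq_square)
  have L1: "(\<lambda>n. LINT X|lebesgue. u X * \<psi> n X) \<longlonglongrightarrow> (LINT X|lebesgue. u X * (c X * f X))"
  proof (rule integral_dominated_convergence[where w="\<lambda>X. (B' + 1) * \<bar>u X * c X\<bar>"])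
    show "integrable lebesgue (\<lambda>X. (B' + 1) * \<bar>u X * c X\<bar>)" using uc by simp
    show "(\<lambda>X. u X * \<psi> n X) \<in> borel_measurable lebesgue" for n
      using locally_integrable_cutoff[OF u \<psi>(1)] by (rule borel_measurable_integrable)
    have "(\<lambda>X. (u X * c X) * f X) \<in> borel_measurable lebesgue"
      using borel_measurable_integrable[OF uc] fm by (rule borel_measurable_times)
    then show "(\<lambda>X. u X * (c X * f X)) \<in> borel_measurable lebesgue" by (simp add: mult.assoc)
    show "AE X in lebesgue. (\<lambda>n. u X * \<psi> n X) \<longlonglongrightarrow> u X * (c X * f X)"
      using \<psi>(3) by eventually_elim (rule tendsto_mult[OF tendsto_const])
    show "AE X in lebesgue. norm (u X * \<psi> n X) \<le> (B' + 1) * \<bar>u X * c X\<bar>" for n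
    proof (rule AE_I2)
      fix X
      have "\<bar>u X\<bar> * \<bar>\<psi> n X\<bar> \<le> \<bar>u X\<bar> * ((B' + 1) * \<bar>c X\<bar>)" by (rule mult_left_mono[OF \<psi>(2)]) simp
      then show "norm (u X * \<psi> n X) \<le> (B' + 1) * \<bar>u X * c X\<bar>" by (simp add: abs_mult mult_ac)
    qed
  qed
  have dom: "\<bar>g\<bar>^2 \<le> (B' + 1)^2 * c X" if "\<bar>g\<bar> \<le> (B' + 1) * \<bar>c X\<bar>" for g X
  proof -
    have "\<bar>g\<bar>^2 \<le> ((B' + 1) * \<bar>c X\<bar>)^2" using that by (rule power_mono) simp
    also have "\<dots> = (B' + 1)^2 * (c X * c X)" by (simp add: power2_eq_square mult_ac)
    also have "\<dots> \<le> (B' + 1)^2 * (c X * 1)" using c(2)[of X] by (intro mult_left_mono) auto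
    finally show ?thesis by simp
  qed
  have L2: "(\<lambda>n. LINT X|lebesgue. (\<psi> n X)^2) \<longlonglongrightarrow> (LINT X|lebesgue. (c X * f X)^2)"
  proof (rule integral_dominated_convergence[where w="\<lambda>X. (B' + 1)^2 * c X"])
    show "integrable lebesgue (\<lambda>X. (B' + 1)^2 * c X)" using i1 by simp
    show "(\<lambda>X. (\<psi> n X)^2) \<in> borel_measurable lebesgue" for n
      using \<psi>m[of n] by (rule borel_measurable_power)
    show "(\<lambda>X. (c X * f X)^2) \<in> borel_measurable lebesgue" by measurable
    show "AE X in lebesgue. (\<lambda>n. (\<psi> n X)^2) \<longlonglongrightarrow> (c X * f X)^2"
      using \<psi>(3) by eventually_elim (rule tendsto_power)
    show "AE X in lebesgue. norm ((\<psi> n X)^2) \<le> (B' + 1)^2 * c X" for n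
      using dom[OF \<psi>(2)] by (intro AE_I2) simp
  qed
  define I where "I = (LINT X|lebesgue. u X * (c X * f X))"
  have I0: "0 \<le> I" unfolding I_def cf using c(2) by (intro Bochner_Integration.integral_nonneg) auto
  have "\<bar>I\<bar> \<le> C * sqrt (LINT X|lebesgue. (c X * f X)^2)"
  proof (rule LIMSEQ_le)
    show "(\<lambda>n. \<bar>LINT X|lebesgue. u X * \<psi> n X\<bar>) \<longlonglongrightarrow> \<bar>I\<bar>" unfolding I_def by (rule tendsto_rabs[OF L1])
    show "(\<lambda>n. C * l2 (\<psi> n)) \<longlonglongrightarrow> C * sqrt (LINT X|lebesgue. (c X * f X)^2)"
      unfolding l2_def by (intro tendsto_mult tendsto_const tendsto_real_sqrt L2)
    show "\<exists>N. \<forall>n\<ge>N. \<bar>LINT X|lebesgue. u X * \<psi> n X\<bar> \<le> C * l2 (\<psi> n)" using bound[OF \<psi>(1)] by blast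
  qed
  moreover have iI: "integrable lebesgue (\<lambda>X. u X * (c X * f X))"
  proof (rule Bochner_Integration.integrable_bound[where f="\<lambda>X. (B' + 1) * \<bar>u X * c X\<bar>"])
    show "integrable lebesgue (\<lambda>X. (B' + 1) * \<bar>u X * c X\<bar>)" using uc by simp
    have "(\<lambda>X. (u X * c X) * f X) \<in> borel_measurable lebesgue"
      using borel_measurable_integrable[OF uc] fm by (rule borel_measurable_times)
    then show "(\<lambda>X. u X * (c X * f X)) \<in> borel_measurable lebesgue" by (simp add: mult.assoc)
    have "\<bar>f X\<bar> * \<bar>u X * c X\<bar> \<le> (B' + 1) * \<bar>u X * c X\<bar>" for X
      using fB[of X] by (intro mult_right_mono) auto
    then show "AE X in lebesgue. norm (u X * (c X * f X)) \<le> norm ((B' + 1) * \<bar>u X * c X\<bar>)"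
      using B1 by (intro AE_I2) (simp add: abs_mult mult_ac)
  qed
  moreover have "(LINT X|lebesgue. (c X * f X)^2) \<le> I"
    unfolding I_def
  proof (rule integral_mono[OF _ iI])
    show "integrable lebesgue (\<lambda>X. (c X * f X)^2)"
    proof (rule Bochner_Integration.integrable_bound[where f="\<lambda>X. (B' + 1)^2 * c X"])
      have "\<bar>c X * f X\<bar> \<le> (B' + 1) * \<bar>c X\<bar>" for X
        using mult_right_mono[of "\<bar>f X\<bar>" "B' + 1" "\<bar>c X\<bar>"] fB[of X] by (simp add: abs_mult mult_ac)
      from dom[OF this] show "AE X in lebesgue. norm ((c X * f X)^2) \<le> norm ((B' + 1)^2 * c X)"
        using c(2) by (intro AE_I2) (simp add: abs_mult power_mult_distrib)
      show "(\<lambda>X. (c X * f X)^2) \<in> borel_measurable lebesgue" by measurable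
    qed (use i1 in simp)
    fix X
    have "(c X * f X)^2 = c X * (u X * (c X * f X))"
      using test_function_zero_outside[OF c(1), of X] by (cases "X \<in> A") (auto simp: f_def power2_eq_square)
    also have "\<dots> \<le> 1 * (u X * (c X * f X))"
      using c(2)[of X] unfolding cf by (intro mult_right_mono) auto
    finally show "(c X * f X)^2 \<le> u X * (c X * f X)" by simp
  qed
  ultimately have "I \<le> C * sqrt I"
    using I0 C by (smt (verit) mult_left_mono real_sqrt_le_mono)
  then have "I \<le> C^2"
  proof (cases "I = 0")
    case False
    have "sqrt I * sqrt I \<le> C * sqrt I" using \<open>I \<le> C * sqrt I\<close> I0 by simp
    then have "sqrt I \<le> C" using False I0 by (intro mult_right_le_imp_le[of "sqrt I" "sqrt I" C]) auto
    then have "(sqrt I)^2 \<le> C^2" using I0 by (intro power_mono) auto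
    then show ?thesis using I0 by simp
  qed simp
  moreover have "(\<integral>\<^sup>+ X. ennreal (u X * (c X * f X)) \<partial>lebesgue) = ennreal I"
    unfolding I_def using c(2) by (intro nn_integral_eq_integral[OF iI] AE_I2) (simp add: cf)
  ultimately show ?thesis unfolding cf by (simp add: ennreal_leI)
qed

text \<open>
Let the cutoff increase to the indicator of \<open>A\<close> and the truncation height to infinity.
\<close>

lemma L2_bound_by_duality:
  fixes u :: "'e::euclidean_space \<Rightarrow> real"
  assumes A: "open A" and u: "locally_integrable A u" and C: "0 \<le> C"
    and bound: "\<And>\<psi>. test_function A \<psi> \<Longrightarrow> \<bar>LINT X|lebesgue. u X * \<psi> X\<bar> \<le> C * l2 \<psi>"
  shows "(\<integral>\<^sup>+ X. ennreal ((u X)^2) \<partial>lebesgue_on A) \<le> ennreal (C^2)"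
proof -
  obtain c where c: "\<And>n. test_function A (c n)" "\<And>n x. 0 \<le> c n x \<and> c n x \<le> 1"
    "\<And>x. x \<in> A \<Longrightarrow> (\<lambda>n. c n x) \<longlonglongrightarrow> 1"
    using cutoff_sequence[OF A] by metis
  let ?h = "\<lambda>n X. c n X * (u X)^2 * indicator {X. \<bar>u X\<bar> \<le> real n} X"
  have um: "(\<lambda>X. indicator A X * u X) \<in> borel_measurable lebesgue" by (rule locally_integrable_measurable[OF A u])
  have he: "?h n X = c n X * (indicator A X * u X)^2 * indicator {x. \<bar>x\<bar> \<le> real n} (indicator A X * u X)" for n X
    using test_function_zero_outside[OF c(1), of X n] by (cases "X \<in> A") (auto simp: indicator_def)
  have hm: "(\<lambda>X. ennreal (?h n X)) \<in> borel_measurable lebesgue" for n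
  proof -
    have [measurable]: "c n \<in> borel_measurable lebesgue"
      by (rule test_function_measurable[OF c(1)])
    note um[measurable]
    show ?thesis unfolding he by measurable
  qed
  have lim: "(\<lambda>n. ?h n X) \<longlonglongrightarrow> indicator A X * (u X)^2" for X
  proof (cases "X \<in> A")
    case True
    have "\<forall>\<^sub>F n in sequentially. c n X * (u X)^2 = ?h n X"
    proof -
      have "\<forall>\<^sub>F n in sequentially. \<bar>u X\<bar> \<le> real n"
        using filterlim_real_sequentially unfolding filterlim_at_top by blast
      then show ?thesis by eventually_elim simp
    qed
    moreover have "(\<lambda>n. c n X * (u X)^2) \<longlonglongrightarrow> 1 * (u X)^2" by (intro tendsto_intros c(3) True)
    ultimately show ?thesis using True by (auto intro: Lim_transform_eventually)
  next
    case False
    then show ?thesis using test_function_zero_outside[OF c(1) False] by simp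
  qed
  have "(\<integral>\<^sup>+ X. ennreal ((u X)^2) \<partial>lebesgue_on A) = (\<integral>\<^sup>+ X. ennreal ((u X)^2) * indicator A X \<partial>lebesgue)"
    using A by (subst nn_integral_restrict_space) auto
  also have "\<dots> = (\<integral>\<^sup>+ X. liminf (\<lambda>n. ennreal (?h n X)) \<partial>lebesgue)"
  proof (rule nn_integral_cong)
    fix X
    have "(\<lambda>n. ennreal (?h n X)) \<longlonglongrightarrow> ennreal (indicator A X * (u X)^2)" by (rule tendsto_ennrealI[OF lim])
    from lim_imp_Liminf[OF _ this] show "ennreal ((u X)^2) * indicator A X = liminf (\<lambda>n. ennreal (?h n X))"
      by (auto simp: indicator_def)
  qed
  also have "\<dots> \<le> liminf (\<lambda>n. \<integral>\<^sup>+ X. ennreal (?h n X) \<partial>lebesgue)"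
    by (rule nn_integral_liminf[OF hm])
  also have "\<dots> \<le> liminf (\<lambda>n. ennreal (C^2))"
    using truncated_duality_bound[OF A u C bound c(1) c(2)] by (intro Liminf_mono always_eventually allI)
  also have "\<dots> = ennreal (C^2)" by (simp add: Liminf_const)
  finally show ?thesis .
qed

text \<open>
The case \<open>C = 0\<close> of the duality bound.
\<close>

lemma fundamental_lemma_of_variations:
  fixes w :: "'e::euclidean_space \<Rightarrow> real"
  assumes A: "open A" and w: "locally_integrable A w"
    and zero: "\<And>\<psi>. test_function A \<psi> \<Longrightarrow> (LINT X|lebesgue. w X * \<psi> X) = 0"
  shows "AE X in lebesgue_on A. w X = 0"
proof -
  have "(\<integral>\<^sup>+ X. ennreal ((w X)^2) \<partial>lebesgue_on A) \<le> ennreal (0^2)"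
    by (rule L2_bound_by_duality[OF A w]) (simp_all add: zero)
  then have "(\<integral>\<^sup>+ X. ennreal ((w X)^2) \<partial>lebesgue_on A) = 0" by simp
  moreover have "(\<lambda>X. ennreal ((w X)^2)) \<in> borel_measurable (lebesgue_on A)"
  proof -
    have "(\<lambda>X. indicator A X * w X) \<in> borel_measurable lebesgue" by (rule locally_integrable_measurable[OF A w])
    then have "w \<in> borel_measurable (lebesgue_on A)"
      using A by (subst borel_measurable_restrict_space_iff) auto
    then show ?thesis by measurable
  qed
  ultimately have "AE X in lebesgue_on A. ennreal ((w X)^2) = 0" by (simp add: nn_integral_0_iff_AE)
  then show ?thesis by eventually_elim (simp add: ennreal_eq_0_iff)
qed

section \<open>The shear fields of the kinetic geometry\<close>

lemma lborel_preserving_translation: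
  fixes c :: "'a::euclidean_space"
  shows "distr lborel borel (\<lambda>X. X + c) = lborel"
proof -
  have "(\<lambda>X. X + c) = (+) c" by (simp add: fun_eq_iff add.commute)
  then show ?thesis using lborel_distr_plus[of c] by simp
qed

lemma shear_field_const: "shear_field h (\<lambda>_. 0)"
  by (rule shear_field.intro[OF bounded_linear_zero]) (simp_all add: lborel_preserving_translation)

text \<open>
Fubini: on every fibre the inner integral is unchanged.
\<close>

lemma lborel_preserving_fibrewise:
  fixes S :: "'a::euclidean_space \<Rightarrow> 'b::euclidean_space \<Rightarrow> 'b"
  assumes S: "continuous_on UNIV (\<lambda>p. S (fst p) (snd p))" "\<And>x. distr lborel borel (S x) = lborel"
  shows "distr lborel borel (\<lambda>p. (fst p, S (fst p) (snd p))) = lborel"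
proof (rule measure_eqI)
  let ?T = "\<lambda>p. (fst p, S (fst p) (snd p))"
  have T: "?T \<in> borel_measurable borel"
    by (intro borel_measurable_continuous_onI continuous_intros S(1))
  have Sm: "S x \<in> borel_measurable borel" for x
  proof (rule borel_measurable_continuous_onI)
    have "continuous_on UNIV (\<lambda>y. (x, y))" by (intro continuous_intros)
    from continuous_on_compose2[OF S(1) this] show "continuous_on UNIV (S x)" by simp
  qed
  fix A :: "('a \<times> 'b) set" assume "A \<in> sets (distr lborel borel ?T)"
  then have A: "A \<in> sets borel" by simp
  have m1: "(\<lambda>p. indicator A (?T p) :: ennreal) \<in> borel_measurable (lborel \<Otimes>\<^sub>M lborel)"
    unfolding lborel_prod using measurable_compose[OF T borel_measurable_indicator[OF A]] by simp
  have m2: "(indicator A :: _ \<Rightarrow> ennreal) \<in> borel_measurable (lborel \<Otimes>\<^sub>M lborel)"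
    unfolding lborel_prod using A by simp
  have "emeasure (distr lborel borel ?T) A = (\<integral>\<^sup>+ p. indicator A p \<partial>distr lborel borel ?T)"
    using A by simp
  also have "\<dots> = (\<integral>\<^sup>+ p. indicator A (?T p) \<partial>lborel)"
    using T A by (intro nn_integral_distr) auto
  also have "\<dots> = (\<integral>\<^sup>+ x. \<integral>\<^sup>+ y. indicator A (?T (x, y)) \<partial>lborel \<partial>lborel)"
    using lborel.nn_integral_fst[OF m1] by (simp add: lborel_prod)
  also have "\<dots> = (\<integral>\<^sup>+ x. \<integral>\<^sup>+ y. indicator A (x, y) \<partial>lborel \<partial>lborel)"
  proof (rule nn_integral_cong)
    fix x :: 'a
    have m: "(\<lambda>y. indicator A (x, y) :: ennreal) \<in> borel_measurable borel"
    proof -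
      have "(\<lambda>y::'b. (x, y)) \<in> borel_measurable borel"
        by (intro borel_measurable_continuous_onI continuous_intros)
      from measurable_compose[OF this borel_measurable_indicator[OF A]] show ?thesis .
    qed
    have "(\<integral>\<^sup>+ y. indicator A (x, y) \<partial>lborel) = (\<integral>\<^sup>+ y. indicator A (x, y) \<partial>distr lborel borel (S x))"
      unfolding S(2)[of x] ..
    also have "\<dots> = (\<integral>\<^sup>+ y. indicator A (x, S x y) \<partial>lborel)"
      using m Sm by (intro nn_integral_distr) auto
    finally show "(\<integral>\<^sup>+ y. indicator A (?T (x, y)) \<partial>lborel) = (\<integral>\<^sup>+ y. indicator A (x, y) \<partial>lborel)" by simp
  qed
  also have "\<dots> = (\<integral>\<^sup>+ p. indicator A p \<partial>lborel)"
    using lborel.nn_integral_fst[OF m2] by (simp add: lborel_prod)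
  finally show "emeasure (distr lborel borel ?T) A = emeasure lborel A" using A by simp
qed simp

abbreviation e_t :: "'n::finite pt" where "e_t \<equiv> (1, 0, 0, 0)"
abbreviation in_x :: "real^'n \<Rightarrow> 'n::finite pt" where "in_x h \<equiv> (0, h, 0, 0)"
abbreviation in_z :: "real^'n \<Rightarrow> 'n::finite pt" where "in_z h \<equiv> (0, 0, 0, h)"

text \<open>
The linear part \<open>- x \<cdot> \<nabla>\<^sub>y\<close> of the transport field, without the term \<open>- y \<cdot> \<nabla>\<^sub>z\<close>: that term is moved to the right
hand side, which is what makes the integral curves straight.
\<close>

definition xdy :: "'n::finite pt \<Rightarrow> 'n pt" where
  "xdy X = (0, 0, - fst (snd X), 0)"

lemma bounded_linear_xdy: "bounded_linear (xdy :: 'n::finite pt \<Rightarrow> _)"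
  unfolding xdy_def[abs_def]
  by (intro bounded_linear_Pair bounded_linear_zero bounded_linear_minus
      bounded_linear_compose[OF bounded_linear_fst bounded_linear_snd])

text \<open>
The flow is a translation in \<open>t\<close> after a shear of \<open>(y, z)\<close> by a multiple of \<open>(x, 0)\<close>, for fixed \<open>t\<close>.
\<close>

lemma shear_field_transport: "shear_field (e_t :: 'n::finite pt) xdy"
proof (rule shear_field.intro)
  show "bounded_linear (xdy :: 'n pt \<Rightarrow> _)" by (rule bounded_linear_xdy)
  show "xdy (e_t :: 'n pt) = 0" by (simp add: xdy_def zero_prod_def)
  show "xdy (xdy X) = 0" for X :: "'n pt" by (simp add: xdy_def zero_prod_def)
  fix s :: real
  let ?S = "\<lambda>p::(real^'n) \<times> (real^'n) \<times> (real^'n). (fst p, snd p + (- s *\<^sub>R fst p, 0))"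
  let ?U = "\<lambda>p::'n pt. (fst p, ?S (snd p))"
  have S: "distr lborel borel ?S = lborel"
    using lborel_preserving_fibrewise[of "\<lambda>x p. p + (- s *\<^sub>R x, 0)"]
    by (simp add: lborel_preserving_translation continuous_intros)
  have cS: "continuous_on UNIV ?S" by (intro continuous_intros)
  have cS': "continuous_on UNIV (\<lambda>p::'n pt. ?S (snd p))" by (intro continuous_intros)
  have U: "distr lborel borel ?U = lborel"
    by (rule lborel_preserving_fibrewise[of "\<lambda>_::real. ?S", OF cS' S])
  have cU: "continuous_on UNIV ?U" by (intro continuous_intros)
  have "distr lborel borel (\<lambda>X::'n pt. X + s *\<^sub>R (e_t + xdy X)) = distr lborel borel ((\<lambda>X. X + s *\<^sub>R e_t) \<circ> ?U)"
    by (rule arg_cong[where f="distr lborel borel"]) (auto simp: xdy_def fun_eq_iff zero_prod_def)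
  also have "\<dots> = distr (distr lborel borel ?U) borel (\<lambda>X. X + s *\<^sub>R e_t)"
    using borel_measurable_continuous_onI[OF cU] by (intro distr_distr[symmetric]) auto
  also have "\<dots> = lborel" unfolding U by (rule lborel_preserving_translation)
  finally show "distr lborel borel (\<lambda>X::'n pt. X + s *\<^sub>R (e_t + xdy X)) = lborel" .
qed

section \<open>Points at which the solution is controlled\<close>

lemma open_Q: "open (Q r)"
  unfolding Q_def by (intro open_Times) auto

lemma convex_Q: "convex (Q r)"
  unfolding Q_def by (intro convex_Times) auto

lemma mem_Q2: "(t, x, y, z) \<in> Q 2 \<longleftrightarrow> -4 < t \<and> t < 0 \<and> norm x < 2 \<and> norm y < 8 \<and> norm z < 32"
  by (auto simp: Q_def)

lemma mem_Q1: "(t, x, y, z) \<in> Q 1 \<longleftrightarrow> -1 < t \<and> t < 0 \<and> norm x < 1 \<and> norm y < 1 \<and> norm z < 1"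
  by (auto simp: Q_def)

definition sqint :: "('n::finite pt \<Rightarrow> real) \<Rightarrow> ennreal" where
  "sqint f = (\<integral>\<^sup>+ X. ennreal ((f X)^2) \<partial>lebesgue_on (Q 2))"

text \<open>
The information about a solution that the propagation argument uses, all of size \<open>M\<close>: the solution on \<open>Q 1\<close>, tested
against test functions; its derivative along \<open>(1, 0, - x, 0)\<close>; its first derivatives in \<open>z\<close>; and its second
derivatives in \<open>x\<close>. First derivatives in \<open>x\<close> are only required to exist.
\<close>

definition controlled :: "('n::finite pt \<Rightarrow> real) \<Rightarrow> real \<Rightarrow> bool" where
  "controlled u M \<longleftrightarrow> 0 \<le> M \<and> locally_integrable (Q 2) u \<and>
    (\<forall>\<psi>. test_function (Q 1) \<psi> \<longrightarrow> \<bar>LINT X|lebesgue. u X * \<psi> X\<bar> \<le> M * l2 \<psi>) \<and>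
    (\<exists>f. weak_deriv (Q 2) (\<lambda>X. e_t + xdy X) u f \<and> sqint f \<le> ennreal (M^2)) \<and>
    (\<forall>h. \<exists>g. weak_deriv (Q 2) (\<lambda>_. in_z h) u g \<and> sqint g \<le> ennreal ((norm h * M)^2)) \<and>
    (\<forall>h. \<exists>g k. weak_deriv (Q 2) (\<lambda>_. in_x h) u g \<and> weak_deriv (Q 2) (\<lambda>_. in_x h) g k \<and>
        sqint k \<le> ennreal (((norm h)^2 * M)^2))"

text \<open>
Near \<open>p\<close> every controlled function is bounded by its data, in dual form. The definition also makes
sense for points on the boundary of \<open>Q 2\<close>, which is needed since compactness is applied to the
closure.
\<close>

definition good :: "'n::finite pt \<Rightarrow> bool" where
  "good p \<longleftrightarrow> (\<exists>\<epsilon>>0. \<exists>N\<ge>0. \<forall>u M. controlled u M \<longrightarrow>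
     (\<forall>\<psi>. test_function (ball p \<epsilon> \<inter> Q 2) \<psi> \<longrightarrow> \<bar>LINT X|lebesgue. u X * \<psi> X\<bar> \<le> N * M * l2 \<psi>))"

lemma goodI:
  assumes "0 < \<epsilon>" "0 \<le> N" "\<And>u M \<psi>. controlled u M \<Longrightarrow> test_function (ball p \<epsilon> \<inter> Q 2) \<psi> \<Longrightarrow>
    \<bar>LINT X|lebesgue. u X * \<psi> X\<bar> \<le> N * M * l2 \<psi>"
  shows "good p"
  unfolding good_def
  by (rule exI[of _ \<epsilon>], rule conjI[OF assms(1)], rule exI[of _ N], rule conjI[OF assms(2)]) (simp add: assms(3))

lemma test_function_mono: "test_function A \<psi> \<Longrightarrow> A \<subseteq> B \<Longrightarrow> test_function B \<psi>"
  unfolding test_function_smooth by (meson subset_trans)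

lemma good_Q1: assumes "p \<in> (Q 1 :: 'n::finite pt set)" shows "good p"
proof -
  obtain e where e: "e > 0" "ball p e \<subseteq> Q 1" using open_Q assms open_contains_ball by blast
  show ?thesis
  proof (rule goodI[OF e(1) zero_le_one])
    fix u :: "'n pt \<Rightarrow> real" and M \<psi>
    assume u: "controlled u M" and t: "test_function (ball p e \<inter> Q 2) \<psi>"
    have "test_function (Q 1) \<psi>" by (rule test_function_mono[OF t]) (use e in auto)
    then show "\<bar>LINT X|lebesgue. u X * \<psi> X\<bar> \<le> 1 * M * l2 \<psi>" using u unfolding controlled_def by simp
  qed
qed

lemma (in shear_field) tube_subset:
  assumes "\<And>r X. X \<in> K \<Longrightarrow> r \<in> {a..b} \<Longrightarrow> flow r X \<in> A"
  shows "tube a b K \<subseteq> A"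
  using assms unfolding tube_def by auto

text \<open>
Transport a test function \<open>\<psi>\<close> supported near \<open>p\<close> for the time \<open>s\<close>: it is then supported near the image point,
where \<open>u\<close> is bounded, and the pairing with \<open>u\<close> has changed by at most \<open>\<bar>s\<bar> C M\<close> times the norm of \<open>\<psi>\<close>. The
point \<open>p\<close> and its image may lie on the boundary of \<open>Q 2\<close>; only points of \<open>Q 2\<close> near \<open>p\<close> have to be
moved into \<open>Q 2\<close>.
\<close>

lemma good_move:
  fixes c :: "'n::finite pt"
  assumes sf: "shear_field c N" and C: "0 \<le> C"
    and wd: "\<And>u M. controlled u M \<Longrightarrow> \<exists>f. weak_deriv (Q 2) (\<lambda>X. c + N X) u f \<and> sqint f \<le> ennreal ((C * M)^2)"
    and U: "open U" "p \<in> U" "\<And>X. X \<in> U \<Longrightarrow> X \<in> Q 2 \<Longrightarrow> X + s *\<^sub>R (c + N X) \<in> Q 2"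
    and q: "good (p + s *\<^sub>R (c + N p))"
  shows "good p"
proof -
  interpret shear_field c N by (rule sf)
  have Vfun: "V = (\<lambda>X. c + N X)" by (simp add: V_def fun_eq_iff)
  have fl: "X + s *\<^sub>R (c + N X) = flow s X" for X by (simp add: flow_def V_def)
  from q obtain e Nq where e: "e > 0" and Nq: "Nq \<ge> 0" and gq0: "\<forall>u M. controlled u M \<longrightarrow>
     (\<forall>\<psi>. test_function (ball (flow s p) e \<inter> Q 2) \<psi> \<longrightarrow> \<bar>LINT X|lebesgue. u X * \<psi> X\<bar> \<le> Nq * M * l2 \<psi>)"
    unfolding good_def fl by (elim exE conjE)
  note gq = gq0[rule_format]
  have cf: "continuous_on UNIV (flow s)"
    using continuous_on_compose2[OF continuous_flow, of UNIV "\<lambda>X. (s, X)"] by (simp add: continuous_on_Pair continuous_on_const continuous_on_id)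
  have "open (U \<inter> flow s -` ball (flow s p) e)"
    using U(1) cf by (intro open_Int open_vimage) auto
  moreover have "p \<in> U \<inter> flow s -` ball (flow s p) e" using U(2) e by simp
  ultimately obtain d where d: "d > 0" "ball p d \<subseteq> U \<inter> flow s -` ball (flow s p) e"
    using open_contains_ball by metis
  have s_in: "flow s X \<in> ball (flow s p) e \<inter> Q 2" if "X \<in> ball p d \<inter> Q 2" for X
    using d(2) that U(3)[of X, unfolded fl] by auto
  let ?a = "min 0 s" and ?b = "max 0 s"
  \<comment> \<open>The whole path stays in the convex set \<open>Q 2\<close>, being a segment between two of its points.\<close>
  have seg: "flow r X \<in> Q 2" if X: "X \<in> ball p d \<inter> Q 2" and r: "r \<in> {?a..?b}" for X r
  proof (cases "s = 0")
    case True then show ?thesis using X r by simp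
  next
    case False
    define \<theta> where "\<theta> = r / s"
    have th: "0 \<le> \<theta>" "\<theta> \<le> 1"
      using r False unfolding \<theta>_def
      by (cases "s > 0"; simp add: zero_le_divide_iff divide_le_eq_1; linarith)+
    have "flow r X = (1 - \<theta>) *\<^sub>R X + \<theta> *\<^sub>R flow s X"
      using False by (simp add: flow_def \<theta>_def algebra_simps)
    moreover have "(1 - \<theta>) *\<^sub>R X + \<theta> *\<^sub>R flow s X \<in> Q 2"
      using convexD_alt[OF convex_Q, of X 2 "flow s X" \<theta>] X s_in[OF X] th by auto
    ultimately show ?thesis by simp
  qed
  have N0: "0 \<le> Nq + C * \<bar>s\<bar>" using Nq C by simp
  show ?thesis
  proof (rule goodI[OF d(1) N0])
    fix u :: "'n pt \<Rightarrow> real" and M \<psi>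
    assume u: "controlled u M" and t: "test_function (ball p d \<inter> Q 2) \<psi>"
    have M: "M \<ge> 0" using u by (simp add: controlled_def)
    obtain K where K: "smooth \<psi>" "compact K" "K \<subseteq> ball p d \<inter> Q 2" "\<And>X. X \<notin> K \<Longrightarrow> \<psi> X = 0"
      using t unfolding test_function_smooth by auto
    obtain f where f: "weak_deriv (Q 2) V u f" "sqint f \<le> ennreal ((C * M)^2)"
      using wd[OF u] unfolding Vfun by auto
    have tube: "tube ?a ?b K \<subseteq> Q 2" by (rule tube_subset) (rule seg[OF subsetD[OF K(3)]])
    have ts: "tube s s K \<subseteq> ball (flow s p) e \<inter> Q 2"
    proof (rule tube_subset)
      fix X r assume X: "X \<in> K" and r: "r \<in> {s..s}"
      from r have "r = s" by simp
      then show "flow r X \<in> ball (flow s p) e \<inter> Q 2" using s_in[OF subsetD[OF K(3) X]] by simp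
    qed
    have ss: "s \<in> {s..s}" by simp
    have "test_function (ball (flow s p) e \<inter> Q 2) (\<lambda>X. \<psi> (flow (-s) X))"
      by (rule test_function_flow[OF K(1,2,4) ss ts])
    from gq[OF u this] have 1: "\<bar>LINT X|lebesgue. u X * \<psi> (flow (-s) X)\<bar> \<le> Nq * M * l2 \<psi>"
      by (simp add: l2_flow[OF K(1)])
    have "\<bar>(LINT X|lebesgue. u X * \<psi> (flow (-0) X)) - (LINT X|lebesgue. u X * \<psi> (flow (-s) X))\<bar>
       \<le> (C * M) * l2 \<psi> * \<bar>0 - s\<bar>"
      by (rule transport_integral_bound[OF f(1) open_Q K(1,2,4) tube])
        (use f(2) C M in \<open>auto simp: sqint_def\<close>)
    then have 2: "\<bar>(LINT X|lebesgue. u X * \<psi> X) - (LINT X|lebesgue. u X * \<psi> (flow (-s) X))\<bar>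
       \<le> C * \<bar>s\<bar> * M * l2 \<psi>" by (simp add: mult_ac)
    have "(Nq + C * \<bar>s\<bar>) * M * l2 \<psi> = Nq * M * l2 \<psi> + C * \<bar>s\<bar> * M * l2 \<psi>" by (simp add: algebra_simps)
    with 1 2 show "\<bar>LINT X|lebesgue. u X * \<psi> X\<bar> \<le> (Nq + C * \<bar>s\<bar>) * M * l2 \<psi>" by linarith
  qed
qed

lemma goodE:
  assumes "good p"
  obtains \<epsilon> N where "0 < \<epsilon>" "0 \<le> N" "\<And>u M \<psi>. controlled u M \<Longrightarrow> test_function (ball p \<epsilon> \<inter> Q 2) \<psi> \<Longrightarrow>
    \<bar>LINT X|lebesgue. u X * \<psi> X\<bar> \<le> N * M * l2 \<psi>"
proof -
  from assms obtain e N where e: "0 < e" "0 \<le> N" and g: "\<forall>u M. controlled u M \<longrightarrow>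
     (\<forall>\<psi>. test_function (ball p e \<inter> Q 2) \<psi> \<longrightarrow> \<bar>LINT X|lebesgue. u X * \<psi> X\<bar> \<le> N * M * l2 \<psi>)"
    unfolding good_def by (elim exE conjE)
  show thesis by (rule that[OF e g[rule_format]])
qed

section \<open>Moving a controlled point\<close>

lemma good_z:
  assumes "norm z0 < 32" "norm z \<le> 32" "good (t, x, y, z0)"
  shows "good (t, x, y, z)"
proof (rule good_move[where c="in_z (z0 - z)" and N="\<lambda>_. 0" and s=1 and C="norm (z0 - z)" and U="{X. norm (snd (snd (snd X)) + (z0 - z)) < 32}"])
  show "shear_field (in_z (z0 - z)) (\<lambda>_. 0)" by (rule shear_field_const)
  show "\<exists>f. weak_deriv (Q 2) (\<lambda>X. in_z (z0 - z) + 0) u f \<and> sqint f \<le> ennreal ((norm (z0 - z) * M)\<^sup>2)"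
    if "controlled u M" for u M
    using that unfolding controlled_def by simp
  show "open {X::'a pt. norm (snd (snd (snd X)) + (z0 - z)) < 32}"
    by (intro open_Collect_less continuous_intros)
  show "(t, x, y, z) \<in> {X. norm (snd (snd (snd X)) + (z0 - z)) < 32}" using assms(1) by simp
  show "X + 1 *\<^sub>R (in_z (z0 - z) + 0) \<in> Q 2" if "X \<in> {X. norm (snd (snd (snd X)) + (z0 - z)) < 32}" "X \<in> Q 2" for X
    using that by (cases X) (simp add: mem_Q2)
  show "good ((t, x, y, z) + 1 *\<^sub>R (in_z (z0 - z) + 0))" using assms(3) by simp
qed simp

lemma good_transport:
  assumes "-4 < t + s" "t + s < 0" "norm (y - s *\<^sub>R x) < 8" "good (t + s, x, y - s *\<^sub>R x, z)"
  shows "good (t, x, y, z)"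
proof (rule good_move[where c=e_t and N=xdy and s=s and C=1 and
      U="{X. -4 < fst X + s} \<inter> {X. fst X + s < 0} \<inter> {X. norm (fst (snd (snd X)) - s *\<^sub>R fst (snd X)) < 8}"])
  show "shear_field (e_t::'a pt) xdy" by (rule shear_field_transport)
  show "\<exists>f. weak_deriv (Q 2) (\<lambda>X. e_t + xdy X) u f \<and> sqint f \<le> ennreal ((1 * M)\<^sup>2)"
    if "controlled u M" for u :: "'a pt \<Rightarrow> real" and M
    using that unfolding controlled_def by simp
  show "open ({X::'a pt. -4 < fst X + s} \<inter> {X. fst X + s < 0} \<inter> {X. norm (fst (snd (snd X)) - s *\<^sub>R fst (snd X)) < 8})"
    by (intro open_Int open_Collect_less continuous_intros)
  show "(t, x, y, z) \<in> {X. -4 < fst X + s} \<inter> {X. fst X + s < 0} \<inter> {X. norm (fst (snd (snd X)) - s *\<^sub>R fst (snd X)) < 8}"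
    using assms(1-3) by simp
  show "X + s *\<^sub>R (e_t + xdy X) \<in> Q 2" if "X \<in> {X. -4 < fst X + s} \<inter> {X. fst X + s < 0} \<inter> {X. norm (fst (snd (snd X)) - s *\<^sub>R fst (snd X)) < 8}" "X \<in> Q 2" for X :: "'a pt"
    using that by (cases X) (simp add: mem_Q2 xdy_def)
  show "good ((t, x, y, z) + s *\<^sub>R (e_t + xdy (t, x, y, z)))" using assms(4) by (simp add: xdy_def)
qed simp

text \<open>
The second difference along \<open>x, x + h, x + 2h\<close> expresses \<open>u\<close> near the first point by \<open>u\<close> near the other two.
\<close>

lemma good_x_second:
  fixes h x :: "real^'n::finite"
  assumes n: "norm (x + h) < 2" "norm (x + 2 *\<^sub>R h) < 2"
    and g1: "good (t, x + h, y, z)" and g2: "good (t, x + 2 *\<^sub>R h, y, z)"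
  shows "good (t, x, y, z)"
proof -
  let ?p = "(t, x, y, z) :: 'n pt"
  interpret shear_field "in_x h" "\<lambda>_. 0" by (rule shear_field_const)
  have fl: "flow s X = X + s *\<^sub>R in_x h" for s X by (simp add: flow_def V_def)
  have Vf: "V = (\<lambda>_. in_x h)" by (simp add: V_def fun_eq_iff)
  from g1 obtain e1 N1 where 1: "0 < e1" "0 \<le> N1" "\<And>u M \<psi>. controlled u M \<Longrightarrow> test_function (ball (t, x + h, y, z) e1 \<inter> Q 2) \<psi> \<Longrightarrow>
    \<bar>LINT X|lebesgue. u X * \<psi> X\<bar> \<le> N1 * M * l2 \<psi>" by (rule goodE) (rule that)
  from g2 obtain e2 N2 where 2: "0 < e2" "0 \<le> N2" "\<And>u M \<psi>. controlled u M \<Longrightarrow> test_function (ball (t, x + 2 *\<^sub>R h, y, z) e2 \<inter> Q 2) \<psi> \<Longrightarrow>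
    \<bar>LINT X|lebesgue. u X * \<psi> X\<bar> \<le> N2 * M * l2 \<psi>" by (rule goodE) (rule that)
  have d1: "dist (flow s ?p) (flow s X) = dist ?p X" for s X unfolding fl by (rule dist_add_cancel2)
  let ?U = "{X::'n pt. norm (fst (snd X) + h) < 2} \<inter> {X. norm (fst (snd X) + 2 *\<^sub>R h) < 2}"
  have "open ?U" by (intro open_Int open_Collect_less continuous_intros)
  moreover have "?p \<in> ?U" using n by simp
  ultimately obtain d0 where d0: "d0 > 0" "ball ?p d0 \<subseteq> ?U" using open_contains_ball by metis
  define d where "d = min d0 (min e1 e2)"
  have d: "d > 0" using d0(1) 1(1) 2(1) by (simp add: d_def)
  have end1: "flow 1 X \<in> ball (t, x + h, y, z) e1 \<inter> Q 2" and end2: "flow 2 X \<in> ball (t, x + 2 *\<^sub>R h, y, z) e2 \<inter> Q 2"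
    if X: "X \<in> ball ?p d \<inter> Q 2" for X
  proof -
    have dX: "dist ?p X < d" using X by simp
    have "X \<in> ball ?p d0" using dX by (simp add: d_def)
    then have XU: "X \<in> ?U" using d0(2) by (rule subsetD[rotated])
    have q: "flow 1 X \<in> Q 2" "flow 2 X \<in> Q 2" using XU X by (cases X; simp add: fl mem_Q2)+
    have "flow 1 ?p = (t, x + h, y, z)" "flow 2 ?p = (t, x + 2 *\<^sub>R h, y, z)" by (simp_all add: fl)
    with d1[of 1 X] d1[of 2 X] have "dist (t, x + h, y, z) (flow 1 X) < e1" "dist (t, x + 2 *\<^sub>R h, y, z) (flow 2 X) < e2"
      using dX by (simp_all add: d_def)
    with q show "flow 1 X \<in> ball (t, x + h, y, z) e1 \<inter> Q 2" "flow 2 X \<in> ball (t, x + 2 *\<^sub>R h, y, z) e2 \<inter> Q 2" by simp_all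
  qed
  have seg: "flow r X \<in> Q 2" if X: "X \<in> ball ?p d \<inter> Q 2" and r: "r \<in> {0..2}" for X r
  proof -
    have "flow r X = (1 - r/2) *\<^sub>R X + (r/2) *\<^sub>R flow 2 X"
      by (simp add: flow_def algebra_simps flip: scaleR_add_left)
    moreover have "(1 - r/2) *\<^sub>R X + (r/2) *\<^sub>R flow 2 X \<in> Q 2"
      using convexD_alt[OF convex_Q, of X 2 "flow 2 X" "r/2"] X end2[OF X] r by auto
    ultimately show ?thesis by simp
  qed
  have N0: "0 \<le> 2 * N1 + N2 + (norm h)^2" using 1 2 by simp
  show ?thesis
  proof (rule goodI[OF d N0])
    fix u :: "'n pt \<Rightarrow> real" and M \<psi>
    assume u: "controlled u M" and t: "test_function (ball ?p d \<inter> Q 2) \<psi>"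
    have M: "M \<ge> 0" using u by (simp add: controlled_def)
    obtain K where K: "smooth \<psi>" "compact K" "K \<subseteq> ball ?p d \<inter> Q 2" "\<And>X. X \<notin> K \<Longrightarrow> \<psi> X = 0"
      using t unfolding test_function_smooth by auto
    have "\<forall>h. \<exists>g k. weak_deriv (Q 2) (\<lambda>_. in_x h) u g \<and> weak_deriv (Q 2) (\<lambda>_. in_x h) g k \<and>
        sqint k \<le> ennreal (((norm h)^2 * M)^2)" using u unfolding controlled_def by (elim conjE)
    from this[rule_format, of h] obtain g k where gk: "weak_deriv (Q 2) V u g" "weak_deriv (Q 2) V g k" "sqint k \<le> ennreal (((norm h)^2 * M)^2)"
      unfolding Vf by (elim exE conjE)
    have one: "1 \<in> {1..1::real}" and two: "2 \<in> {2..2::real}" by simp_all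
    have tube: "tube 0 2 K \<subseteq> Q 2" by (rule tube_subset) (rule seg[OF subsetD[OF K(3)]])
    have t1: "tube 1 1 K \<subseteq> ball (t, x + h, y, z) e1 \<inter> Q 2"
    proof (rule tube_subset)
      fix X r assume X: "X \<in> K" and "r \<in> {1..1::real}"
      then have "r = 1" by simp
      then show "flow r X \<in> ball (t, x + h, y, z) e1 \<inter> Q 2" using end1[OF subsetD[OF K(3) X]] by simp
    qed
    have t2: "tube 2 2 K \<subseteq> ball (t, x + 2 *\<^sub>R h, y, z) e2 \<inter> Q 2"
    proof (rule tube_subset)
      fix X r assume X: "X \<in> K" and "r \<in> {2..2::real}"
      then have "r = 2" by simp
      then show "flow r X \<in> ball (t, x + 2 *\<^sub>R h, y, z) e2 \<inter> Q 2" using end2[OF subsetD[OF K(3) X]] by simp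
    qed
    have "test_function (ball (t, x + h, y, z) e1 \<inter> Q 2) (\<lambda>X. \<psi> (flow (-1) X))"
      by (rule test_function_flow[OF K(1,2,4) one t1])
    from 1(3)[OF u this] have b1: "\<bar>LINT X|lebesgue. u X * \<psi> (flow (-1) X)\<bar> \<le> N1 * M * l2 \<psi>"
      by (simp add: l2_flow[OF K(1)])
    have "test_function (ball (t, x + 2 *\<^sub>R h, y, z) e2 \<inter> Q 2) (\<lambda>X. \<psi> (flow (-2) X))"
      by (rule test_function_flow[OF K(1,2,4) two t2])
    from 2(3)[OF u this] have b2: "\<bar>LINT X|lebesgue. u X * \<psi> (flow (-2) X)\<bar> \<le> N2 * M * l2 \<psi>"
      by (simp add: l2_flow[OF K(1)])
    have "\<bar>(LINT X|lebesgue. u X * \<psi> X) - 2 * (LINT X|lebesgue. u X * \<psi> (flow (-1) X))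
      + (LINT X|lebesgue. u X * \<psi> (flow (-2) X))\<bar> \<le> ((norm h)^2 * M) * l2 \<psi>"
      by (rule second_difference_bound[OF gk(1,2) open_Q K(1,2,4) tube])
        (use gk(3) M in \<open>auto simp: sqint_def\<close>)
    moreover have "(2 * N1 + N2 + (norm h)^2) * M * l2 \<psi> = 2 * (N1 * M * l2 \<psi>) + N2 * M * l2 \<psi> + ((norm h)^2 * M) * l2 \<psi>"
      by (simp add: algebra_simps)
    ultimately show "\<bar>LINT X|lebesgue. u X * \<psi> X\<bar> \<le> (2 * N1 + N2 + (norm h)^2) * M * l2 \<psi>"
      using b1 b2 by linarith
  qed
qed

text \<open>
A function with bounded second derivatives is affine up to a bounded error, and an affine function is
determined by its values on any small ball. Concretely, the midpoint of \<open>x\<close> and \<open>c\<close> has half the distance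
from \<open>c\<close>, so good points around \<open>c\<close> extend to balls of doubled radius.
\<close>

lemma good_x_ball:
  fixes c :: "real^'n::finite"
  assumes c: "norm c < 2" and r: "0 < r" and g: "\<And>x. norm x \<le> 2 \<Longrightarrow> norm (x - c) < r \<Longrightarrow> good (t, x, y, z)"
    and x: "norm x \<le> 2"
  shows "good (t, x, y, z)"
proof -
  have *: "good (t, x, y, z)" if "norm x \<le> 2" "norm (x - c) < 2^k * r" for k x
    using that
  proof (induction k arbitrary: x)
    case 0 then show ?case using g by simp
  next
    case (Suc k)
    \<comment> \<open>With this \<open>h\<close>, the points \<open>x + h\<close> and \<open>x + 2h\<close> are the midpoint and \<open>c\<close> itself.\<close>
    define h where "h = (1/2) *\<^sub>R (c - x)"
    have m: "x + h - c = (1/2) *\<^sub>R (x - c)" unfolding h_def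
      by (simp add: vec_eq_iff field_simps)
    have m2: "x + h = (1/2) *\<^sub>R x + (1/2) *\<^sub>R c" unfolding h_def by (simp add: vec_eq_iff field_simps)
    have c2: "x + 2 *\<^sub>R h = c" unfolding h_def by (simp add: vec_eq_iff field_simps)
    have n: "norm (x + h) < 2"
      using norm_triangle_ineq[of "(1/2) *\<^sub>R x" "(1/2) *\<^sub>R c"] Suc.prems(1) c unfolding m2 by simp
    have "norm (x + h - c) < 2^k * r" using Suc.prems(2) unfolding m by simp
    then have "good (t, x + h, y, z)" using n by (intro Suc.IH) auto
    moreover have "good (t, x + 2 *\<^sub>R h, y, z)" unfolding c2 using c r by (intro g) auto
    ultimately show ?case using n c c2 by (intro good_x_second[of x h]) auto
  qed
  obtain k where "norm (x - c) / r < 2^k" using real_arch_pow[of 2] by auto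
  then have "norm (x - c) < 2^k * r" using r by (simp add: divide_less_eq)
  then show ?thesis using * x by blast
qed

section \<open>Reaching the whole cylinder\<close>

text \<open>
The \<open>x\<close> and \<open>z\<close> variables are easily exhausted, so that the search for good points takes place
in the plane of \<open>(t, y)\<close>.
\<close>

definition good_slice :: "real \<Rightarrow> real^'n::finite \<Rightarrow> bool" where
  "good_slice t y \<longleftrightarrow> (\<forall>x z. norm x \<le> 2 \<longrightarrow> norm z \<le> 32 \<longrightarrow> good (t, x, y, z))"

text \<open>
First spread from the small ball to all \<open>x\<close>, then from \<open>z = 0\<close> to all \<open>z\<close>.
\<close>

lemma good_sliceI:
  fixes c :: "real^'n::finite"
  assumes c: "norm c < 2" and r: "0 < r" and g: "\<And>x. norm x \<le> 2 \<Longrightarrow> norm (x - c) < r \<Longrightarrow> good (t, x, y, 0)"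
  shows "good_slice t y"
  unfolding good_slice_def
proof (intro allI impI)
  fix x z :: "real^'n" assume x: "norm x \<le> 2" and z: "norm z \<le> 32"
  have g0: "good (t, x, y, 0)" by (rule good_x_ball[OF c r g x])
  show "good (t, x, y, z)" by (rule good_z[OF _ z g0]) simp
qed

lemma good_slice_start:
  fixes y :: "real^'n::finite"
  assumes "-1 < t" "t < 0" "norm y < 1" shows "good_slice t y"
proof (rule good_sliceI[of 0 1])
  show "good (t, x, y, 0)" if "norm (x - 0) < 1" for x :: "real^'n"
    by (rule good_Q1) (use assms that in \<open>simp add: mem_Q1\<close>)
qed simp_all

text \<open>
To move from \<open>(t, y)\<close> to \<open>(t + s, y')\<close> use the velocity \<open>c = (y - y') / s\<close>, which is admissible since \<open>\<bar>c\<bar> < 2\<close>.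
Velocities \<open>x\<close> near \<open>c\<close> lead to points near \<open>y'\<close>, and a small ball of \<open>x\<close> suffices.
\<close>

lemma good_slice_step:
  fixes y y' :: "real^'n::finite"
  assumes s: "s \<noteq> 0" "-4 < t + s" "t + s < 0" and y: "norm (y - y') < 2 * \<bar>s\<bar>" and y': "norm y' < R" "R \<le> 8"
    and g: "\<And>w :: real^'n. norm w < R \<Longrightarrow> good_slice (t + s) w"
  shows "good_slice t y"
proof (rule good_sliceI)
  let ?c = "(1/s) *\<^sub>R (y - y')"
  show "norm ?c < 2" using y s(1) by (simp add: divide_less_eq)
  show "0 < (R - norm y') / \<bar>s\<bar>" using y' s(1) by simp
  fix x :: "real^'n" assume x: "norm x \<le> 2" "norm (x - ?c) < (R - norm y') / \<bar>s\<bar>"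
  have e: "y - s *\<^sub>R x = y' - s *\<^sub>R (x - ?c)" using s(1) by (simp add: algebra_simps)
  have "norm (s *\<^sub>R (x - ?c)) < R - norm y'" using x(2) s(1) by (simp add: less_divide_eq mult.commute)
  then have n: "norm (y - s *\<^sub>R x) < R" unfolding e using norm_triangle_ineq4[of y' "s *\<^sub>R (x - ?c)"] by linarith
  from g[OF n] have g1: "good (t + s, x, y - s *\<^sub>R x, 0)" using x(1) unfolding good_slice_def by simp
  have "norm (y - s *\<^sub>R x) < 8" using n y' by simp
  from good_transport[OF s(2,3) this g1] show "good (t, x, y, 0)" .
qed

text \<open>
Whatever \<open>t\<close> is, one of the times \<open>- 1/4\<close> and \<open>- 3/4\<close> is at distance at least \<open>1/4\<close>, and velocities up
to \<open>2\<close> move \<open>y\<close> by up to \<open>1/2\<close> during that time. So the radius in \<open>y\<close> grows by \<open>1/2\<close>, and all times in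
\<open>{-4..0}\<close> are reached from those in \<open>(-1, 0)\<close>.
\<close>

lemma good_slice_grow:
  fixes y :: "real^'n::finite"
  assumes g: "\<And>t (w :: real^'n). -1 < t \<Longrightarrow> t < 0 \<Longrightarrow> norm w < R \<Longrightarrow> good_slice t w"
    and R: "0 < R" "R \<le> 8" and t: "-4 \<le> t" "t \<le> 0" and y: "norm y < R + 1/2"
  shows "good_slice t y"
proof -
  define s where "s = (if t \<le> -1/2 then -1/4 - t else -3/4 - t)"
  have s: "s \<noteq> 0" "-1 < t + s" "t + s < 0" "\<bar>s\<bar> \<ge> 1/4" using t by (auto simp: s_def)
  \<comment> \<open>The target \<open>\<theta> y\<close> divides the allowed norm \<open>R + 1/2\<close> in the ratio \<open>R : 1/2\<close>.\<close>
  define \<theta> where "\<theta> = R / (R + 1/2)"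
  have l: "0 < \<theta>" "1 - \<theta> = (1/2) / (R + 1/2)" using R by (auto simp: \<theta>_def field_simps)
  have "norm (\<theta> *\<^sub>R y) = \<theta> * norm y" using l by simp
  also have "\<dots> < \<theta> * (R + 1/2)" using l y by (intro mult_strict_left_mono) auto
  also have "\<dots> = R" using R by (simp add: \<theta>_def)
  finally have n1: "norm (\<theta> *\<^sub>R y) < R" .
  have l1: "1 - \<theta> > 0" unfolding l(2) using R by simp
  have "y - \<theta> *\<^sub>R y = (1 - \<theta>) *\<^sub>R y" by (simp add: algebra_simps)
  then have "norm (y - \<theta> *\<^sub>R y) = (1 - \<theta>) * norm y" using l1 by simp
  also have "\<dots> < (1 - \<theta>) * (R + 1/2)" using l1 y by (intro mult_strict_left_mono) auto
  also have "\<dots> = 1/2" unfolding l(2) using R by simp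
  finally have n2: "norm (y - \<theta> *\<^sub>R y) < 2 * \<bar>s\<bar>" using s(4) by linarith
  show ?thesis
  proof (rule good_slice_step[OF s(1) _ s(3) n2 n1 R(2)])
    show "-4 < t + s" using s(2) by simp
    show "good_slice (t + s) w" if "norm w < R" for w :: "real^'n" by (rule g[OF s(2,3) that])
  qed
qed

text \<open>
Going back and forth in \<open>(-1, 0)\<close>, the radius grows from \<open>1\<close> to \<open>8\<close> in \<open>14\<close> steps; one more step gives the boundary
and the remaining times.
\<close>

lemma good_slice_all:
  fixes y :: "real^'n::finite"
  assumes t: "-4 \<le> t" "t \<le> 0" and y: "norm y \<le> 8"
  shows "good_slice t y"
proof -
  have *: "good_slice t w" if "-1 < t" "t < 0" "norm w < 1 + real k / 2" "k \<le> 14" for k t and w :: "real^'n"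
    using that
  proof (induction k arbitrary: t w)
    case 0 then show ?case using good_slice_start[of t w] by simp
  next
    case (Suc k)
    have w: "norm w < 1 + real k / 2 + 1 / 2" using Suc.prems(3) by (simp add: field_simps)
    have k: "1 + real k / 2 \<le> 8" "0 < 1 + real k / 2" using Suc.prems(4) by simp_all
    show ?case
    proof (rule good_slice_grow[of "1 + real k / 2"])
      show "good_slice t w" if "-1 < t" "t < 0" "norm w < 1 + real k / 2" for t and w :: "real^'n"
        by (rule Suc.IH[OF that]) (use Suc.prems(4) in simp)
    qed (use Suc.prems(1,2) w k in simp_all)
  qed
  show ?thesis
  proof (rule good_slice_grow[of 8])
    show "good_slice t w" if "-1 < t" "t < 0" "norm w < 8" for t and w :: "real^'n"
      by (rule *[of t w 14]) (use that in simp_all)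
  qed (use t y in simp_all)
qed

lemma closure_Q2: "closure (Q 2 :: 'n::finite pt set) = {-4..0} \<times> cball 0 2 \<times> cball 0 8 \<times> cball 0 32"
  by (simp add: Q_def closure_Times)

lemma good_closure_Q2: "p \<in> closure (Q 2) \<Longrightarrow> good p"
proof -
  assume p: "p \<in> closure (Q 2)"
  obtain t x y z where e: "p = (t, x, y, z)" by (cases p)
  have b: "-4 \<le> t" "t \<le> 0" "norm x \<le> 2" "norm y \<le> 8" "norm z \<le> 32" using p unfolding e closure_Q2 by auto
  from good_slice_all[OF b(1,2,4)] show "good p" unfolding e good_slice_def using b(3,5) by simp
qed

text \<open>
Finitely many neighbourhoods of good points cover the compact closure of \<open>Q 2\<close>. On each of them the
dual bound is turned into a bound of the square integral, and these are summed. The constant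
depends on the dimension only.
\<close>

lemma controlled_L2_bound:
  "\<exists>N\<ge>0. \<forall>(u :: 'n::finite pt \<Rightarrow> real) M. controlled u M \<longrightarrow> sqint u \<le> ennreal (N * M^2)"
proof -
  let ?C = "closure (Q 2) :: 'n pt set"
  have "\<forall>p\<in>?C. \<exists>q. 0 < fst q \<and> 0 \<le> snd q \<and>
    (\<forall>u M. controlled u M \<longrightarrow> (\<integral>\<^sup>+ X. ennreal ((u X)^2) \<partial>lebesgue_on (ball p (fst q) \<inter> Q 2)) \<le> ennreal (snd q * M^2))"
  proof
    fix p assume p: "p \<in> ?C"
    from good_closure_Q2[OF p] obtain e N where e: "0 < e" "0 \<le> N" "\<And>u M \<psi>. controlled u M \<Longrightarrow> test_function (ball p e \<inter> Q 2) \<psi> \<Longrightarrow>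
      \<bar>LINT X|lebesgue. u X * \<psi> X\<bar> \<le> N * M * l2 \<psi>" by (rule goodE) (rule that)
    have "(\<integral>\<^sup>+ X. ennreal ((u X)^2) \<partial>lebesgue_on (ball p e \<inter> Q 2)) \<le> ennreal (N^2 * M^2)" if u: "controlled u M" for u :: "'n pt \<Rightarrow> real" and M
    proof -
      have "locally_integrable (ball p e \<inter> Q 2) u" using u unfolding controlled_def locally_integrable_def by simp
      moreover have "0 \<le> N * M" using u e unfolding controlled_def by simp
      ultimately have "(\<integral>\<^sup>+ X. ennreal ((u X)^2) \<partial>lebesgue_on (ball p e \<inter> Q 2)) \<le> ennreal ((N * M)^2)"
        using e(3)[OF u] open_Q by (intro L2_bound_by_duality) auto
      then show ?thesis by (simp add: power_mult_distrib)
    qed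
    then show "\<exists>q. 0 < fst q \<and> 0 \<le> snd q \<and>
      (\<forall>u M. controlled u M \<longrightarrow> (\<integral>\<^sup>+ X. ennreal ((u X)^2) \<partial>lebesgue_on (ball p (fst q) \<inter> Q 2)) \<le> ennreal (snd q * M^2))"
      using e(1) by (intro exI[of _ "(e, N^2)"]) simp
  qed
  from bchoice[OF this] obtain q where q: "\<forall>p\<in>?C. 0 < fst (q p) \<and> 0 \<le> snd (q p) \<and>
    (\<forall>u M. controlled u M \<longrightarrow> (\<integral>\<^sup>+ X. ennreal ((u X)^2) \<partial>lebesgue_on (ball p (fst (q p)) \<inter> Q 2)) \<le> ennreal (snd (q p) * M^2))"
    by (elim exE)
  define e where "e = (\<lambda>p. fst (q p))"
  define N where "N = (\<lambda>p. snd (q p))"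
  have eN: "0 < e p" "0 \<le> N p"
    "controlled u M \<Longrightarrow> (\<integral>\<^sup>+ X. ennreal ((u X)^2) \<partial>lebesgue_on (ball p (e p) \<inter> Q 2)) \<le> ennreal (N p * M^2)"
    if "p \<in> ?C" for p u M
    using bspec[OF q that] unfolding e_def N_def by simp_all
  have C: "compact ?C" unfolding closure_Q2 by (intro compact_Times) auto
  have cover: "?C \<subseteq> \<Union>((\<lambda>p. ball p (e p)) ` ?C)"
  proof
    fix p assume p: "p \<in> ?C"
    have "p \<in> ball p (e p)" using eN(1)[OF p] by simp
    then show "p \<in> \<Union>((\<lambda>p. ball p (e p)) ` ?C)" by (rule UN_I[OF p])
  qed
  obtain D where D: "D \<subseteq> ?C" "finite D" "?C \<subseteq> \<Union>((\<lambda>p. ball p (e p)) ` D)"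
    by (rule compactE_image[OF C _ cover]) (rule open_ball, rule that)
  have "sqint u \<le> ennreal ((\<Sum>p\<in>D. N p) * M^2)" if u: "controlled u M" for u :: "'n pt \<Rightarrow> real" and M
  proof -
    have lu: "locally_integrable (Q 2) u" using u by (simp add: controlled_def)
    have um: "(\<lambda>X. indicator (Q 2) X * u X) \<in> borel_measurable lebesgue" by (rule locally_integrable_measurable[OF open_Q lu])
    let ?v = "\<lambda>X. (indicator (Q 2) X * u X)^2"
    have "sqint u = (\<integral>\<^sup>+ X. ennreal ((u X)^2) * indicator (Q 2) X \<partial>lebesgue)"
      unfolding sqint_def using open_imp_lebesgue[OF open_Q] by (subst nn_integral_restrict_space) simp_all
    also have "\<dots> \<le> (\<integral>\<^sup>+ X. (\<Sum>p\<in>D. ennreal (?v X) * indicator (ball p (e p)) X) \<partial>lebesgue)"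
    proof (rule nn_integral_mono)
      fix X :: "'n pt"
      show "ennreal ((u X)^2) * indicator (Q 2) X \<le> (\<Sum>p\<in>D. ennreal (?v X) * indicator (ball p (e p)) X)"
      proof (cases "X \<in> Q 2")
        case True
        then have XC: "X \<in> ?C" using closure_subset by (rule subsetD[rotated])
        from subsetD[OF D(3) XC] obtain p where p: "p \<in> D" "X \<in> ball p (e p)" by (rule UN_E)
        have "ennreal ((u X)^2) * indicator (Q 2) X = ennreal (?v X) * indicator (ball p (e p)) X"
          using True p(2) by simp
        also have "\<dots> \<le> (\<Sum>p\<in>D. ennreal (?v X) * indicator (ball p (e p)) X)"
          using p(1) D(2) by (intro member_le_sum) auto
        finally show ?thesis .
      qed simp
    qed
    also have "\<dots> = (\<Sum>p\<in>D. \<integral>\<^sup>+ X. ennreal (?v X) * indicator (ball p (e p)) X \<partial>lebesgue)"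
    proof (rule nn_integral_sum)
      fix p assume "p \<in> D"
      have [measurable]: "ball p (e p) \<in> sets lebesgue" by (rule open_imp_lebesgue[OF open_ball])
      note um[measurable]
      show "(\<lambda>X. ennreal (?v X) * indicator (ball p (e p)) X) \<in> borel_measurable lebesgue" by measurable
    qed
    also have "\<dots> \<le> (\<Sum>p\<in>D. ennreal (N p * M^2))"
    proof (rule sum_mono)
      fix p assume p: "p \<in> D"
      have "(\<integral>\<^sup>+ X. ennreal (?v X) * indicator (ball p (e p)) X \<partial>lebesgue) = (\<integral>\<^sup>+ X. ennreal ((u X)^2) * indicator (ball p (e p) \<inter> Q 2) X \<partial>lebesgue)"
      proof (rule nn_integral_cong)
        fix X :: "'n pt"
        show "ennreal (?v X) * indicator (ball p (e p)) X = ennreal ((u X)^2) * indicator (ball p (e p) \<inter> Q 2) X"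
          by (cases "X \<in> Q 2"; cases "X \<in> ball p (e p)") simp_all
      qed
      also have "\<dots> = (\<integral>\<^sup>+ X. ennreal ((u X)^2) \<partial>lebesgue_on (ball p (e p) \<inter> Q 2))"
        using open_imp_lebesgue[OF open_Int[OF open_ball open_Q]] by (subst nn_integral_restrict_space) simp_all
      also have "\<dots> \<le> ennreal (N p * M^2)" by (rule eN(3)[OF subsetD[OF D(1) p] u])
      finally show "(\<integral>\<^sup>+ X. ennreal (?v X) * indicator (ball p (e p)) X \<partial>lebesgue) \<le> ennreal (N p * M^2)" .
    qed
    also have "\<dots> = ennreal ((\<Sum>p\<in>D. N p) * M^2)"
      using eN(2) D(1) by (subst sum_ennreal) (auto simp: sum_distrib_right)
    finally show ?thesis .
  qed
  moreover have "0 \<le> (\<Sum>p\<in>D. N p)" using eN(2) D(1) by (intro sum_nonneg) auto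
  ultimately show ?thesis by blast
qed

section \<open>Symmetry of second derivatives of test functions\<close>

lemma smooth_line_derivative:
  assumes "smooth f"
  shows "((\<lambda>s. f (y + s *\<^sub>R v)) has_real_derivative dderiv v f (y + s *\<^sub>R v)) (at s)"
proof -
  interpret D: bounded_linear "frechet_derivative f (at (y + s *\<^sub>R v))"
    using smooth_has_derivative[OF assms] has_derivative_bounded_linear by blast
  have "((\<lambda>s. y + s *\<^sub>R v) has_derivative (\<lambda>h. h *\<^sub>R v)) (at s)"
    by (auto intro!: derivative_eq_intros)
  from has_derivative_compose[OF this smooth_has_derivative[OF assms]]
  have "((\<lambda>s. f (y + s *\<^sub>R v)) has_derivative (\<lambda>h. frechet_derivative f (at (y + s *\<^sub>R v)) (h *\<^sub>R v))) (at s)" .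
  moreover have "(\<lambda>h. frechet_derivative f (at (y + s *\<^sub>R v)) (h *\<^sub>R v)) = (*) (dderiv v f (y + s *\<^sub>R v))"
    by (rule ext) (simp add: D.scaleR)
  ultimately show ?thesis unfolding has_field_derivative_def by simp
qed

text \<open>
Two applications of the mean value theorem write the quotient as the mixed derivative at a point within
\<open>h (\<bar>v\<bar> + \<bar>w\<bar>)\<close> of \<open>x\<close>.
\<close>

lemma second_difference_quotient_limit:
  assumes f: "smooth f"
  shows "((\<lambda>h. (f (x + h *\<^sub>R v + h *\<^sub>R w) - f (x + h *\<^sub>R v) - f (x + h *\<^sub>R w) + f x) / h^2)
    \<longlongrightarrow> dderiv w (dderiv v f) x) (at_right 0)"
proof (rule tendstoI)
  fix e :: real assume e: "e > 0"
  let ?D = "dderiv w (dderiv v f)"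
  have sD: "smooth (dderiv v f)" "smooth ?D" using f by (auto intro: smooth_dderiv)
  have "continuous (at x) ?D" using smooth_continuous[OF sD(2)] by (simp add: continuous_on_eq_continuous_within)
  then obtain d where d: "d > 0" "\<And>y. dist y x < d \<Longrightarrow> dist (?D y) (?D x) < e"
    using e unfolding continuous_at_eps_delta by blast
  \<comment> \<open>The summand \<open>1\<close> avoids a division by zero for \<open>v = w = 0\<close>.\<close>
  define b where "b = d / (norm v + norm w + 1)"
  have b: "b > 0" using d(1) unfolding b_def by (intro divide_pos_pos) (auto intro: add_nonneg_pos)
  show "\<forall>\<^sub>F h in at_right 0. dist ((f (x + h *\<^sub>R v + h *\<^sub>R w) - f (x + h *\<^sub>R v) - f (x + h *\<^sub>R w) + f x) / h^2) (?D x) < e"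
    unfolding eventually_at_right_field
  proof (intro exI[of _ b] conjI b allI impI)
    fix h :: real assume h0: "0 < h" and hb: "h < b"
    have "\<exists>s. 0 < s \<and> s < h \<and> (f (x + h *\<^sub>R w + h *\<^sub>R v) - f (x + h *\<^sub>R v)) - (f (x + h *\<^sub>R w + 0 *\<^sub>R v) - f (x + 0 *\<^sub>R v))
      = (h - 0) * (dderiv v f (x + h *\<^sub>R w + s *\<^sub>R v) - dderiv v f (x + s *\<^sub>R v))"
      by (rule MVT2[OF h0]) (intro DERIV_diff smooth_line_derivative f)
    then obtain s where s: "0 < s" "s < h" and s1: "(f (x + h *\<^sub>R w + h *\<^sub>R v) - f (x + h *\<^sub>R v)) - (f (x + h *\<^sub>R w + 0 *\<^sub>R v) - f (x + 0 *\<^sub>R v))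
      = (h - 0) * (dderiv v f (x + h *\<^sub>R w + s *\<^sub>R v) - dderiv v f (x + s *\<^sub>R v))" by (elim exE conjE)
    have "\<exists>r. 0 < r \<and> r < h \<and> dderiv v f (x + s *\<^sub>R v + h *\<^sub>R w) - dderiv v f (x + s *\<^sub>R v + 0 *\<^sub>R w)
      = (h - 0) * ?D (x + s *\<^sub>R v + r *\<^sub>R w)"
      by (rule MVT2[OF h0]) (intro smooth_line_derivative sD)
    then obtain r where r: "0 < r" "r < h" and r1: "dderiv v f (x + s *\<^sub>R v + h *\<^sub>R w) - dderiv v f (x + s *\<^sub>R v + 0 *\<^sub>R w)
      = (h - 0) * ?D (x + s *\<^sub>R v + r *\<^sub>R w)" by (elim exE conjE)
    have c1: "x + h *\<^sub>R w + s *\<^sub>R v = x + s *\<^sub>R v + h *\<^sub>R w" "x + h *\<^sub>R w + h *\<^sub>R v = x + h *\<^sub>R v + h *\<^sub>R w"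
      by (simp_all add: algebra_simps)
    have "f (x + h *\<^sub>R v + h *\<^sub>R w) - f (x + h *\<^sub>R v) - f (x + h *\<^sub>R w) + f x = h * (h * ?D (x + s *\<^sub>R v + r *\<^sub>R w))"
      using s1 r1 unfolding c1 by simp
    then have q: "(f (x + h *\<^sub>R v + h *\<^sub>R w) - f (x + h *\<^sub>R v) - f (x + h *\<^sub>R w) + f x) / h^2 = ?D (x + s *\<^sub>R v + r *\<^sub>R w)"
      using h0 by (simp add: power2_eq_square)
    have "dist (x + s *\<^sub>R v + r *\<^sub>R w) x = norm (s *\<^sub>R v + r *\<^sub>R w)" by (simp add: dist_norm)
    also have "\<dots> \<le> s * norm v + r * norm w" using norm_triangle_ineq[of "s *\<^sub>R v" "r *\<^sub>R w"] s r by simp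
    also have "\<dots> \<le> h * norm v + h * norm w" using s r by (intro add_mono mult_right_mono) auto
    also have "\<dots> \<le> h * (norm v + norm w + 1)" using h0 by (simp add: algebra_simps)
    also have "\<dots> < b * (norm v + norm w + 1)" using hb by (intro mult_strict_right_mono) (auto intro: add_nonneg_pos)
    also have "\<dots> = d"
    proof -
      have "norm v + norm w + 1 \<noteq> 0" using norm_ge_zero[of v] norm_ge_zero[of w] by linarith
      then show ?thesis by (simp add: b_def)
    qed
    finally show "dist ((f (x + h *\<^sub>R v + h *\<^sub>R w) - f (x + h *\<^sub>R v) - f (x + h *\<^sub>R w) + f x) / h^2) (?D x) < e"
      unfolding q by (rule d(2))
  qed
qed

text \<open>
The second difference is symmetric in \<open>v\<close> and \<open>w\<close>.
\<close>

lemma dderiv_commute: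
  assumes "smooth f" shows "dderiv w (dderiv v f) x = dderiv v (dderiv w f) x"
proof (rule tendsto_unique[OF _ second_difference_quotient_limit[OF assms]])
  have e: "f (x + h *\<^sub>R v + h *\<^sub>R w) - f (x + h *\<^sub>R v) - f (x + h *\<^sub>R w) + f x
    = f (x + h *\<^sub>R w + h *\<^sub>R v) - f (x + h *\<^sub>R w) - f (x + h *\<^sub>R v) + f x" for h
    by (simp add: add.commute add.left_commute)
  show "((\<lambda>h. (f (x + h *\<^sub>R v + h *\<^sub>R w) - f (x + h *\<^sub>R v) - f (x + h *\<^sub>R w) + f x) / h^2)
    \<longlongrightarrow> dderiv v (dderiv w f) x) (at_right 0)"
    unfolding e by (rule second_difference_quotient_limit[OF assms])
qed simp

section \<open>Linear operations on weak derivatives\<close>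

lemma test_function_dderiv:
  assumes "test_function G \<phi>" shows "test_function G (dderiv v \<phi>)"
proof -
  obtain K where K: "smooth \<phi>" "compact K" "K \<subseteq> G" "\<And>x. x \<notin> K \<Longrightarrow> \<phi> x = 0"
    using assms unfolding test_function_smooth by auto
  have "dderiv v \<phi> x = 0" if "x \<notin> K" for x
    using frechet_derivative_zero_outside[OF compact_imp_closed[OF K(2)] K(4) that] by simp
  then show ?thesis unfolding test_function_smooth using K smooth_dderiv[OF K(1)] by auto
qed

lemma test_function_mult:
  assumes "smooth g" "test_function G \<phi>" shows "test_function G (\<lambda>X. g X * \<phi> X)"
proof -
  obtain K where K: "smooth \<phi>" "compact K" "K \<subseteq> G" "\<And>x. x \<notin> K \<Longrightarrow> \<phi> x = 0"
    using assms unfolding test_function_smooth by auto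
  then show ?thesis unfolding test_function_smooth using smooth_mult[OF assms(1) K(1)] by auto
qed

lemma weak_derivI:
  assumes "open G" "locally_integrable G u" "locally_integrable G f"
    and "\<And>\<phi>. test_function G \<phi> \<Longrightarrow>
      (LINT X|lebesgue. u X * frechet_derivative \<phi> (at X) (V X)) = - (LINT X|lebesgue. f X * \<phi> X)"
  shows "weak_deriv G V u f"
  unfolding weak_deriv_def
proof (intro conjI assms(2,3) allI impI)
  fix \<phi> assume t: "test_function G \<phi>"
  have G: "G \<in> sets lebesgue" using assms(1) by auto
  have 1: "frechet_derivative \<phi> (at X) (V X) = 0" if "X \<notin> G" for X
    by (rule test_function_zero_outside[OF test_function_dderiv[OF t] that])
  have 2: "\<phi> X = 0" if "X \<notin> G" for X by (rule test_function_zero_outside[OF t that])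
  have e1: "(LINT X|lebesgue_on G. u X * frechet_derivative \<phi> (at X) (V X)) = (LINT X|lebesgue. u X * frechet_derivative \<phi> (at X) (V X))"
    by (rule integral_lebesgue_on_support[OF G 1])
  have e2: "(LINT X|lebesgue_on G. f X * \<phi> X) = (LINT X|lebesgue. f X * \<phi> X)"
    by (rule integral_lebesgue_on_support[OF G 2])
  show "(LINT X|lebesgue_on G. u X * frechet_derivative \<phi> (at X) (V X)) = - (LINT X|lebesgue_on G. f X * \<phi> X)"
    unfolding e1 e2 by (rule assms(4)[OF t])
qed

lemma locally_integrable_sum:
  assumes "finite I" "\<And>i. i \<in> I \<Longrightarrow> locally_integrable G (f i)"
  shows "locally_integrable G (\<lambda>X. \<Sum>i\<in>I. f i X)"
  unfolding locally_integrable_def set_integrable_def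
proof (intro allI impI)
  fix K assume K: "compact K \<and> K \<subseteq> G"
  have "integrable lebesgue (\<lambda>X. \<Sum>i\<in>I. indicator K X *\<^sub>R f i X)"
    using assms(2) K unfolding locally_integrable_def set_integrable_def by (intro Bochner_Integration.integrable_sum) simp
  then show "integrable lebesgue (\<lambda>X. indicator K X *\<^sub>R (\<Sum>i\<in>I. f i X))" by (simp add: sum_distrib_left)
qed

lemma locally_integrable_mult_continuous:
  fixes g :: "'e::euclidean_space \<Rightarrow> real"
  assumes "continuous_on UNIV g" "locally_integrable G f"
  shows "locally_integrable G (\<lambda>X. g X * f X)"
  unfolding locally_integrable_def
proof (intro allI impI)
  fix K assume K: "compact K \<and> K \<subseteq> G"
  have "compact (g ` K)" using K assms(1) by (intro compact_continuous_image) (auto intro: continuous_on_subset)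
  then obtain B where B: "\<forall>y\<in>g ` K. norm y \<le> B" using compact_imp_bounded bounded_iff by metis
  have f: "integrable lebesgue (\<lambda>X. indicator K X *\<^sub>R f X)" using assms(2) K unfolding locally_integrable_def set_integrable_def by simp
  have gm: "g \<in> borel_measurable lebesgue" by (rule continuous_imp_lebesgue_measurable[OF assms(1)])
  show "set_integrable lebesgue K (\<lambda>X. g X * f X)" unfolding set_integrable_def
  proof (rule Bochner_Integration.integrable_bound[OF integrable_mult_left[OF f, of B]])
    have "(\<lambda>X. g X * (indicator K X *\<^sub>R f X)) \<in> borel_measurable lebesgue"
      using gm borel_measurable_integrable[OF f] by (rule borel_measurable_times)
    then show "(\<lambda>X. indicator K X *\<^sub>R (g X * f X)) \<in> borel_measurable lebesgue" by (simp add: mult_ac)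
    show "AE X in lebesgue. norm (indicator K X *\<^sub>R (g X * f X)) \<le> norm (indicator K X *\<^sub>R f X * B)"
    proof (rule AE_I2)
      fix X
      show "norm (indicator K X *\<^sub>R (g X * f X)) \<le> norm (indicator K X *\<^sub>R f X * B)"
      proof (cases "X \<in> K")
        case True
        then have "\<bar>g X\<bar> \<le> \<bar>B\<bar>" using B by force
        from mult_right_mono[OF this, of "\<bar>f X\<bar>"] show ?thesis using True by (simp add: abs_mult mult.commute)
      qed simp
    qed
  qed
qed

lemma weak_deriv_locally_integrable:
  assumes "weak_deriv G V u f" shows "locally_integrable G u" "locally_integrable G f"
  using assms by (simp_all add: weak_deriv_def)

lemma weak_deriv_sum_direction:
  fixes c :: "'i::finite \<Rightarrow> real"
  assumes G: "open G" and wd: "\<And>i. weak_deriv G (\<lambda>_. E i) u (f i)"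
  shows "weak_deriv G (\<lambda>_. \<Sum>i\<in>UNIV. c i *\<^sub>R E i) u (\<lambda>X. \<Sum>i\<in>UNIV. c i * f i X)"
proof (rule weak_derivI[OF G])
  show u: "locally_integrable G u" using weak_deriv_locally_integrable(1)[OF wd] .
  show "locally_integrable G (\<lambda>X. \<Sum>i\<in>UNIV. c i * f i X)"
    by (intro locally_integrable_sum locally_integrable_mult_continuous weak_deriv_locally_integrable(2)[OF wd]) auto
  fix \<phi> assume t: "test_function G \<phi>"
  have sm: "smooth \<phi>" using t by (simp add: test_function_smooth)
  have "u X * frechet_derivative \<phi> (at X) (\<Sum>i\<in>UNIV. c i *\<^sub>R E i) = (\<Sum>i\<in>UNIV. c i * (u X * dderiv (E i) \<phi> X))" for X
  proof -
    interpret D: bounded_linear "frechet_derivative \<phi> (at X)"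
      using smooth_has_derivative[OF sm] has_derivative_bounded_linear by blast
    show ?thesis by (simp add: D.sum D.scaleR sum_distrib_left mult_ac)
  qed
  then have "(LINT X|lebesgue. u X * frechet_derivative \<phi> (at X) (\<Sum>i\<in>UNIV. c i *\<^sub>R E i))
     = (LINT X|lebesgue. (\<Sum>i\<in>UNIV. c i * (u X * dderiv (E i) \<phi> X)))" by simp
  also have "\<dots> = (\<Sum>i\<in>UNIV. c i * (LINT X|lebesgue. u X * dderiv (E i) \<phi> X))"
    using locally_integrable_cutoff[OF u test_function_dderiv[OF t]] by (subst Bochner_Integration.integral_sum) auto
  also have "\<dots> = (\<Sum>i\<in>UNIV. c i * - (LINT X|lebesgue. f i X * \<phi> X))"
    by (simp only: weak_deriv_apply[OF wd G t])
  also have "\<dots> = - (LINT X|lebesgue. (\<Sum>i\<in>UNIV. c i * (f i X * \<phi> X)))"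
    using locally_integrable_cutoff[OF weak_deriv_locally_integrable(2)[OF wd] t]
    by (subst Bochner_Integration.integral_sum) (auto simp: sum_negf)
  also have "(\<lambda>X. \<Sum>i\<in>UNIV. c i * (f i X * \<phi> X)) = (\<lambda>X. (\<Sum>i\<in>UNIV. c i * f i X) * \<phi> X)"
    by (simp add: sum_distrib_right mult.assoc)
  finally show "(LINT X|lebesgue. u X * frechet_derivative \<phi> (at X) (\<Sum>i\<in>UNIV. c i *\<^sub>R E i))
     = - (LINT X|lebesgue. (\<Sum>i\<in>UNIV. c i * f i X) * \<phi> X)" .
qed

lemma weak_deriv_sum_function:
  fixes c :: "'i::finite \<Rightarrow> real"
  assumes G: "open G" and wd: "\<And>i. weak_deriv G (\<lambda>_. v) (u i) (f i)"
  shows "weak_deriv G (\<lambda>_. v) (\<lambda>X. \<Sum>i\<in>UNIV. c i * u i X) (\<lambda>X. \<Sum>i\<in>UNIV. c i * f i X)"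
proof (rule weak_derivI[OF G])
  note l = weak_deriv_locally_integrable[OF wd]
  show "locally_integrable G (\<lambda>X. \<Sum>i\<in>UNIV. c i * u i X)" "locally_integrable G (\<lambda>X. \<Sum>i\<in>UNIV. c i * f i X)"
    by (intro locally_integrable_sum locally_integrable_mult_continuous l; simp)+
  have e: "(LINT X|lebesgue. (\<Sum>i\<in>UNIV. c i * w i X) * \<psi> X) = (\<Sum>i\<in>UNIV. c i * (LINT X|lebesgue. w i X * \<psi> X))"
    if "test_function G \<psi>" "\<And>i. locally_integrable G (w i)" for w \<psi>
  proof -
    have "(LINT X|lebesgue. (\<Sum>i\<in>UNIV. c i * w i X) * \<psi> X) = (LINT X|lebesgue. (\<Sum>i\<in>UNIV. c i * (w i X * \<psi> X)))"
      by (simp add: sum_distrib_right mult.assoc)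
    also have "\<dots> = (\<Sum>i\<in>UNIV. c i * (LINT X|lebesgue. w i X * \<psi> X))"
      using locally_integrable_cutoff[OF that(2,1)] by (subst Bochner_Integration.integral_sum) auto
    finally show ?thesis .
  qed
  fix \<phi> assume t: "test_function G \<phi>"
  show "(LINT X|lebesgue. (\<Sum>i\<in>UNIV. c i * u i X) * dderiv v \<phi> X) = - (LINT X|lebesgue. (\<Sum>i\<in>UNIV. c i * f i X) * \<phi> X)"
    unfolding e[OF test_function_dderiv[OF t] l(1)] e[OF t l(2)] weak_deriv_apply[OF wd G t] by (simp add: sum_negf)
qed

section \<open>The diffusion term\<close>

lemma weak_hess_apply:
  assumes h: "weak_hess_x G u h" and G: "open G" and t: "test_function G \<phi>"
  shows "(LINT X|lebesgue. h X $ i $ j * \<phi> X) = (LINT X|lebesgue. u X * dderiv (in_x (axis i 1)) (dderiv (in_x (axis j 1)) \<phi>) X)"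
proof -
  obtain g where g: "weak_grad_x G u g" "\<forall>i. weak_grad_x G (\<lambda>X. g X $ i) (\<lambda>X. h X $ i)"
    using h unfolding weak_hess_x_def by (elim exE conjE)
  have 1: "weak_deriv G (\<lambda>_. in_x (axis i 1)) u (\<lambda>X. g X $ i)" using g(1) unfolding weak_grad_x_def by simp
  have 2: "weak_deriv G (\<lambda>_. in_x (axis j 1)) (\<lambda>X. g X $ i) (\<lambda>X. h X $ i $ j)" using g(2) unfolding weak_grad_x_def by simp
  show ?thesis
    using weak_deriv_apply[OF 1 G test_function_dderiv[OF t, of "in_x (axis j 1)"]] weak_deriv_apply[OF 2 G t] by simp
qed

lemma weak_hess_locally_integrable:
  assumes "weak_hess_x G u h" shows "locally_integrable G (\<lambda>X. h X $ i $ j)"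
proof -
  obtain g where g: "\<forall>i. weak_grad_x G (\<lambda>X. g X $ i) (\<lambda>X. h X $ i)"
    using assms unfolding weak_hess_x_def by (elim exE conjE)
  then have "weak_deriv G (\<lambda>_. in_x (axis j 1)) (\<lambda>X. g X $ i) (\<lambda>X. h X $ i $ j)" unfolding weak_grad_x_def by simp
  then show ?thesis by (rule weak_deriv_locally_integrable(2))
qed

text \<open>
Both entries have the same pairings with test functions, by symmetry of the second derivatives of the latter.
With \<open>h' = h\<close> this says that a weak Hessian is symmetric; together the two statements
give the uniqueness of the weak Hessian.
\<close>

lemma weak_hess_transpose_unique:
  assumes h: "weak_hess_x G u h" and h': "weak_hess_x G u h'" and G: "open G"
  shows "AE X in lebesgue_on G. \<forall>i j. h X $ i $ j = h' X $ j $ i"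
proof (intro eventually_all_finite)
  fix i j
  have l: "locally_integrable G (\<lambda>X. h X $ i $ j)" "locally_integrable G (\<lambda>X. h' X $ j $ i)"
    using weak_hess_locally_integrable h h' by blast+
  have lw: "locally_integrable G (\<lambda>X. h X $ i $ j - h' X $ j $ i)"
    using l unfolding locally_integrable_def by (intro allI impI set_integral_diff(1)) simp_all
  have "AE X in lebesgue_on G. h X $ i $ j - h' X $ j $ i = 0"
  proof (rule fundamental_lemma_of_variations[OF G lw])
    fix \<psi> assume t: "test_function G \<psi>"
    then have sm: "smooth \<psi>" by (simp add: test_function_smooth)
    have "(LINT X|lebesgue. (h X $ i $ j - h' X $ j $ i) * \<psi> X) = (LINT X|lebesgue. h X $ i $ j * \<psi> X) - (LINT X|lebesgue. h' X $ j $ i * \<psi> X)"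
      using locally_integrable_cutoff[OF l(1) t] locally_integrable_cutoff[OF l(2) t] by (simp add: left_diff_distrib)
    also have "\<dots> = 0"
      unfolding weak_hess_apply[OF h G t] weak_hess_apply[OF h' G t] dderiv_commute[OF sm, where w="in_x (axis i 1)" and v="in_x (axis j 1)"] by simp
    finally show "(LINT X|lebesgue. (h X $ i $ j - h' X $ j $ i) * \<psi> X) = 0" .
  qed
  then show "AE X in lebesgue_on G. h X $ i $ j = h' X $ j $ i" by eventually_elim simp
qed

text \<open>
The matrix \<open>A\<close> may have an arbitrarily large antisymmetric part, on which the quadratic form gives no
information; it cancels against the symmetric \<open>H\<close>. The symmetric part of \<open>A\<close> is bounded by polarization.
\<close>

lemma quadratic_form_contraction_bound:
  fixes A H :: "real^'n^'n::finite"
  assumes q: "\<And>\<xi>. 0 \<le> (\<Sum>i\<in>UNIV. \<Sum>j\<in>UNIV. A $ i $ j * \<xi> $ i * \<xi> $ j)"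
    "\<And>\<xi>. (\<Sum>i\<in>UNIV. \<Sum>j\<in>UNIV. A $ i $ j * \<xi> $ i * \<xi> $ j) \<le> L * (norm \<xi>)^2"
    and L: "0 \<le> L" and H: "\<And>i j. H $ i $ j = H $ j $ i"
  shows "\<bar>\<Sum>i\<in>UNIV. \<Sum>j\<in>UNIV. A $ i $ j * H $ i $ j\<bar> \<le> L * (real CARD('n))^2 * norm H"
proof -
  have qe: "(\<Sum>i\<in>UNIV. \<Sum>j\<in>UNIV. A $ i $ j * \<xi> $ i * \<xi> $ j) = \<xi> \<bullet> (A *v \<xi>)" for \<xi>
    by (simp add: inner_vec_def matrix_vector_mult_def sum_distrib_left mult_ac)
  have be: "axis i 1 \<bullet> (A *v axis j 1) = A $ i $ j" for i j
    by (simp add: inner_axis' matrix_vector_mult_basis column_def)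
  have s: "\<bar>A $ i $ j + A $ j $ i\<bar> \<le> 2 * L" for i j
  proof -
    let ?x = "axis i 1 :: real^'n" and ?y = "axis j 1 :: real^'n"
    have "(?x + ?y) \<bullet> (A *v (?x + ?y)) - (?x - ?y) \<bullet> (A *v (?x - ?y)) = 2 * (A $ i $ j + A $ j $ i)"
      by (simp add: matrix_vector_right_distrib matrix_vector_mult_diff_distrib inner_add_left inner_add_right inner_diff_left inner_diff_right be)
    moreover have "0 \<le> (?x + ?y) \<bullet> (A *v (?x + ?y))" "0 \<le> (?x - ?y) \<bullet> (A *v (?x - ?y))" using q(1) unfolding qe by blast+
    moreover have "\<bar>s\<bar> \<le> 2 * L" if "p - q = 2 * s" "0 \<le> p" "0 \<le> q" "p \<le> L * 4" "q \<le> L * 4" for p q s :: real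
      using that by linarith
    moreover have "(?x + ?y) \<bullet> (A *v (?x + ?y)) \<le> L * 4"
    proof -
      have "norm (?x + ?y) \<le> 2" using norm_triangle_ineq[of ?x ?y] by simp
      then have "(norm (?x + ?y))^2 \<le> 2^2" by (rule power_mono) simp
      then have "L * (norm (?x + ?y))^2 \<le> L * 4" using L by (intro mult_left_mono) auto
      then show ?thesis using q(2)[of "?x + ?y"] unfolding qe by linarith
    qed
    moreover have "(?x - ?y) \<bullet> (A *v (?x - ?y)) \<le> L * 4"
    proof -
      have "norm (?x - ?y) \<le> 2" using norm_triangle_ineq4[of ?x ?y] by simp
      then have "(norm (?x - ?y))^2 \<le> 2^2" by (rule power_mono) simp
      then have "L * (norm (?x - ?y))^2 \<le> L * 4" using L by (intro mult_left_mono) auto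
      then show ?thesis using q(2)[of "?x - ?y"] unfolding qe by linarith
    qed
    ultimately show ?thesis by metis
  qed
  let ?S = "\<Sum>i\<in>UNIV. \<Sum>j\<in>UNIV. A $ i $ j * H $ i $ j"
  \<comment> \<open>Symmetrize: \<open>2 ?S\<close> is the contraction of \<open>A + transpose A\<close> with \<open>H\<close>.\<close>
  have "?S = (\<Sum>i\<in>UNIV. \<Sum>j\<in>UNIV. A $ j $ i * H $ j $ i)" by (rule sum.swap)
  also have "\<dots> = (\<Sum>i\<in>UNIV. \<Sum>j\<in>UNIV. A $ j $ i * H $ i $ j)" using H by (intro sum.cong) auto
  finally have "2 * ?S = (\<Sum>i\<in>UNIV. \<Sum>j\<in>UNIV. (A $ i $ j + A $ j $ i) * H $ i $ j)"
    by (simp add: distrib_right sum.distrib)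
  also have "\<bar>\<dots>\<bar> \<le> (\<Sum>i\<in>(UNIV::'n set). \<Sum>j\<in>(UNIV::'n set). 2 * L * norm H)"
  proof (rule order_trans[OF sum_abs sum_mono], rule order_trans[OF sum_abs sum_mono])
    fix i j
    have "\<bar>H $ i $ j\<bar> \<le> norm H" using component_le_norm_cart[of "H $ i" j] Finite_Cartesian_Product.norm_nth_le[of H i] by linarith
    then show "\<bar>(A $ i $ j + A $ j $ i) * H $ i $ j\<bar> \<le> 2 * L * norm H"
      unfolding abs_mult using s[of i j] L by (intro mult_mono) auto
  qed
  also have "\<dots> = 2 * (L * (real CARD('n))^2 * norm H)" by (simp add: power2_eq_square)
  finally show ?thesis by simp
qed

section \<open>From norms to square integrals\<close>

lemma L2norm_le_D:
  assumes "L2norm G f \<le> ennreal M" "0 \<le> M"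
  shows "(\<integral>\<^sup>+ X. ennreal ((norm (f X))^2) \<partial>lebesgue_on G) \<le> ennreal (M^2)"
proof -
  let ?I = "\<integral>\<^sup>+ X. ennreal ((norm (f X))^2) \<partial>lebesgue_on G"
  have fin: "?I \<noteq> \<infinity>"
  proof
    assume "?I = \<infinity>"
    then have "L2norm G f = \<infinity>" by (simp add: L2norm_def)
    then show False using assms(1) by (simp add: top_unique)
  qed
  then have "ennreal (sqrt (enn2real ?I)) \<le> ennreal M" using assms(1) by (simp add: L2norm_def)
  then have "sqrt (enn2real ?I) \<le> M" using assms(2) by (simp add: ennreal_le_iff)
  then have "enn2real ?I \<le> M^2" by (rule sqrt_le_D)
  then have "ennreal (enn2real ?I) \<le> ennreal (M^2)" by (rule ennreal_leI)
  moreover have "ennreal (enn2real ?I) = ?I" using fin by (simp add: ennreal_enn2real_if)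
  ultimately show ?thesis by metis
qed

lemma L2norm_leI:
  assumes "(\<integral>\<^sup>+ X. ennreal ((norm (f X))^2) \<partial>lebesgue_on G) \<le> ennreal (M^2)" "0 \<le> M"
  shows "L2norm G f \<le> ennreal M"
proof -
  let ?I = "\<integral>\<^sup>+ X. ennreal ((norm (f X))^2) \<partial>lebesgue_on G"
  have fin: "?I \<noteq> \<infinity>"
  proof
    assume "?I = \<infinity>" then show False using assms(1) by (simp add: top_unique)
  qed
  have "enn2real ?I \<le> M^2" using enn2real_mono[OF assms(1)] by simp
  then have "sqrt (enn2real ?I) \<le> M" using assms(2) real_le_lsqrt by simp
  then show ?thesis using fin by (simp add: L2norm_def ennreal_leI)
qed

lemma locally_integrable_measurable_on:
  fixes u :: "'e::euclidean_space \<Rightarrow> real"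
  assumes "open A" "locally_integrable A u"
  shows "u \<in> borel_measurable (lebesgue_on A)"
  using locally_integrable_measurable[OF assms] open_imp_lebesgue[OF assms(1)]
  by (subst borel_measurable_restrict_space_iff) simp_all

lemma sqint_le:
  fixes k :: "'n::finite pt \<Rightarrow> real"
  assumes "AE X in lebesgue_on (Q 2). \<bar>k X\<bar> \<le> C * norm (h X)" "0 \<le> C"
    and h: "(\<integral>\<^sup>+ X. ennreal ((norm (h X))^2) \<partial>lebesgue_on (Q 2)) \<le> ennreal (M^2)"
    and m: "(\<lambda>X. (norm (h X))^2) \<in> borel_measurable (lebesgue_on (Q 2))"
  shows "sqint k \<le> ennreal ((C * M)^2)"
proof -
  have "sqint k \<le> (\<integral>\<^sup>+ X. ennreal (C^2) * ennreal ((norm (h X))^2) \<partial>lebesgue_on (Q 2))"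
    unfolding sqint_def
  proof (rule nn_integral_mono_AE, use assms(1) in eventually_elim)
    fix X assume "\<bar>k X\<bar> \<le> C * norm (h X)"
    then have "\<bar>k X\<bar>^2 \<le> (C * norm (h X))^2" by (rule power_mono) simp
    then show "ennreal ((k X)^2) \<le> ennreal (C^2) * ennreal ((norm (h X))^2)"
      by (simp add: power_mult_distrib ennreal_leI flip: ennreal_mult)
  qed
  also have "\<dots> = ennreal (C^2) * (\<integral>\<^sup>+ X. ennreal ((norm (h X))^2) \<partial>lebesgue_on (Q 2))"
    using m by (intro nn_integral_cmult) simp
  also have "\<dots> \<le> ennreal (C^2) * ennreal (M^2)" using h by (rule mult_left_mono) simp
  also have "\<dots> = ennreal ((C * M)^2)" by (simp add: power_mult_distrib ennreal_mult)
  finally show ?thesis .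
qed

lemma norm_squared_vec: "(norm (v::real^'n))^2 = (\<Sum>i\<in>UNIV. (v $ i)^2)"
  unfolding power2_norm_eq_inner by (simp add: inner_vec_def power2_eq_square)

lemma norm_squared_mat: "(norm (H::real^'n^'m))^2 = (\<Sum>i\<in>UNIV. \<Sum>j\<in>UNIV. (H $ i $ j)^2)"
proof -
  have "(norm H)^2 = (\<Sum>i\<in>UNIV. (norm (H $ i))^2)" by (simp add: power2_norm_eq_inner inner_vec_def)
  then show ?thesis by (simp add: norm_squared_vec)
qed

section \<open>Directional weak derivatives of a solution\<close>

lemma sum_axis_embedding:
  "(\<Sum>i\<in>UNIV. (v $ i) *\<^sub>R in_x (axis i 1)) = in_x (v :: real^'n::finite)"
  "(\<Sum>i\<in>UNIV. (v $ i) *\<^sub>R in_z (axis i 1)) = in_z (v :: real^'n::finite)"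
proof -
  have b: "(\<Sum>i\<in>UNIV. (v $ i) *\<^sub>R axis i 1) = v"
    using basis_expansion[of v] by (simp add: vector_scalar_mult_def scalar_mult_eq_scaleR)
  interpret X: bounded_linear "in_x :: real^'n \<Rightarrow> 'n pt"
    by (intro bounded_linear_Pair bounded_linear_zero bounded_linear_ident)
  interpret Z: bounded_linear "in_z :: real^'n \<Rightarrow> 'n pt"
    by (intro bounded_linear_Pair bounded_linear_zero bounded_linear_ident)
  show "(\<Sum>i\<in>UNIV. (v $ i) *\<^sub>R in_x (axis i 1)) = in_x v" unfolding X.scaleR[symmetric] X.sum[symmetric] b ..
  show "(\<Sum>i\<in>UNIV. (v $ i) *\<^sub>R in_z (axis i 1)) = in_z v" unfolding Z.scaleR[symmetric] Z.sum[symmetric] b ..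
qed

lemma weak_directional_z:
  assumes "open G" "weak_grad_z G u g"
  shows "weak_deriv G (\<lambda>_. in_z v) u (\<lambda>X. \<Sum>i\<in>UNIV. v $ i * g X $ i)"
  using weak_deriv_sum_direction[OF assms(1), of "\<lambda>i. in_z (axis i 1)" u "\<lambda>i X. g X $ i" "\<lambda>i. v $ i"] assms(2)
  unfolding weak_grad_z_def sum_axis_embedding by simp

lemma weak_directional_x:
  assumes "open G" "weak_grad_x G u g"
  shows "weak_deriv G (\<lambda>_. in_x v) u (\<lambda>X. \<Sum>i\<in>UNIV. v $ i * g X $ i)"
  using weak_deriv_sum_direction[OF assms(1), of "\<lambda>i. in_x (axis i 1)" u "\<lambda>i X. g X $ i" "\<lambda>i. v $ i"] assms(2)
  unfolding weak_grad_x_def sum_axis_embedding by simp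

lemma weak_second_directional_x:
  assumes G: "open G" and h: "weak_hess_x G u h"
  shows "\<exists>g. weak_deriv G (\<lambda>_. in_x v) u g \<and>
     weak_deriv G (\<lambda>_. in_x v) g (\<lambda>X. \<Sum>i\<in>UNIV. v $ i * (\<Sum>j\<in>UNIV. v $ j * h X $ i $ j))"
proof -
  obtain g where g: "weak_grad_x G u g" "\<forall>i. weak_grad_x G (\<lambda>X. g X $ i) (\<lambda>X. h X $ i)"
    using h unfolding weak_hess_x_def by (elim exE conjE)
  have "weak_deriv G (\<lambda>_. in_x v) (\<lambda>X. g X $ i) (\<lambda>X. \<Sum>j\<in>UNIV. v $ j * h X $ i $ j)" for i
    by (rule weak_directional_x[OF G g(2)[rule_format]])
  then have "weak_deriv G (\<lambda>_. in_x v) (\<lambda>X. \<Sum>i\<in>UNIV. v $ i * g X $ i) (\<lambda>X. \<Sum>i\<in>UNIV. v $ i * (\<Sum>j\<in>UNIV. v $ j * h X $ i $ j))"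
    by (rule weak_deriv_sum_function[OF G])
  with weak_directional_x[OF G g(1), of v] show ?thesis by blast
qed

text \<open>
The term \<open>y \<cdot> \<nabla>\<^sub>z u\<close> is added to both sides. Weakly this means testing the \<open>z\<close> derivatives with
\<open>y\<^sub>i \<phi>\<close>, on which \<open>\<partial>\<^sub>z\<close> acts as on \<open>\<phi>\<close> because \<open>y\<^sub>i\<close> does not depend on \<open>z\<close>.
\<close>

lemma weak_deriv_flat_transport:
  fixes u :: "'n::finite pt \<Rightarrow> real"
  assumes G: "open G" and f: "weak_transport G u f" and g: "weak_grad_z G u g"
  shows "weak_deriv G (\<lambda>X. e_t + xdy X) u (\<lambda>X. f X + (\<Sum>i\<in>UNIV. fst (snd (snd X)) $ i * g X $ i))"
proof -
  interpret shear_field "e_t :: 'n pt" xdy by (rule shear_field_transport)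
  have f': "weak_deriv G (\<lambda>(t, x, y, z). (1, 0, - x, - y)) u f" using f by (simp add: weak_transport_def)
  have gi: "weak_deriv G (\<lambda>_. in_z (axis i 1)) u (\<lambda>X. g X $ i)" for i using g by (simp add: weak_grad_z_def)
  have bl: "bounded_linear (\<lambda>X::'n pt. fst (snd (snd X)) $ i)" for i
    by (intro bounded_linear_compose[OF bounded_linear_vec_nth] bounded_linear_compose[OF bounded_linear_fst]
        bounded_linear_compose[OF bounded_linear_snd] bounded_linear_snd)
  have sy: "smooth (\<lambda>X::'n pt. fst (snd (snd X)) $ i)" for i by (rule smooth_linear[OF bl])
  have lu: "locally_integrable G u" by (rule weak_deriv_locally_integrable(1)[OF f'])
  have lf: "locally_integrable G f" by (rule weak_deriv_locally_integrable(2)[OF f'])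
  have lg: "locally_integrable G (\<lambda>X. fst (snd (snd X)) $ i * g X $ i)" for i
    by (intro locally_integrable_mult_continuous smooth_continuous sy weak_deriv_locally_integrable(2)[OF gi])
  have lS: "locally_integrable G (\<lambda>X. \<Sum>i\<in>UNIV. fst (snd (snd X)) $ i * g X $ i)"
    by (intro locally_integrable_sum lg) simp
  show ?thesis
  proof (rule weak_derivI[OF G lu])
    show "locally_integrable G (\<lambda>X. f X + (\<Sum>i\<in>UNIV. fst (snd (snd X)) $ i * g X $ i))"
      using lf lS unfolding locally_integrable_def by (intro allI impI set_integral_add(1)) simp_all
    fix \<phi> :: "'n pt \<Rightarrow> real" assume t: "test_function G \<phi>"
    have sm: "smooth \<phi>" using t by (simp add: test_function_smooth)
    let ?y\<phi> = "\<lambda>i X. fst (snd (snd X)) $ i * \<phi> X"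
    have ty: "test_function G (?y\<phi> i)" for i by (rule test_function_mult[OF sy t])
    have dy: "dderiv (in_z (axis i 1)) (?y\<phi> i) X = fst (snd (snd X)) $ i * dderiv (in_z (axis i 1)) \<phi> X" for i X
    proof -
      have "((\<lambda>X. fst (snd (snd X)) $ i * \<phi> X) has_derivative
          (\<lambda>v. fst (snd (snd X)) $ i * frechet_derivative \<phi> (at X) v + fst (snd (snd v)) $ i * \<phi> X)) (at X)"
        by (rule has_derivative_mult[OF bounded_linear_imp_has_derivative[OF bl] smooth_has_derivative[OF sm]])
      from frechet_derivative_at[OF this]
      have "frechet_derivative (?y\<phi> i) (at X) = (\<lambda>v. fst (snd (snd X)) $ i * frechet_derivative \<phi> (at X) v + fst (snd (snd v)) $ i * \<phi> X)" by simp
      then show ?thesis by simp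
    qed
    have split: "frechet_derivative \<phi> (at X) ((\<lambda>(t, x, y, z). (1, 0, - x, - y)) X) + (\<Sum>i\<in>UNIV. dderiv (in_z (axis i 1)) (?y\<phi> i) X)
        = frechet_derivative \<phi> (at X) (e_t + xdy X)" for X :: "'n pt"
    proof -
      interpret D: bounded_linear "frechet_derivative \<phi> (at X)"
        using smooth_has_derivative[OF sm] has_derivative_bounded_linear by blast
      obtain tt x y z where X: "X = (tt, x, y, z)" by (cases X)
      have "(\<Sum>i\<in>UNIV. dderiv (in_z (axis i 1)) (?y\<phi> i) X) = frechet_derivative \<phi> (at X) (\<Sum>i\<in>UNIV. (fst (snd (snd X)) $ i) *\<^sub>R in_z (axis i 1))"
        unfolding dy by (simp only: D.sum D.scaleR real_scaleR_def)
      also have "\<dots> = frechet_derivative \<phi> (at X) (in_z y)" unfolding sum_axis_embedding by (simp add: X)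
      finally have "frechet_derivative \<phi> (at X) ((\<lambda>(t, x, y, z). (1, 0, - x, - y)) X) + (\<Sum>i\<in>UNIV. dderiv (in_z (axis i 1)) (?y\<phi> i) X)
        = frechet_derivative \<phi> (at X) ((\<lambda>(t, x, y, z). (1, 0, - x, - y)) X + in_z y)" by (simp add: D.add)
      also have "(\<lambda>(t, x, y, z). (1, 0, - x, - y)) X + in_z y = e_t + xdy X" by (simp add: X xdy_def)
      finally show ?thesis .
    qed
    have iVD: "integrable lebesgue (\<lambda>X. u X * frechet_derivative \<phi> (at X) (e_t + xdy X))"
    proof -
      obtain K where K: "compact K" "K \<subseteq> G" "\<And>x. x \<notin> K \<Longrightarrow> \<phi> x = 0"
        using t unfolding test_function_smooth by auto
      have "test_function G (VD \<phi>)"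
        unfolding test_function_smooth using smooth_VD[OF sm] K(1,2) VD_zero_off[OF K(1,3)] by auto
      from locally_integrable_cutoff[OF lu this] show ?thesis by (simp add: VD_def V_def)
    qed
    have ii: "integrable lebesgue (\<lambda>X. u X * dderiv (in_z (axis i 1)) (?y\<phi> i) X)" for i
      by (rule locally_integrable_cutoff[OF lu test_function_dderiv[OF ty]])
    have "(LINT X|lebesgue. u X * frechet_derivative \<phi> (at X) ((\<lambda>(t, x, y, z). (1, 0, - x, - y)) X))
      = (LINT X|lebesgue. u X * frechet_derivative \<phi> (at X) (e_t + xdy X) - (\<Sum>i\<in>UNIV. u X * dderiv (in_z (axis i 1)) (?y\<phi> i) X))"
      unfolding split[symmetric] by (simp add: sum_distrib_left algebra_simps)
    also have "\<dots> = (LINT X|lebesgue. u X * frechet_derivative \<phi> (at X) (e_t + xdy X))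
        - (\<Sum>i\<in>UNIV. LINT X|lebesgue. u X * dderiv (in_z (axis i 1)) (?y\<phi> i) X)"
      using iVD ii by (simp add: Bochner_Integration.integral_diff Bochner_Integration.integral_sum Bochner_Integration.integrable_sum)
    also have "\<dots> = (LINT X|lebesgue. u X * frechet_derivative \<phi> (at X) (e_t + xdy X))
        + (\<Sum>i\<in>UNIV. LINT X|lebesgue. g X $ i * ?y\<phi> i X)"
      unfolding weak_deriv_apply[OF gi G ty] by (simp add: sum_negf)
    finally have 1: "(LINT X|lebesgue. u X * frechet_derivative \<phi> (at X) (e_t + xdy X)) =
        - (LINT X|lebesgue. f X * \<phi> X) - (\<Sum>i\<in>UNIV. LINT X|lebesgue. g X $ i * ?y\<phi> i X)"
      unfolding weak_deriv_apply[OF f' G t] by simp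
    have "(\<Sum>i\<in>UNIV. fst (snd (snd X)) $ i * g X $ i) * \<phi> X = (\<Sum>i\<in>UNIV. g X $ i * ?y\<phi> i X)" for X
      unfolding sum_distrib_right by (rule sum.cong) (simp_all add: mult_ac)
    then have "(LINT X|lebesgue. (f X + (\<Sum>i\<in>UNIV. fst (snd (snd X)) $ i * g X $ i)) * \<phi> X)
      = (LINT X|lebesgue. f X * \<phi> X + (\<Sum>i\<in>UNIV. g X $ i * ?y\<phi> i X))"
      by (simp add: distrib_right)
    also have "\<dots> = (LINT X|lebesgue. f X * \<phi> X) + (\<Sum>i\<in>UNIV. LINT X|lebesgue. g X $ i * ?y\<phi> i X)"
      using locally_integrable_cutoff[OF lf t] locally_integrable_cutoff[OF weak_deriv_locally_integrable(2)[OF gi] ty]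
      by (simp add: Bochner_Integration.integral_add Bochner_Integration.integral_sum Bochner_Integration.integrable_sum)
    finally show "(LINT X|lebesgue. u X * frechet_derivative \<phi> (at X) (e_t + xdy X))
      = - (LINT X|lebesgue. (f X + (\<Sum>i\<in>UNIV. fst (snd (snd X)) $ i * g X $ i)) * \<phi> X)" unfolding 1 by simp
  qed
qed

section \<open>Solutions are controlled\<close>

lemma norm_square_measurable_vec:
  fixes g :: "'n::finite pt \<Rightarrow> real^'n"
  assumes "open G" "\<And>i. locally_integrable G (\<lambda>X. g X $ i)"
  shows "(\<lambda>X. (norm (g X))^2) \<in> borel_measurable (lebesgue_on G)"
  unfolding norm_squared_vec
  by (intro borel_measurable_sum borel_measurable_power locally_integrable_measurable_on assms)

lemma norm_square_measurable_mat:
  fixes h :: "'n::finite pt \<Rightarrow> real^'n^'n"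
  assumes "open G" "\<And>i j. locally_integrable G (\<lambda>X. h X $ i $ j)"
  shows "(\<lambda>X. (norm (h X))^2) \<in> borel_measurable (lebesgue_on G)"
  unfolding norm_squared_mat
  by (intro borel_measurable_sum borel_measurable_power locally_integrable_measurable_on assms)

text \<open>
The Hessian \<open>h'\<close> of the equation and the Hessian \<open>h\<close> whose norm is given agree almost everywhere.
\<close>

lemma diffusion_term_bound:
  fixes a :: "real \<Rightarrow> real^'n^'n::finite"
  assumes \<delta>: "0 < \<delta>" and a: "admissible_coeff \<delta> a" and G: "open G"
    and h: "weak_hess_x G u h" and h': "weak_hess_x G u h'"
  shows "AE X in lebesgue_on G. \<bar>\<Sum>i\<in>UNIV. \<Sum>j\<in>UNIV. a (fst X) $ i $ j * h' X $ i $ j\<bar>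
     \<le> inverse \<delta> * (real CARD('n))^2 * norm (h X)"
  using weak_hess_transpose_unique[OF h h' G] weak_hess_transpose_unique[OF h h G]
proof eventually_elim
  fix X assume 1: "\<forall>i j. h X $ i $ j = h' X $ j $ i" and 2: "\<forall>i j. h X $ i $ j = h X $ j $ i"
  have e: "h' X $ i $ j = h X $ i $ j" for i j using 1 2 by metis
  have q: "\<delta> * (norm \<xi>)^2 \<le> (\<Sum>i\<in>UNIV. \<Sum>j\<in>UNIV. a (fst X) $ i $ j * \<xi> $ i * \<xi> $ j)"
    "(\<Sum>i\<in>UNIV. \<Sum>j\<in>UNIV. a (fst X) $ i $ j * \<xi> $ i * \<xi> $ j) \<le> inverse \<delta> * (norm \<xi>)^2" for \<xi> :: "real^'n"
    using a unfolding admissible_coeff_def by blast+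
  have q0: "0 \<le> (\<Sum>i\<in>UNIV. \<Sum>j\<in>UNIV. a (fst X) $ i $ j * \<xi> $ i * \<xi> $ j)" for \<xi> :: "real^'n"
  proof -
    have "0 \<le> \<delta> * (norm \<xi>)^2" using \<delta> by simp
    then show ?thesis using q(1)[of \<xi>] by linarith
  qed
  show "\<bar>\<Sum>i\<in>UNIV. \<Sum>j\<in>UNIV. a (fst X) $ i $ j * h' X $ i $ j\<bar> \<le> inverse \<delta> * (real CARD('n))^2 * norm (h X)"
    unfolding e by (rule quadratic_form_contraction_bound[OF q0 q(2)]) (use \<delta> 2 in auto)
qed

lemma abs_sum_component_bound:
  fixes v g :: "real^'n::finite"
  shows "\<bar>\<Sum>i\<in>UNIV. v $ i * g $ i\<bar> \<le> norm v * norm g"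
  using Cauchy_Schwarz_ineq2[of v g] by (simp add: inner_vec_def)

lemma abs_second_directional_bound:
  fixes v :: "real^'n::finite" and H :: "real^'n^'n"
  shows "\<bar>\<Sum>i\<in>UNIV. v $ i * (\<Sum>j\<in>UNIV. v $ j * H $ i $ j)\<bar> \<le> (norm v)^2 * real CARD('n) * norm H"
proof -
  have "\<bar>\<Sum>i\<in>UNIV. v $ i * (\<Sum>j\<in>UNIV. v $ j * H $ i $ j)\<bar> \<le> (\<Sum>i\<in>(UNIV::'n set). norm v * (norm v * norm H))"
  proof (rule order_trans[OF sum_abs sum_mono])
    fix i
    have "\<bar>\<Sum>j\<in>UNIV. v $ j * H $ i $ j\<bar> \<le> norm v * norm (H $ i)" by (rule abs_sum_component_bound)
    also have "\<dots> \<le> norm v * norm H" by (intro mult_left_mono Finite_Cartesian_Product.norm_nth_le) simp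
    finally show "\<bar>v $ i * (\<Sum>j\<in>UNIV. v $ j * H $ i $ j)\<bar> \<le> norm v * (norm v * norm H)"
      unfolding abs_mult by (intro mult_mono component_le_norm_cart) auto
  qed
  then show ?thesis by (simp add: power2_eq_square mult_ac)
qed

lemma AE_in_set: "G \<in> sets lebesgue \<Longrightarrow> AE X in lebesgue_on G. X \<in> G"
  by (rule AE_I2) simp

lemma sqint_mono: "sqint f \<le> ennreal (A^2) \<Longrightarrow> 0 \<le> A \<Longrightarrow> A \<le> B \<Longrightarrow> sqint f \<le> ennreal (B^2)"
  by (meson ennreal_leI order_trans power_mono)

text \<open>
Large enough for the three derivative bounds: \<open>16 + 2 n^2 / \<delta>\<close> for the transport derivative, \<open>n\<close> for the second
directional derivatives in \<open>x\<close>, and at least \<open>1\<close> for those in \<open>z\<close>.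
\<close>

definition kinetic_const :: "real \<Rightarrow> real \<Rightarrow> real" where
  "kinetic_const n \<delta> = 16 + 2 * inverse \<delta> * n^2 + n"

text \<open>
The equation bounds the full transport derivative \<open>f\<close> by the Hessian in \<open>x\<close>; since \<open>\<bar>y\<bar> < 8\<close>, the derivative
along \<open>(1, 0, - x, 0)\<close> is then bounded by the Hessian and \<open>8 \<bar>\<nabla>\<^sub>z u\<bar>\<close>.
\<close>

lemma solution_controlled:
  fixes a :: "real \<Rightarrow> real^'n^'n::finite" and u :: "'n pt \<Rightarrow> real"
  assumes \<delta>: "0 < \<delta>" and a: "admissible_coeff \<delta> a"
    and P0: "weak_P0 a (Q 2) u p" "AE X in lebesgue_on (Q 2). p X = 0"
    and M: "0 \<le> M" and u: "L2norm (Q 1) u \<le> ennreal M"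
    and g: "weak_grad_z (Q 2) u g" "L2norm (Q 2) g \<le> ennreal M"
    and h: "weak_hess_x (Q 2) u h" "L2norm (Q 2) h \<le> ennreal M"
  shows "controlled u (kinetic_const (real CARD('n)) \<delta> * M)"
proof -
  let ?n = "real CARD('n)" and ?c = "kinetic_const (real CARD('n)) \<delta>"
  define k where "k = inverse \<delta> * ?n^2"
  have n: "?n \<ge> 1" using zero_less_card_finite[where 'a='n] by simp
  have k0: "0 \<le> k" using \<delta> by (simp add: k_def)
  have c: "?c \<ge> 1" "?c \<ge> ?n" "?c \<ge> 16 + 2 * k" using n k0 unfolding kinetic_const_def k_def by linarith+
  note oQ = open_Q[of 2, where 'a='n]
  obtain f h' where f: "weak_transport (Q 2) u f" and h': "weak_hess_x (Q 2) u h'"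
    and p: "p = (\<lambda>X. f X - (\<Sum>i\<in>UNIV. \<Sum>j\<in>UNIV. a (fst X) $ i $ j * h' X $ i $ j))"
    using P0(1) unfolding weak_P0_def by (elim exE conjE)
  have gi: "weak_deriv (Q 2) (\<lambda>_. in_z (axis i 1)) u (\<lambda>X. g X $ i)" for i using g(1) by (simp add: weak_grad_z_def)
  have lu: "locally_integrable (Q 2) u" by (rule weak_deriv_locally_integrable(1)[OF gi])
  have mg: "(\<lambda>X. (norm (g X))^2) \<in> borel_measurable (lebesgue_on (Q 2))"
    by (rule norm_square_measurable_vec[OF open_Q weak_deriv_locally_integrable(2)[OF gi]])
  have mh: "(\<lambda>X. (norm (h X))^2) \<in> borel_measurable (lebesgue_on (Q 2))"
    by (rule norm_square_measurable_mat[OF open_Q weak_hess_locally_integrable[OF h(1)]])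
  have ig: "(\<integral>\<^sup>+ X. ennreal ((norm (g X))^2) \<partial>lebesgue_on (Q 2)) \<le> ennreal (M^2)" by (rule L2norm_le_D[OF g(2) M])
  have ih: "(\<integral>\<^sup>+ X. ennreal ((norm (h X))^2) \<partial>lebesgue_on (Q 2)) \<le> ennreal (M^2)" by (rule L2norm_le_D[OF h(2) M])
  have cM: "0 \<le> ?c * M" "M \<le> ?c * M" "?n * M \<le> ?c * M" "(16 + 2 * k) * M \<le> ?c * M"
    using c M mult_right_mono[OF c(1) M] mult_right_mono[OF c(2) M] mult_right_mono[OF c(3) M] by simp_all
  let ?F = "\<lambda>X. f X + (\<Sum>i\<in>UNIV. fst (snd (snd X)) $ i * g X $ i)"
  have 1: "\<bar>LINT X|lebesgue. u X * \<psi> X\<bar> \<le> ?c * M * l2 \<psi>" if t: "test_function (Q 1) \<psi>" for \<psi>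
  proof -
    obtain K where K: "smooth \<psi>" "compact K" "K \<subseteq> Q 1" "\<And>x. x \<notin> K \<Longrightarrow> \<psi> x = 0"
      using t unfolding test_function_smooth by auto
    have "(Q 1 :: 'n pt set) \<subseteq> Q 2"
    proof
      fix X :: "'n pt" assume "X \<in> Q 1" then show "X \<in> Q 2" by (cases X) (simp add: mem_Q1 mem_Q2)
    qed
    then have "set_integrable lebesgue K u" using lu K unfolding locally_integrable_def by (meson subset_trans)
    then have "\<bar>LINT X|lebesgue. u X * \<psi> X\<bar> \<le> M * l2 \<psi>"
    proof (rule Cauchy_Schwarz_support[OF _ K(2) smooth_continuous[OF K(1)] K(4) _ M K(3) open_imp_lebesgue[OF open_Q]])
      show "(\<integral>\<^sup>+ X. ennreal ((u X)^2) \<partial>lebesgue_on (Q 1)) \<le> ennreal (M^2)"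
        using L2norm_le_D[OF u M] by simp
    qed
    also have "\<dots> \<le> ?c * M * l2 \<psi>" using cM(2) by (intro mult_right_mono) auto
    finally show ?thesis .
  qed
  have 2: "sqint ?F \<le> ennreal ((?c * M)^2)"
  proof -
    have "AE X in lebesgue_on (Q 2). \<bar>?F X\<bar> \<le> 1 * norm (k * norm (h X) + 8 * norm (g X))"
      using P0(2) diffusion_term_bound[OF \<delta> a open_Q h(1) h'] AE_in_set[OF open_imp_lebesgue[OF open_Q]]
    proof eventually_elim
      fix X assume p0: "p X = 0" and b: "\<bar>\<Sum>i\<in>UNIV. \<Sum>j\<in>UNIV. a (fst X) $ i $ j * h' X $ i $ j\<bar> \<le> inverse \<delta> * ?n^2 * norm (h X)"
        and X: "X \<in> (Q 2 :: 'n pt set)"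
      have "norm (fst (snd (snd X))) \<le> 8" using X by (cases X) (simp add: mem_Q2)
      then have "\<bar>\<Sum>i\<in>UNIV. fst (snd (snd X)) $ i * g X $ i\<bar> \<le> 8 * norm (g X)"
        using abs_sum_component_bound[of "fst (snd (snd X))" "g X"] mult_right_mono[of "norm (fst (snd (snd X)))" 8 "norm (g X)"] by simp
      moreover have "\<bar>f X\<bar> \<le> k * norm (h X)" using p0 b unfolding p k_def by simp
      ultimately have "\<bar>?F X\<bar> \<le> k * norm (h X) + 8 * norm (g X)" by linarith
      then show "\<bar>?F X\<bar> \<le> 1 * norm (k * norm (h X) + 8 * norm (g X))" by simp
    qed
    moreover have "(\<integral>\<^sup>+ X. ennreal ((norm (k * norm (h X) + 8 * norm (g X)))^2) \<partial>lebesgue_on (Q 2)) \<le> ennreal (((16 + 2 * k) * M)^2)"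
    proof -
      \<comment> \<open>\<open>128 = 2 * 8^2\<close>, from \<open>(x + y)^2 \<le> 2 x^2 + 2 y^2\<close>.\<close>
      define B where "B = (128::real)"
      have B: "0 \<le> B" by (simp add: B_def)
      have sq: "(norm (x + y))^2 \<le> 2 * x^2 + 2 * y^2" for x y :: real
        using sum_squares_bound[of x y] by (simp add: power2_sum)
      have "(norm (k * norm (h X) + 8 * norm (g X)))^2 \<le> (2 * k^2) * (norm (h X))^2 + B * (norm (g X))^2" for X
        using sq[of "k * norm (h X)" "8 * norm (g X)"] by (simp add: power_mult_distrib B_def)
      then have "ennreal ((norm (k * norm (h X) + 8 * norm (g X)))^2) \<le> ennreal ((2 * k^2) * (norm (h X))^2 + B * (norm (g X))^2)" for X
        by (rule ennreal_leI)
      also have "ennreal ((2 * k^2) * (norm (h X))^2 + B * (norm (g X))^2)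
        = ennreal (2 * k^2) * ennreal ((norm (h X))^2) + ennreal B * ennreal ((norm (g X))^2)" for X
        using B by (simp add: ennreal_mult ennreal_plus)
      finally have "(\<integral>\<^sup>+ X. ennreal ((norm (k * norm (h X) + 8 * norm (g X)))^2) \<partial>lebesgue_on (Q 2))
          \<le> (\<integral>\<^sup>+ X. ennreal (2 * k^2) * ennreal ((norm (h X))^2) + ennreal B * ennreal ((norm (g X))^2) \<partial>lebesgue_on (Q 2))"
        by (rule nn_integral_mono)
      also have "\<dots> = ennreal (2 * k^2) * (\<integral>\<^sup>+ X. ennreal ((norm (h X))^2) \<partial>lebesgue_on (Q 2))
          + ennreal B * (\<integral>\<^sup>+ X. ennreal ((norm (g X))^2) \<partial>lebesgue_on (Q 2))"
        using mg mh by (simp add: nn_integral_add nn_integral_cmult)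
      also have "\<dots> \<le> ennreal (2 * k^2) * ennreal (M^2) + ennreal B * ennreal (M^2)"
        by (intro add_mono mult_left_mono ig ih) auto
      also have "\<dots> = ennreal ((2 * k^2 + B) * M^2)"
        using B by (simp add: distrib_right ennreal_mult ennreal_plus)
      also have "\<dots> \<le> ennreal (((16 + 2 * k) * M)^2)"
      proof (rule ennreal_leI)
        have "2 * k^2 + B \<le> (16 + 2 * k)^2" using k0 by (simp add: power2_sum power_mult_distrib B_def)
        then show "(2 * k^2 + B) * M^2 \<le> ((16 + 2 * k) * M)^2"
          unfolding power_mult_distrib by (rule mult_right_mono) simp
      qed
      finally show ?thesis .
    qed
    moreover have "(\<lambda>X. (norm (k * norm (h X) + 8 * norm (g X)))^2) \<in> borel_measurable (lebesgue_on (Q 2))"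
    proof -
      have e: "norm v = sqrt ((norm v)^2)" for v :: "'b::real_normed_vector" by simp
      note mh[measurable] mg[measurable]
      have [measurable]: "(\<lambda>X. norm (h X)) \<in> borel_measurable (lebesgue_on (Q 2))"
        by (subst e) measurable
      have [measurable]: "(\<lambda>X. norm (g X)) \<in> borel_measurable (lebesgue_on (Q 2))"
        by (subst e) measurable
      show ?thesis by measurable
    qed
    ultimately have s: "sqint ?F \<le> ennreal ((1 * ((16 + 2 * k) * M))^2)"
      by (rule sqint_le[where h="\<lambda>X. k * norm (h X) + 8 * norm (g X)" and C=1, OF _ zero_le_one])
    have "0 \<le> 1 * ((16 + 2 * k) * M)" "1 * ((16 + 2 * k) * M) \<le> ?c * M" using cM(4) k0 M by simp_all
    with s show ?thesis by (rule sqint_mono)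
  qed
  have 3: "\<exists>g'. weak_deriv (Q 2) (\<lambda>_. in_z v) u g' \<and> sqint g' \<le> ennreal ((norm v * (?c * M))^2)" for v
  proof -
    have "sqint (\<lambda>X. \<Sum>i\<in>UNIV. v $ i * g X $ i) \<le> ennreal ((norm v * M)^2)"
      by (rule sqint_le[OF AE_I2 _ ig mg]) (simp_all add: abs_sum_component_bound)
    moreover have "0 \<le> norm v * M" "norm v * M \<le> norm v * (?c * M)" using M cM(2) by (simp_all add: mult_left_mono)
    ultimately have "sqint (\<lambda>X. \<Sum>i\<in>UNIV. v $ i * g X $ i) \<le> ennreal ((norm v * (?c * M))^2)"
      by (rule sqint_mono)
    then show ?thesis using weak_directional_z[OF open_Q g(1), of v] by blast
  qed
  have 4: "\<exists>g' k. weak_deriv (Q 2) (\<lambda>_. in_x v) u g' \<and> weak_deriv (Q 2) (\<lambda>_. in_x v) g' k \<and>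
      sqint k \<le> ennreal (((norm v)^2 * (?c * M))^2)" for v
  proof -
    let ?K = "\<lambda>X. \<Sum>i\<in>UNIV. v $ i * (\<Sum>j\<in>UNIV. v $ j * h X $ i $ j)"
    have "sqint ?K \<le> ennreal ((((norm v)^2 * ?n) * M)^2)"
      by (rule sqint_le[OF AE_I2 _ ih mh]) (simp_all add: abs_second_directional_bound)
    moreover have "0 \<le> ((norm v)^2 * ?n) * M" using M by simp
    moreover have "((norm v)^2 * ?n) * M \<le> (norm v)^2 * (?c * M)"
      using mult_left_mono[OF cM(3), of "(norm v)^2"] by (simp add: mult.assoc)
    ultimately have "sqint ?K \<le> ennreal (((norm v)^2 * (?c * M))^2)"
      by (rule sqint_mono)
    then show ?thesis using weak_second_directional_x[OF open_Q h(1), of v] by blast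
  qed
  show ?thesis unfolding controlled_def
  proof (intro conjI allI impI)
    show "\<exists>f. weak_deriv (Q 2) (\<lambda>X. e_t + xdy X) u f \<and> sqint f \<le> ennreal ((?c * M)^2)"
      using weak_deriv_flat_transport[OF open_Q f g(1)] 2 by blast
  qed (use cM(1) lu 1 3 4 in auto)
qed

theorem lemma3p5:
  fixes \<delta> :: real
  assumes "0 < \<delta>" and "\<delta> < 1"
  shows "\<exists>N::real. N > 0 \<and>
    (\<forall>(a :: real \<Rightarrow> real^'n^'n::finite) (u :: 'n pt \<Rightarrow> real).
       admissible_coeff \<delta> a \<longrightarrow>
       u \<in> S2 (Q 2) \<longrightarrow>
       (\<exists>p. weak_P0 a (Q 2) u p \<and> (AE X in lebesgue_on (Q 2). p X = 0)) \<longrightarrow>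
       L2norm (Q 2) u \<le>
         ennreal N * (L2norm (Q 1) u + grad_z_L2norm (Q 2) u + hess_x_L2norm (Q 2) u))"
proof -
  obtain N0 where N0: "N0 \<ge> 0" "\<forall>(u :: 'n pt \<Rightarrow> real) M. controlled u M \<longrightarrow> sqint u \<le> ennreal (N0 * M^2)"
    using controlled_L2_bound[where 'n='n] by (elim exE conjE)
  let ?c = "kinetic_const (real CARD('n)) \<delta>"
  have c: "?c > 0" using assms(1) unfolding kinetic_const_def by (simp add: add_pos_nonneg)
  define C where "C = sqrt N0 * ?c + 1"
  have C: "C > 0" using N0(1) c by (simp add: C_def add_nonneg_pos)
  show ?thesis
  proof (intro exI[of _ C] conjI C allI impI)
    fix a :: "real \<Rightarrow> real^'n^'n" and u :: "'n pt \<Rightarrow> real"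
    assume a: "admissible_coeff \<delta> a" and "u \<in> S2 (Q 2)"
      and "\<exists>p. weak_P0 a (Q 2) u p \<and> (AE X in lebesgue_on (Q 2). p X = 0)"
    then obtain p where p: "weak_P0 a (Q 2) u p" "AE X in lebesgue_on (Q 2). p X = 0" by (elim exE conjE)
    let ?R = "L2norm (Q 1) u + grad_z_L2norm (Q 2) u + hess_x_L2norm (Q 2) u"
    \<comment> \<open>With \<open>M\<close> strictly above the infima on the right there are derivatives of norm less than \<open>M\<close>.\<close>
    have bound: "L2norm (Q 2) u \<le> ennreal (C * M)" if R: "?R < ennreal M" and M: "0 \<le> M" for M
    proof -
      have "L2norm (Q 1) u \<le> ?R" by (simp add: add.assoc)
      then have u1: "L2norm (Q 1) u \<le> ennreal M" using less_imp_le[OF R] by (rule order_trans)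
      have "grad_z_L2norm (Q 2) u \<le> ?R" by (simp add: add.assoc add_increasing)
      then have "grad_z_L2norm (Q 2) u < ennreal M" using R by (rule le_less_trans)
      then obtain g where g: "weak_grad_z (Q 2) u g" "L2norm (Q 2) g < ennreal M"
        unfolding grad_z_L2norm_def INF_less_iff mem_Collect_eq by (elim bexE CollectE)
      have "hess_x_L2norm (Q 2) u \<le> ?R" by (simp add: add_increasing)
      then have "hess_x_L2norm (Q 2) u < ennreal M" using R by (rule le_less_trans)
      then obtain h where h: "weak_hess_x (Q 2) u h" "L2norm (Q 2) h < ennreal M"
        unfolding hess_x_L2norm_def INF_less_iff mem_Collect_eq by (elim bexE CollectE)
      have ctrl: "controlled u (?c * M)"
        by (rule solution_controlled[OF assms(1) a p M u1 g(1) less_imp_le[OF g(2)] h(1) less_imp_le[OF h(2)]])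
      have "sqint u \<le> ennreal (N0 * (?c * M)^2)" by (rule N0(2)[rule_format, OF ctrl])
      also have "N0 * (?c * M)^2 = (sqrt N0 * (?c * M))^2" using N0(1) by (simp add: power_mult_distrib)
      finally have "L2norm (Q 2) u \<le> ennreal (sqrt N0 * (?c * M))"
        using N0(1) c M by (intro L2norm_leI) (simp_all add: sqint_def)
      also have "\<dots> \<le> ennreal (C * M)" using M by (intro ennreal_leI) (simp add: C_def algebra_simps)
      finally show ?thesis .
    qed
    show "L2norm (Q 2) u \<le> ennreal C * ?R"
    proof (cases "?R = top")
      case True
      have "ennreal C * top = top" using C by (simp add: ennreal_mult_top)
      then show ?thesis unfolding True by simp
    next
      case False
      then obtain S where S: "0 \<le> S" "?R = ennreal S" by (cases ?R) auto
      have fin: "L2norm (Q 2) u \<le> ennreal (C * (S + e))" if "e > 0" for e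
        using bound[of "S + e"] S that by (simp add: ennreal_less_iff)
      from fin[of 1] obtain r where r: "0 \<le> r" "L2norm (Q 2) u = ennreal r"
        by (cases "L2norm (Q 2) u") (auto simp: top_unique)
      have "r \<le> C * S"
      proof (rule field_le_epsilon)
        fix e :: real assume e: "0 < e"
        have "ennreal r \<le> ennreal (C * (S + e / C))" using fin[of "e / C"] e C r by simp
        moreover have "0 \<le> C * (S + e / C)" using C S e by simp
        ultimately have "r \<le> C * (S + e / C)" by (simp add: ennreal_le_iff)
        then show "r \<le> C * S + e" using C by (simp add: distrib_left)
      qed
      then show ?thesis unfolding r S using C S by (simp add: ennreal_leI flip: ennreal_mult)
    qed
  qed
qed

end
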